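(* Let $\delta:\mathcal{B}\to B$ be any derivation. Then there exist a unique $c_0\in\mathbb{C}$ and a unique $\varphi$-invariant derivation $\partial:\mathcal{F}\to C(G)$ such that $$\delta(b)=c_0[\mathbb{L},b]+\delta_\partial(b)+\tilde\delta(b),\qquad b\in\mathcal{B},$$ where $\tilde\delta:\mathcal{B}\to B$ is an approximately inner derivation (also uniquely determined), and $\delta_\partial:\mathcal{B}\to B$ is the unique derivation with $\delta_\partial(V)=0$ and $\delta_\partial(M_f)=M_{\partial f}$ for $f\in\mathcal{F}$.
   Context: Setup: $G$ is an infinite compact (Hausdorff) abelian group, written additively, and $x_1\in G$ generates a dense cyclic subgroup; $x_n=nx_1$, $\varphi(x)=x+x_1$. $\widehat G$ is the group of continuous characters of $G$ and $\mathcal{F}$ is the linear span of $\widehat G$ in $C(G)$ (note $f\circ\varphi\in\mathcal F$ for $f\in\mathcal F$). Let $H=\ell^2(\mathbb{Z})$ with canonical basis $\{E_l\}$; $VE_l=E_{l+1}$, $M_fE_l=f(x_l)E_l$ for $f\in C(G)$, $\mathbb{L}E_l=lE_l$. $B=C^*(V,M_f:f\in C(G))$ and $\mathcal{B}$ is the $*$-subalgebra generated by $V,V^{-1},M_\chi$ ($\chi\in\widehat G$). A derivation is a linear map satisfying the Leibniz rule; a $\varphi$-invariant derivation $\partial:\mathcal F\to C(G)$ is a derivation with $(\partial f)\circ\varphi=\partial(f\circ\varphi)$ for all $f\in\mathcal F$. A derivation $\tilde\delta:\mathcal{B}\to B$ is approximately inner if there are $y_j\in B$ with $\tilde\delta(b)=\lim_j[y_j,b]$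 in norm for all $b\in\mathcal{B}$. *)

theory Defs
  imports "HOL-Analysis.Analysis"
begin

definition gmult :: "int \<Rightarrow> 'g::ab_group_add \<Rightarrow> 'g" where
  "gmult n x = (if 0 \<le> n then (((+) x) ^^ nat n) 0 else - ((((+) x) ^^ nat (- n)) 0))"

definition character :: "('g::{topological_ab_group_add} \<Rightarrow> complex) \<Rightarrow> bool" where
  "character ch \<longleftrightarrow> continuous_on UNIV ch \<and> (\<forall>x y. ch (x + y) = ch x * ch y)
      \<and> (\<forall>x. cmod (ch x) = 1)"

definition CG :: "('g::topological_space \<Rightarrow> complex) set" where
  "CG = {f. continuous_on UNIV f}"

definition Fspan :: "('g::topological_ab_group_add \<Rightarrow> complex) set" where
  "Fspan = {f. \<exists>S c. finite S \<and> S \<subseteq> {ch. character ch} \<and>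
                     f = (\<lambda>x. \<Sum>ch\<in>S. c ch * ch x)}"

definition phi_inv_derivation :: "'g::topological_ab_group_add \<Rightarrow> (('g \<Rightarrow> complex) \<Rightarrow> ('g \<Rightarrow> complex)) \<Rightarrow> bool" where
  "phi_inv_derivation x1 D \<longleftrightarrow>
     (\<forall>f\<in>Fspan. D f \<in> CG) \<and>
     (\<forall>f\<in>Fspan. \<forall>g\<in>Fspan. D (\<lambda>x. f x + g x) = (\<lambda>x. D f x + D g x)) \<and>
     (\<forall>f\<in>Fspan. \<forall>c. D (\<lambda>x. c * f x) = (\<lambda>x. c * D f x)) \<and>
     (\<forall>f\<in>Fspan. \<forall>g\<in>Fspan. D (\<lambda>x. f x * g x) = (\<lambda>x. D f x * g x + f x * D g x)) \<and>
     (\<forall>f\<in>Fspan. (\<lambda>x. D f (x + x1)) = D (\<lambda>x. f (x + x1)))"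

type_synonym vec = "int \<Rightarrow> complex"
type_synonym op = "vec \<Rightarrow> vec"

definition l2 :: "vec \<Rightarrow> bool" where
  "l2 x \<longleftrightarrow> (\<lambda>i. (cmod (x i))\<^sup>2) summable_on UNIV"

definition l2norm :: "vec \<Rightarrow> real" where
  "l2norm x = sqrt (\<Sum>\<^sub>\<infinity>i. (cmod (x i))\<^sup>2)"

definition l2inner :: "vec \<Rightarrow> vec \<Rightarrow> complex" where
  "l2inner x y = (\<Sum>\<^sub>\<infinity>i. x i * cnj (y i))"

text \<open>Bounded linear operators on l2(Z); an operator is a function on all of
  int => complex that is linear and bounded on l2 and (normalisation) is zero
  off l2, so that equality of operators is equality of functions.\<close>
definition bop :: "op \<Rightarrow> bool" where
  "bop T \<longleftrightarrow> (\<forall>x. \<not> l2 x \<longrightarrow> T x = (\<lambda>_. 0)) \<and> (\<forall>x. l2 x \<longrightarrow> l2 (T x)) \<and>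
     (\<forall>x y. l2 x \<longrightarrow> l2 y \<longrightarrow> T (\<lambda>i. x i + y i) = (\<lambda>i. T x i + T y i)) \<and>
     (\<forall>x c. l2 x \<longrightarrow> T (\<lambda>i. c * x i) = (\<lambda>i. c * T x i)) \<and>
     (\<exists>K. \<forall>x. l2 x \<longrightarrow> l2norm (T x) \<le> K * l2norm x)"

definition opnorm :: "op \<Rightarrow> real" where
  "opnorm T = Sup {l2norm (T x) | x. l2 x \<and> l2norm x \<le> 1}"

definition op_add :: "op \<Rightarrow> op \<Rightarrow> op" where
  "op_add T S = (\<lambda>x i. T x i + S x i)"

definition op_sub :: "op \<Rightarrow> op \<Rightarrow> op" where
  "op_sub T S = (\<lambda>x i. T x i - S x i)"

definition op_scale :: "complex \<Rightarrow> op \<Rightarrow> op" where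
  "op_scale c T = (\<lambda>x i. c * T x i)"

definition op_comp :: "op \<Rightarrow> op \<Rightarrow> op" where
  "op_comp T S = (\<lambda>x. T (S x))"

definition adj :: "op \<Rightarrow> op" where
  "adj T = (SOME S. bop S \<and> (\<forall>x y. l2 x \<longrightarrow> l2 y \<longrightarrow> l2inner (T x) y = l2inner x (S y)))"

definition commutator :: "op \<Rightarrow> op \<Rightarrow> op" where
  "commutator T S = op_sub (op_comp T S) (op_comp S T)"

text \<open>Shift V E_l = E_(l+1), its inverse, multiplication operators M_f E_l = f(x_l) E_l.\<close>
definition Vop :: op where
  "Vop x = (if l2 x then (\<lambda>l. x (l - 1)) else (\<lambda>_. 0))"

definition Vinv :: op where
  "Vinv x = (if l2 x then (\<lambda>l. x (l + 1)) else (\<lambda>_. 0))"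

definition Mop :: "'g::ab_group_add \<Rightarrow> ('g \<Rightarrow> complex) \<Rightarrow> op" where
  "Mop x1 f x = (if l2 x then (\<lambda>l. f (gmult l x1) * x l) else (\<lambda>_. 0))"

text \<open>The commutator [L, b] with the unbounded operator L E_l = l E_l, as the bounded
  operator agreeing with L b - b L on finitely supported vectors.\<close>
definition commL :: "op \<Rightarrow> op" where
  "commL b = (SOME T. bop T \<and> (\<forall>x. finite {i. x i \<noteq> 0} \<longrightarrow>
       T x = (\<lambda>l. of_int l * b x l - b (\<lambda>i. of_int i * x i) l)))"

inductive_set star_alg :: "op set \<Rightarrow> op set" for S :: "op set" where
  gen: "T \<in> S \<Longrightarrow> T \<in> star_alg S"
| add: "T \<in> star_alg S \<Longrightarrow> U \<in> star_alg S \<Longrightarrow> op_add T U \<in> star_alg S"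
| scale: "T \<in> star_alg S \<Longrightarrow> op_scale c T \<in> star_alg S"
| comp: "T \<in> star_alg S \<Longrightarrow> U \<in> star_alg S \<Longrightarrow> op_comp T U \<in> star_alg S"
| adjoint: "T \<in> star_alg S \<Longrightarrow> adj T \<in> star_alg S"

definition norm_closure :: "op set \<Rightarrow> op set" where
  "norm_closure A = {T. bop T \<and> (\<forall>e>0. \<exists>U\<in>A. opnorm (op_sub T U) < e)}"

definition Balg :: "'g::topological_ab_group_add \<Rightarrow> op set" where
  "Balg x1 = norm_closure (star_alg ({Vop} \<union> {Mop x1 f | f. f \<in> CG}))"

definition Bcal :: "'g::topological_ab_group_add \<Rightarrow> op set" where
  "Bcal x1 = star_alg ({Vop, Vinv} \<union> {Mop x1 ch | ch. character ch})"

definition derivation :: "'g::topological_ab_group_add \<Rightarrow> (op \<Rightarrow> op) \<Rightarrow> bool" where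
  "derivation x1 d \<longleftrightarrow>
     (\<forall>b\<in>Bcal x1. d b \<in> Balg x1) \<and>
     (\<forall>a\<in>Bcal x1. \<forall>b\<in>Bcal x1. d (op_add a b) = op_add (d a) (d b)) \<and>
     (\<forall>a\<in>Bcal x1. \<forall>c. d (op_scale c a) = op_scale c (d a)) \<and>
     (\<forall>a\<in>Bcal x1. \<forall>b\<in>Bcal x1. d (op_comp a b) = op_add (op_comp (d a) b) (op_comp a (d b)))"

text \<open>Approximately inner: d b = lim_j [y_j, b] in norm for a net (y_j) in B;
  the net is represented by a proper filter on operators.\<close>
definition approx_inner :: "'g::topological_ab_group_add \<Rightarrow> (op \<Rightarrow> op) \<Rightarrow> bool" where
  "approx_inner x1 d \<longleftrightarrow> (\<exists>F::op filter. F \<noteq> bot \<and> eventually (\<lambda>y. y \<in> Balg x1) F \<and>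
      (\<forall>b\<in>Bcal x1. \<forall>e>0. eventually (\<lambda>y. opnorm (op_sub (commutator y b) (d b)) < e) F))"

definition decomposition ::
  "'g::topological_ab_group_add \<Rightarrow> (op \<Rightarrow> op) \<Rightarrow> complex \<Rightarrow> (('g \<Rightarrow> complex) \<Rightarrow> ('g \<Rightarrow> complex))
     \<Rightarrow> (op \<Rightarrow> op) \<Rightarrow> (op \<Rightarrow> op) \<Rightarrow> bool" where
  "decomposition x1 d c0 D dD dt \<longleftrightarrow>
     phi_inv_derivation x1 D \<and>
     derivation x1 dD \<and> dD Vop = (\<lambda>_ _. 0) \<and> (\<forall>f\<in>Fspan. dD (Mop x1 f) = Mop x1 (D f)) \<and>
     derivation x1 dt \<and> approx_inner x1 dt \<and>
     (\<forall>b\<in>Bcal x1. d b = op_add (op_add (op_scale c0 (commL b)) (dD b)) (dt b))"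

end

theory Submission
  imports Defs
begin

text \<open>
  Write \<open>x\<^sub>l = l x\<^sub>1\<close> and split an operator on \<open>\<ell>\<^sup>2(\<int>)\<close> into its diagonals.  The \<open>n\<close>-th diagonal of an
  element of \<open>B\<close> is \<open>V\<^sup>n M\<^sub>f\<close> with \<open>f\<close> continuous, and Fejer means recover the element in norm.
  On the diagonals \<open>n \<noteq> 0\<close> the relations between the generators force \<open>\<delta>\<close> to be the commutator with
  some \<open>V\<^sup>n M\<^sub>h\<close>, because a character \<open>\<psi>\<close> with \<open>\<psi>(x\<^sub>n) \<noteq> 1\<close> exists.  On the main diagonal
  \<open>f \<mapsto> \<delta>(M\<^sub>f)\<close> is an invariant derivation, and the diagonal of \<open>\<delta>(V) V\<^sup>-\<^sup>1\<close> is its mean value \<open>c\<^sub>0\<close>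
  up to uniform limits of coboundaries of the rotation.  Fejer means of the formal sum of the
  \<open>V\<^sup>n M\<^sub>h\<close>, with an approximate primitive on the main diagonal, are the required net.
  Commutators with \<open>M\<^sub>f\<close> vanish on the main diagonal, and those with \<open>V\<close> telescope there,
  which gives uniqueness.

  Characters that separate points are obtained without Haar measure: a nonzero continuous \<open>g\<close> on the
  orbit has exponential sums \<open>\<Sum>\<^sub>l\<^sub><\<^sub>N g(x\<^sub>l) z\<^sup>l\<close> of size proportional to \<open>N\<close> for some \<open>z = z\<^sub>N\<close> on the unit
  circle, and a limit point \<open>z\<close> of the \<open>z\<^sub>N\<close> makes \<open>x\<^sub>l \<mapsto> z\<^sup>l\<close> uniformly continuous.
\<close>

section \<open>Square-summable sequences and bounded operators\<close>

text \<open>The sum over n of the operators \<open>VM n (h n)\<close> is only formal: nothing makes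
  it converge to an element of B. Only its commutators with the generators are under control.
  Commutation with \<open>Mop x1 f\<close> rescales each entry, and commutation with
  \<open>Vop\<close>, followed by \<open>Vinv\<close>, takes differences along each diagonal;
  neither mixes diagonals. Fejer weights put on the sum therefore reappear as Fejer weights on a
  value of the derivation, which lies in B, and there the means converge in norm. The derivation is
  not assumed continuous, so convergence is shown on generators and carried to all of
  \<open>Bcal x1\<close> by the Leibniz rule. A sharp cut-off of the diagonals would not do, because
  its norms grow with the cut-off, while the Fejer multiplier is a contraction. The main diagonal
  escapes this scheme, since diagonal operators commute with \<open>Mop x1 f\<close>. What remains
  there is the equation H(x + x1) - H(x) = G(x) - c0, which in general has no continuous solution H
  but can be solved up to a uniformly small error once c0 is the mean of G.\<close>

lemma l2I:
  assumes "\<And>F. finite F \<Longrightarrow> L2_set (\<lambda>i. cmod (x i)) F \<le> K"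
  shows "l2 x" and "l2norm x \<le> K"
proof -
  have K: "0 \<le> K" using assms[of "{}"] by simp
  have fin: "(\<Sum>i\<in>F. (cmod (x i))\<^sup>2) \<le> K\<^sup>2" if "finite F" for F
  proof -
    have "(\<Sum>i\<in>F. (cmod (x i))\<^sup>2) = (L2_set (\<lambda>i. cmod (x i)) F)\<^sup>2"
      by (simp add: L2_set_def sum_nonneg)
    also have "\<dots> \<le> K\<^sup>2" using assms[OF that] by (intro power_mono) auto
    finally show ?thesis .
  qed
  show l2: "l2 x" unfolding l2_def
    by (rule nonneg_bounded_partial_sums_imp_summable_on[where C="K\<^sup>2"])
       (auto intro!: eventually_finite_subsets_at_top_weakI fin)
  have "(\<Sum>\<^sub>\<infinity>i. (cmod (x i))\<^sup>2) \<le> K\<^sup>2"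
    using l2 unfolding l2_def by (rule infsum_le_finite_sums) (use fin in auto)
  then show "l2norm x \<le> K" unfolding l2norm_def
    using K real_le_lsqrt by blast
qed

lemma l2norm_nonneg: "0 \<le> l2norm x"
  unfolding l2norm_def by (auto intro: infsum_nonneg)

lemma L2_set_le_l2norm:
  assumes "l2 x"
  shows "L2_set (\<lambda>i. cmod (x i)) F \<le> l2norm x"
proof (cases "finite F")
  case True
  then have "(\<Sum>i\<in>F. (cmod (x i))\<^sup>2) \<le> (\<Sum>\<^sub>\<infinity>i. (cmod (x i))\<^sup>2)"
    using assms unfolding l2_def by (intro finite_sum_le_infsum) auto
  then show ?thesis unfolding L2_set_def l2norm_def by simp
qed (simp add: l2norm_nonneg)

lemma cmod_le_l2norm: "l2 x \<Longrightarrow> cmod (x i) \<le> l2norm x"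
  using L2_set_le_l2norm[of x "{i}"] by simp

lemma l2_add:
  assumes "l2 x" "l2 y"
  shows "l2 (\<lambda>i. x i + y i)" and "l2norm (\<lambda>i. x i + y i) \<le> l2norm x + l2norm y"
proof -
  have *: "L2_set (\<lambda>i. cmod (x i + y i)) F \<le> l2norm x + l2norm y" if "finite F" for F
  proof -
    have "L2_set (\<lambda>i. cmod (x i + y i)) F \<le> L2_set (\<lambda>i. cmod (x i) + cmod (y i)) F"
      by (intro L2_set_mono norm_triangle_ineq) auto
    also have "\<dots> \<le> L2_set (\<lambda>i. cmod (x i)) F + L2_set (\<lambda>i. cmod (y i)) F"
      by (rule L2_set_triangle_ineq)
    also have "\<dots> \<le> l2norm x + l2norm y"
      by (intro add_mono L2_set_le_l2norm assms)
    finally show ?thesis .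
  qed
  show "l2 (\<lambda>i. x i + y i)" by (rule l2I(1), rule *)
  show "l2norm (\<lambda>i. x i + y i) \<le> l2norm x + l2norm y" by (rule l2I(2), rule *)
qed

lemma l2_scale:
  assumes "l2 x"
  shows "l2 (\<lambda>i. c * x i)" and "l2norm (\<lambda>i. c * x i) \<le> cmod c * l2norm x"
proof -
  have *: "L2_set (\<lambda>i. cmod (c * x i)) F \<le> cmod c * l2norm x" if "finite F" for F
    using mult_left_mono[OF L2_set_le_l2norm[OF assms, of F], of "cmod c"]
    by (simp add: norm_mult L2_set_right_distrib)
  show "l2 (\<lambda>i. c * x i)" by (rule l2I(1), rule *)
  show "l2norm (\<lambda>i. c * x i) \<le> cmod c * l2norm x" by (rule l2I(2), rule *)
qed

lemma l2_zero: "l2 (\<lambda>_. 0)" and l2norm_zero: "l2norm (\<lambda>_. 0) = 0"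
  by (auto simp: l2_def l2norm_def)

lemma l2_diff:
  assumes "l2 x" "l2 y"
  shows "l2 (\<lambda>i. x i - y i)" and "l2norm (\<lambda>i. x i - y i) \<le> l2norm x + l2norm y"
  using l2_add[OF assms(1) l2_scale(1)[OF assms(2), of "-1"]] l2_scale(2)[OF assms(2), of "-1"]
  by simp_all

lemma l2_dominated:
  assumes "l2 x" "\<And>i. cmod (y i) \<le> cmod (x i)"
  shows "l2 y" and "l2norm y \<le> l2norm x"
proof -
  have *: "L2_set (\<lambda>i. cmod (y i)) F \<le> l2norm x" if "finite F" for F
    by (rule order_trans[OF L2_set_mono L2_set_le_l2norm[OF assms(1)]]) (auto simp: assms(2))
  show "l2 y" by (rule l2I(1), rule *)
  show "l2norm y \<le> l2norm x" by (rule l2I(2), rule *)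
qed

lemma finite_support_norm_le:
  assumes "finite A" "\<And>i. i \<notin> A \<Longrightarrow> x i = 0"
  shows "l2 x" and "l2norm x \<le> L2_set (\<lambda>i. cmod (x i)) A"
proof -
  have *: "L2_set (\<lambda>i. cmod (x i)) F \<le> L2_set (\<lambda>i. cmod (x i)) A" if "finite F" for F
  proof -
    have "(\<Sum>i\<in>F. (cmod (x i))\<^sup>2) = (\<Sum>i\<in>F \<inter> A. (cmod (x i))\<^sup>2)"
      by (rule sum.mono_neutral_right) (use that assms(2) in auto)
    also have "\<dots> \<le> (\<Sum>i\<in>A. (cmod (x i))\<^sup>2)"
      by (rule sum_mono2) (use assms(1) in auto)
    finally show ?thesis by (simp add: L2_set_def)
  qed
  show "l2 x" by (rule l2I(1), rule *)
  show "l2norm x \<le> L2_set (\<lambda>i. cmod (x i)) A" by (rule l2I(2), rule *)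
qed

lemma l2_tail:
  assumes "l2 x" "e > 0"
  obtains F where "finite F" "l2norm (\<lambda>i. if i \<in> F then 0 else x i) < e"
proof -
  let ?f = "\<lambda>i. (cmod (x i))\<^sup>2"
  \<comment> \<open>The tolerance e^2/4 leaves room for the strict inequality: \<open>l2I\<close>
    only yields the bound e/2.\<close>
  obtain F where F: "finite F" "dist (sum ?f F) (infsum ?f UNIV) \<le> e\<^sup>2 / 4"
    using infsum_finite_approximation[of ?f UNIV "e\<^sup>2/4"] assms unfolding l2_def by auto
  have "L2_set (\<lambda>i. cmod (if i \<in> F then 0 else x i)) G \<le> e / 2" if "finite G" for G
  proof -
    have "(\<Sum>i\<in>G. (cmod (if i \<in> F then 0 else x i))\<^sup>2) = sum ?f (G - F)"
      by (rule sum.mono_neutral_cong_right) (use that in auto)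
    also have "\<dots> = sum ?f (G \<union> F) - sum ?f F"
      by (subst sum_Un) (use that F in \<open>auto simp: sum_diff1 sum.Int_Diff[of G _ F]\<close>)
    also have "\<dots> \<le> infsum ?f UNIV - sum ?f F"
      using assms that F unfolding l2_def by (intro diff_right_mono finite_sum_le_infsum) auto
    also have "\<dots> \<le> e\<^sup>2 / 4" using F(2) unfolding dist_real_def by linarith
    also have "\<dots> = (e/2)\<^sup>2" by (simp add: power2_eq_square)
    finally show ?thesis
      unfolding L2_set_def using assms(2) by (intro real_le_lsqrt) (auto intro: sum_nonneg)
  qed
  then have "l2norm (\<lambda>i. if i \<in> F then 0 else x i) \<le> e / 2" by (rule l2I(2))
  then show ?thesis using F(1) assms(2) that by force
qed

section \<open>Matrix entries, bounded operators and the operator norm\<close>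

definition Evec :: "int \<Rightarrow> vec" where "Evec j = (\<lambda>i. if i = j then 1 else 0)"

text \<open>Row \<open>i\<close>, column \<open>j\<close>; the diagonal of index n consists of the
  entries with i - j = n.\<close>

definition ent :: "op \<Rightarrow> int \<Rightarrow> int \<Rightarrow> complex" where "ent T i j = T (Evec j) i"

lemma l2_Evec: "l2 (Evec j)" and l2norm_Evec: "l2norm (Evec j) \<le> 1"
  using finite_support_norm_le[of "{j}" "Evec j"] by (auto simp: Evec_def)

lemma
  assumes "bop T"
  shows bop_off: "\<not> l2 x \<Longrightarrow> T x = (\<lambda>_. 0)"
    and bop_l2: "l2 x \<Longrightarrow> l2 (T x)"
    and bop_add: "l2 x \<Longrightarrow> l2 y \<Longrightarrow> T (\<lambda>i. x i + y i) = (\<lambda>i. T x i + T y i)"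
    and bop_scale: "l2 x \<Longrightarrow> T (\<lambda>i. c * x i) = (\<lambda>i. c * T x i)"
  using assms unfolding bop_def by blast+

lemma bop_zero: "bop T \<Longrightarrow> T (\<lambda>_. 0) = (\<lambda>_. 0)"
  using bop_scale[of T "\<lambda>_. 0" 0] l2_zero by simp

lemma bop_l2': "bop T \<Longrightarrow> l2 (T x)"
  using bop_l2 bop_off l2_zero by (cases "l2 x") auto

lemma bopI:
  assumes "\<And>x. \<not> l2 x \<Longrightarrow> T x = (\<lambda>_. 0)"
    and "\<And>x y. l2 x \<Longrightarrow> l2 y \<Longrightarrow> T (\<lambda>i. x i + y i) = (\<lambda>i. T x i + T y i)"
    and "\<And>x c. l2 x \<Longrightarrow> T (\<lambda>i. c * x i) = (\<lambda>i. c * T x i)"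
    and "\<And>x. l2 x \<Longrightarrow> l2 (T x) \<and> l2norm (T x) \<le> K * l2norm x"
  shows "bop T"
  unfolding bop_def using assms by blast

lemma l2norm_eq_0: "l2 x \<Longrightarrow> l2norm x \<le> 0 \<Longrightarrow> x = (\<lambda>_. 0)"
  using cmod_le_l2norm by (metis ext norm_le_zero_iff order_trans)

lemma l2norm_apply_le:
  assumes T: "bop T" and x: "l2 x"
  shows "l2norm (T x) \<le> opnorm T * l2norm x"
proof (cases "l2norm x = 0")
  case True
  then show ?thesis using l2norm_eq_0[OF x] bop_zero[OF T] by (simp add: l2norm_zero)
next
  case False
  let ?n = "l2norm x"
  have n: "?n > 0" using False l2norm_nonneg[of x] by linarith
  let ?c = "complex_of_real (1 / ?n)"
  have xs: "l2 (\<lambda>i. ?c * x i)" "l2norm (\<lambda>i. ?c * x i) \<le> 1"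
    using l2_scale[OF x, of ?c] n by (auto simp: norm_divide)
  obtain K where K: "\<forall>x. l2 x \<longrightarrow> l2norm (T x) \<le> K * l2norm x" using T unfolding bop_def by blast
  have "l2norm (T x) \<le> \<bar>K\<bar>" if "l2 x" "l2norm x \<le> 1" for x
  proof -
    have "l2norm (T x) \<le> K * l2norm x" using K that by blast
    also have "\<dots> \<le> \<bar>K\<bar> * l2norm x" by (intro mult_right_mono l2norm_nonneg) auto
    also have "\<dots> \<le> \<bar>K\<bar> * 1" using that by (intro mult_left_mono) auto
    finally show ?thesis by simp
  qed
  then have bdd: "bdd_above {l2norm (T x) | x. l2 x \<and> l2norm x \<le> 1}"
    unfolding bdd_above_def by blast
  have "l2norm (T (\<lambda>i. ?c * x i)) \<le> opnorm T"
    unfolding opnorm_def by (rule cSup_upper[OF _ bdd]) (use xs in blast)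
  moreover have "l2norm (T x) \<le> ?n * l2norm (T (\<lambda>i. ?c * x i))"
    using l2_scale(2)[OF bop_l2[OF T xs(1)], of "of_real ?n"] n
    by (simp add: bop_scale[OF T x, of ?c] mult.assoc[symmetric] del: of_real_divide flip: of_real_mult)
  ultimately have "l2norm (T x) \<le> ?n * opnorm T"
    using n by (meson less_imp_le mult_left_mono order_trans)
  then show ?thesis by (simp add: mult.commute)
qed

lemma opnorm_leI:
  assumes "\<And>x. l2 x \<Longrightarrow> l2norm x \<le> 1 \<Longrightarrow> l2norm (T x) \<le> K"
  shows "opnorm T \<le> K"
  unfolding opnorm_def
  by (rule cSup_least) (use assms l2_zero l2norm_zero in \<open>auto intro!: exI[of _ "\<lambda>_. 0"]\<close>)

lemma opnorm_le_multI:
  assumes "\<And>x. l2 x \<Longrightarrow> l2norm (T x) \<le> K * l2norm x" "0 \<le> K"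
  shows "opnorm T \<le> K"
  by (rule opnorm_leI) (use assms in \<open>metis mult_left_le order_trans\<close>)

lemma opnorm_nonneg:
  assumes "bop T" shows "0 \<le> opnorm T"
proof -
  have "1 \<le> l2norm (Evec 0)"
    using cmod_le_l2norm[OF l2_Evec, of 0 0] by (simp add: Evec_def)
  moreover have "0 \<le> opnorm T * l2norm (Evec 0)"
    using l2norm_apply_le[OF assms l2_Evec] l2norm_nonneg order_trans by blast
  ultimately show ?thesis by (simp add: zero_le_mult_iff)
qed

lemma cmod_ent_le:
  assumes "bop T" shows "cmod (ent T i j) \<le> opnorm T"
proof -
  have "cmod (ent T i j) \<le> l2norm (T (Evec j))"
    unfolding ent_def by (rule cmod_le_l2norm[OF bop_l2[OF assms l2_Evec]])
  also have "\<dots> \<le> opnorm T * l2norm (Evec j)" by (rule l2norm_apply_le[OF assms l2_Evec])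
  also have "\<dots> \<le> opnorm T" using l2norm_Evec opnorm_nonneg[OF assms] by (rule mult_left_le)
  finally show ?thesis .
qed

lemma bop_op_add:
  assumes "bop T" "bop S"
  shows "bop (op_add T S)" and "opnorm (op_add T S) \<le> opnorm T + opnorm S"
proof -
  have *: "l2 (op_add T S x)" "l2norm (op_add T S x) \<le> (opnorm T + opnorm S) * l2norm x" if "l2 x" for x
    using l2_add[OF bop_l2[OF assms(1) that] bop_l2[OF assms(2) that]]
      l2norm_apply_le[OF assms(1) that] l2norm_apply_le[OF assms(2) that]
    by (auto simp: op_add_def distrib_right)
  show "bop (op_add T S)"
    by (rule bopI[where K="opnorm T + opnorm S"])
       (use * in \<open>auto simp: op_add_def bop_off[OF assms(1)] bop_off[OF assms(2)]
          bop_add[OF assms(1)] bop_add[OF assms(2)] bop_scale[OF assms(1)] bop_scale[OF assms(2)] algebra_simps\<close>)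
  show "opnorm (op_add T S) \<le> opnorm T + opnorm S"
    by (rule opnorm_le_multI) (use * opnorm_nonneg assms in auto)
qed

lemma bop_op_scale:
  assumes "bop T"
  shows "bop (op_scale c T)" and "opnorm (op_scale c T) \<le> cmod c * opnorm T"
proof -
  have *: "l2 (op_scale c T x)" "l2norm (op_scale c T x) \<le> (cmod c * opnorm T) * l2norm x" if "l2 x" for x
    using l2_scale[OF bop_l2[OF assms that], of c]
      mult_left_mono[OF l2norm_apply_le[OF assms that], of "cmod c"]
    by (auto simp: op_scale_def mult.assoc)
  show "bop (op_scale c T)"
    by (rule bopI[where K="cmod c * opnorm T"])
       (use * in \<open>auto simp: op_scale_def bop_off[OF assms] bop_add[OF assms] bop_scale[OF assms] algebra_simps\<close>)
  show "opnorm (op_scale c T) \<le> cmod c * opnorm T"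
    by (rule opnorm_le_multI) (use * opnorm_nonneg assms in auto)
qed

lemma op_sub_eq: "op_sub T S = op_add T (op_scale (-1) S)"
  by (simp add: op_sub_def op_add_def op_scale_def)

lemma bop_op_sub:
  assumes "bop T" "bop S"
  shows "bop (op_sub T S)" and "opnorm (op_sub T S) \<le> opnorm T + opnorm S"
  using bop_op_add[OF assms(1) bop_op_scale(1)[OF assms(2), of "-1"]] bop_op_scale(2)[OF assms(2), of "-1"]
  by (auto simp: op_sub_eq)

lemma bop_op_comp:
  assumes "bop T" "bop S"
  shows "bop (op_comp T S)" and "opnorm (op_comp T S) \<le> opnorm T * opnorm S"
proof -
  have *: "l2 (op_comp T S x)" "l2norm (op_comp T S x) \<le> (opnorm T * opnorm S) * l2norm x" if "l2 x" for x
    using bop_l2[OF assms(1) bop_l2[OF assms(2) that]]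
      order_trans[OF l2norm_apply_le[OF assms(1) bop_l2[OF assms(2) that]]
        mult_left_mono[OF l2norm_apply_le[OF assms(2) that] opnorm_nonneg[OF assms(1)]]]
    by (auto simp: op_comp_def mult.assoc)
  show "bop (op_comp T S)"
    by (rule bopI[where K="opnorm T * opnorm S"])
       (use * in \<open>auto simp: op_comp_def bop_off[OF assms(2)] bop_zero[OF assms(1)]
          bop_add[OF assms(2)] bop_scale[OF assms(2)]
          bop_add[OF assms(1)] bop_scale[OF assms(1)] bop_l2[OF assms(2)]\<close>)
  show "opnorm (op_comp T S) \<le> opnorm T * opnorm S"
    by (rule opnorm_le_multI) (use * opnorm_nonneg assms in auto)
qed

lemma bop_commutator: "bop T \<Longrightarrow> bop S \<Longrightarrow> bop (commutator T S)"
  unfolding commutator_def by (intro bop_op_sub bop_op_comp)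

lemma ent_simps [simp]:
  "ent (op_add T S) i j = ent T i j + ent S i j"
  "ent (op_sub T S) i j = ent T i j - ent S i j"
  "ent (op_scale c T) i j = c * ent T i j"
  by (simp_all add: ent_def op_add_def op_sub_def op_scale_def)

lemma bop_finite_support:
  assumes T: "bop T" and A: "finite A"
  shows "T (\<lambda>i. if i \<in> A then x i else 0) = (\<lambda>i. \<Sum>j\<in>A. x j * ent T i j)"
  using A
proof induction
  case empty
  then show ?case using bop_zero[OF T] by simp
next
  case (insert a A)
  have 1: "(\<lambda>i. if i \<in> insert a A then x i else 0) =
      (\<lambda>i. x a * Evec a i + (if i \<in> A then x i else 0))"
    using insert by (auto simp: Evec_def)
  have "l2 (\<lambda>i. if i \<in> A then x i else 0)"
    by (rule finite_support_norm_le(1)[OF insert(1)]) auto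
  then show ?case unfolding 1 using insert
    by (subst bop_add[OF T l2_scale(1)[OF l2_Evec]]) (auto simp: bop_scale[OF T l2_Evec] ent_def)
qed

text \<open>Finitely supported vectors are dense, so a bounded difference \<open>R\<close> with zero
  entries kills every vector of l2; off l2 both operators are zero by the normalisation in
  \<open>bop\<close>. Most operator identities below are checked by entries through this
  lemma.\<close>

lemma bop_eqI:
  assumes T: "bop T" and S: "bop S" and eq: "\<And>i j. ent T i j = ent S i j"
  shows "T = S"
proof -
  define R where "R = op_sub T S"
  have R: "bop R" unfolding R_def by (rule bop_op_sub[OF T S])
  have "R x i = 0" if x: "l2 x" for x i
  proof -
    have "cmod (R x i) \<le> e" if "e > 0" for e
    proof -
      \<comment> \<open>The summand 1 keeps the denominator positive even if
        \<open>opnorm R = 0\<close>.\<close>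
      define e' where "e' = e / (opnorm R + 1)"
      have e': "e' > 0" using that opnorm_nonneg[OF R] by (simp add: e'_def)
      obtain F where F: "finite F" "l2norm (\<lambda>i. if i \<in> F then 0 else x i) < e'"
        using l2_tail[OF x e'] .
      have l: "l2 (\<lambda>i. if i \<in> F then x i else 0)" "l2 (\<lambda>i. if i \<in> F then 0 else x i)"
        by (rule l2_dominated(1)[OF x]; simp)+
      have "x = (\<lambda>i. (if i \<in> F then x i else 0) + (if i \<in> F then 0 else x i))" by auto
      then have "R x i = R (\<lambda>i. if i \<in> F then x i else 0) i + R (\<lambda>i. if i \<in> F then 0 else x i) i"
        using bop_add[OF R l] by metis
      also have "R (\<lambda>i. if i \<in> F then x i else 0) i = 0"
        by (subst bop_finite_support[OF R F(1)]) (simp add: R_def eq)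
      finally have "cmod (R x i) \<le> l2norm (R (\<lambda>i. if i \<in> F then 0 else x i))"
        using cmod_le_l2norm[OF bop_l2[OF R l(2)]] by simp
      also have "\<dots> \<le> opnorm R * l2norm (\<lambda>i. if i \<in> F then 0 else x i)"
        by (rule l2norm_apply_le[OF R l(2)])
      also have "\<dots> \<le> opnorm R * e'"
        using F(2) opnorm_nonneg[OF R] by (intro mult_left_mono) auto
      also have "\<dots> \<le> e" unfolding e'_def using that opnorm_nonneg[OF R] by (auto simp: field_simps)
      finally show ?thesis .
    qed
    then have "cmod (R x i) \<le> 0" by (rule field_le_epsilon) simp
    then show ?thesis by simp
  qed
  then have "T x i = S x i" for x i
    using bop_off[OF T] bop_off[OF S] by (cases "l2 x") (auto simp: R_def op_sub_def)
  then show ?thesis by blast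
qed

section \<open>Adjoints\<close>

lemma inner_summable:
  assumes "l2 x" "l2 y"
  shows "(\<lambda>i. x i * cnj (y i)) summable_on UNIV"
proof -
  have sq: "(\<lambda>i. (cmod (x i))\<^sup>2 + (cmod (y i))\<^sup>2) summable_on UNIV"
    using assms unfolding l2_def by (rule summable_on_add)
  have le: "cmod (x i * cnj (y i)) \<le> (cmod (x i))\<^sup>2 + (cmod (y i))\<^sup>2" for i
    using sum_squares_bound[of "cmod (x i)" "cmod (y i)"]
      mult_nonneg_nonneg[OF norm_ge_zero norm_ge_zero, of "x i" "y i"]
    unfolding norm_mult complex_mod_cnj by linarith
  have "(\<lambda>i. cmod (x i * cnj (y i))) summable_on UNIV"
    by (rule Infinite_Sum.abs_summable_on_comparison_test'[OF sq le])
  then show ?thesis by (rule abs_summable_summable)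
qed

lemma l2inner_Evec: "l2inner (Evec j) y = cnj (y j)"
proof -
  have "l2inner (Evec j) y = (\<Sum>\<^sub>\<infinity>i\<in>{j}. Evec j i * cnj (y i))"
    unfolding l2inner_def by (rule infsum_cong_neutral) (auto simp: Evec_def)
  then show ?thesis by (simp add: Evec_def)
qed

definition is_adj :: "op \<Rightarrow> op \<Rightarrow> bool" where
  "is_adj T S \<longleftrightarrow> bop S \<and> (\<forall>x y. l2 x \<longrightarrow> l2 y \<longrightarrow> l2inner (T x) y = l2inner x (S y))"

text \<open>Pairing with basis vectors recovers every coordinate of \<open>S y\<close>, and the
  normalisation settles the vectors off l2. The choice in \<open>adj\<close> is thus determined as
  soon as one adjoint is exhibited.\<close>

lemma adj_eqI:
  assumes "is_adj T S" shows "adj T = S"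
proof -
  have "U = S" if "is_adj T U" for U
  proof -
    have "U y j = S y j" if y: "l2 y" for y j
    proof -
      have "l2inner (Evec j) (U y) = l2inner (Evec j) (S y)"
        using \<open>is_adj T U\<close> assms y l2_Evec unfolding is_adj_def by metis
      then show ?thesis by (simp add: l2inner_Evec)
    qed
    then have "U y = S y" for y
      using bop_off[of U y] bop_off[of S y] that assms unfolding is_adj_def by (cases "l2 y") auto
    then show ?thesis by blast
  qed
  moreover have "adj T = (SOME S. is_adj T S)" by (simp only: adj_def is_adj_def)
  ultimately show ?thesis using assms by (metis someI)
qed

lemma is_adj_add:
  assumes "bop T" "bop T'" "is_adj T S" "is_adj T' S'"
  shows "is_adj (op_add T T') (op_add S S')"
proof -
  have S: "bop S" "bop S'" using assms by (auto simp: is_adj_def)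
  have "l2inner (op_add T T' x) y = l2inner x (op_add S S' y)" if "l2 x" "l2 y" for x y
  proof -
    have "l2inner (op_add T T' x) y = l2inner (T x) y + l2inner (T' x) y"
      unfolding l2inner_def op_add_def distrib_right
      by (rule infsum_add; rule inner_summable[OF bop_l2[OF _ that(1)] that(2)]; fact)
    also have "\<dots> = l2inner x (S y) + l2inner x (S' y)"
      using assms that unfolding is_adj_def by simp
    also have "\<dots> = l2inner x (op_add S S' y)"
      unfolding l2inner_def op_add_def distrib_left complex_cnj_add
      by (rule infsum_add[symmetric]; rule inner_summable[OF that(1) bop_l2[OF _ that(2)]]; fact)
    finally show ?thesis .
  qed
  then show ?thesis using bop_op_add[OF S] unfolding is_adj_def by blast
qed

section \<open>Fejer multipliers\<close>

text \<open>The triangle 1 - |n|/(N + 1), cut off at 0: the Fourier coefficients of the Fejer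
  kernel.\<close>

definition fejer :: "nat \<Rightarrow> int \<Rightarrow> real" where
  "fejer N n = real_of_int (max 0 (int N + 1 - \<bar>n\<bar>)) / (real N + 1)"

lemma fejer_0 [simp]: "fejer N 0 = 1"
  by (simp add: fejer_def add.commute)

lemma fejer_eq_0: "\<bar>n\<bar> > int N \<Longrightarrow> fejer N n = 0"
  by (auto simp: fejer_def)

lemma fejer_tendsto: "(\<lambda>N. fejer N n) \<longlonglongrightarrow> 1"
proof -
  have "eventually (\<lambda>N. 1 - \<bar>real_of_int n\<bar> / (real N + 1) = fejer N n) sequentially"
    using eventually_ge_at_top[of "nat \<bar>n\<bar>"]
    by eventually_elim (auto simp: fejer_def field_simps max_def)
  moreover have "(\<lambda>N. 1 - \<bar>real_of_int n\<bar> / (real N + 1)) \<longlonglongrightarrow> 1 - 0"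
    by (intro tendsto_intros tendsto_divide_0 filterlim_at_top_imp_at_infinity
        filterlim_at_top_mono[OF filterlim_real_sequentially] always_eventually) auto
  ultimately show ?thesis by (auto elim: Lim_transform_eventually[rotated])
qed

text \<open>The windows that contain both i and j start between max i j - N and min i j, which
  leaves N + 1 - |i - j| of them, or none.\<close>

lemma fejer_count:
  assumes "finite R" "{i - int N..i} \<subseteq> R"
  shows "(\<Sum>s\<in>R. of_bool (i \<in> {s..s + int N} \<and> j \<in> {s..s + int N}) :: complex) =
    of_real ((real N + 1) * fejer N (i - j))"
proof -
  have "(\<Sum>s\<in>R. of_bool (i \<in> {s..s + int N} \<and> j \<in> {s..s + int N}) :: complex) =
      of_nat (card (R \<inter> {s. i \<in> {s..s + int N} \<and> j \<in> {s..s + int N}}))"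
    using assms(1) by (simp add: sum_of_bool_eq)
  also have "R \<inter> {s. i \<in> {s..s + int N} \<and> j \<in> {s..s + int N}} = {max i j - int N..min i j}"
    using subsetD[OF assms(2)] by auto
  also have "of_nat (card {max i j - int N..min i j}) = complex_of_real ((real N + 1) * fejer N (i - j))"
  proof -
    have "real (card {max i j - int N..min i j}) = real_of_int (max 0 (int N + 1 - \<bar>i - j\<bar>))"
      by (auto simp: max_def min_def)
    also have "\<dots> = (real N + 1) * fejer N (i - j)" by (simp add: fejer_def)
    finally show ?thesis by (metis of_real_of_nat_eq)
  qed
  finally show ?thesis .
qed

text \<open>Every index lies in at most N + 1 windows.\<close>

lemma window_sum_le:
  fixes f :: "int \<Rightarrow> real"
  assumes "finite R" "finite A" "\<And>j. 0 \<le> f j"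
  shows "(\<Sum>s\<in>R. \<Sum>j\<in>A \<inter> {s..s + int N}. f j) \<le> (real N + 1) * (\<Sum>j\<in>A. f j)"
proof -
  have "(\<Sum>s\<in>R. \<Sum>j\<in>A \<inter> {s..s + int N}. f j) = (\<Sum>s\<in>R. \<Sum>j\<in>A. of_bool (j \<in> {s..s + int N}) * f j)"
    using assms(2) by (intro sum.cong refl sum.mono_neutral_cong_left) auto
  also have "\<dots> = (\<Sum>j\<in>A. f j * (\<Sum>s\<in>R. of_bool (j \<in> {s..s + int N})))"
    by (subst sum.swap) (simp add: sum_distrib_left mult.commute)
  also have "\<dots> \<le> (\<Sum>j\<in>A. f j * (real N + 1))"
  proof (intro sum_mono mult_left_mono assms(3))
    fix j
    have "(\<Sum>s\<in>R. of_bool (j \<in> {s..s + int N}) :: real) = real (card (R \<inter> {s. j \<in> {s..s + int N}}))"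
      using assms(1) by (simp add: sum_of_bool_eq)
    also have "\<dots> \<le> real (card {j - int N..j})"
      by (intro of_nat_mono card_mono) auto
    finally show "(\<Sum>s\<in>R. of_bool (j \<in> {s..s + int N}) :: real) \<le> real N + 1" by simp
  qed
  also have "\<dots> = (real N + 1) * (\<Sum>j\<in>A. f j)" by (simp only: sum_distrib_right[symmetric] mult.commute)
  finally show ?thesis .
qed

text \<open>The Fejer weight is \<open>fejer N (i - j) = (1 / (N + 1)) \<Sum>\<^sub>s 1\<^sub>s(i) 1\<^sub>s(j)\<close> with \<open>1\<^sub>s\<close> the
  indicator of \<open>{s..s + N}\<close>, so the multiplier averages compressions of the operator.\<close>

lemma fejer_multiplier_finite:
  assumes T: "bop T" and S: "\<And>i j. ent S i j = of_real (fejer N (i - j)) * ent T i j"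
    and A: "finite A" and F: "finite F"
  shows "L2_set (\<lambda>i. cmod (\<Sum>j\<in>A. x j * ent S i j)) F \<le> opnorm T * L2_set (\<lambda>i. cmod (x i)) A"
proof -
  \<comment> \<open>The starting points of all windows that meet \<open>F\<close>.\<close>
  define R where "R = (\<Union>i\<in>F. {i - int N..i})"
  define I where "I s = {s..s + int N}" for s
  have R: "finite R" using F by (simp add: R_def)
  \<comment> \<open>\<open>y\<close> is the weighted operator applied to the part of
    \<open>x\<close> in \<open>A\<close>, while \<open>z s\<close> is \<open>T\<close> itself
    applied to the part of \<open>x\<close> in \<open>A \<inter> I s\<close>.\<close>
  define y where "y i = (\<Sum>j\<in>A. x j * ent S i j)" for i
  define z where "z s i = (\<Sum>j\<in>A \<inter> I s. x j * ent T i j)" for s i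
  define a where "a s = L2_set (\<lambda>i. cmod (x i)) (A \<inter> I s)" for s
  define b where "b s = L2_set (\<lambda>i. cmod (y i)) (F \<inter> I s)" for s
  define X where "X = L2_set (\<lambda>i. cmod (x i)) A"
  define L where "L = L2_set (\<lambda>i. cmod (y i)) F"
  have z: "L2_set (\<lambda>i. cmod (z s i)) G \<le> opnorm T * a s" for s G
  proof -
    let ?x = "\<lambda>i. if i \<in> A \<inter> I s then x i else 0"
    have xl: "l2 ?x" "l2norm ?x \<le> L2_set (\<lambda>i. cmod (?x i)) (A \<inter> I s)"
      by (rule finite_support_norm_le[of "A \<inter> I s"]; use A in auto)+
    have "L2_set (\<lambda>i. cmod (?x i)) (A \<inter> I s) = a s"
      unfolding a_def by (rule L2_set_cong) auto
    moreover have "T ?x = z s"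
      unfolding z_def using bop_finite_support[OF T, of "A \<inter> I s" x] A by simp
    ultimately show ?thesis
      using L2_set_le_l2norm[OF bop_l2[OF T xl(1)], of G] l2norm_apply_le[OF T xl(1)] xl(2)
        mult_left_mono[OF _ opnorm_nonneg[OF T]] by (metis order_trans)
  qed
  \<comment> \<open>By \<open>fejer_count\<close> the squared norm of \<open>y\<close> on
    \<open>F\<close>, times N + 1, splits into one inner product per window, each with the
    unweighted \<open>T\<close>.\<close>
  have swap: "of_real ((real N + 1) * L\<^sup>2) = (\<Sum>s\<in>R. \<Sum>i\<in>F \<inter> I s. z s i * cnj (y i))"
  proof -
    have "of_real ((real N + 1) * L\<^sup>2) = (\<Sum>i\<in>F. of_real (real N + 1) * (y i * cnj (y i)))"
      by (simp add: L_def L2_set_def sum_nonneg sum_distrib_left flip: complex_norm_square)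
    also have "\<dots> = (\<Sum>i\<in>F. \<Sum>j\<in>A. of_real ((real N + 1) * fejer N (i - j)) * (x j * ent T i j * cnj (y i)))"
      by (intro sum.cong refl)
         (subst y_def, simp add: S sum_distrib_left sum_distrib_right mult_ac)
    also have "\<dots> = (\<Sum>i\<in>F. \<Sum>j\<in>A. \<Sum>s\<in>R. of_bool (i \<in> I s \<and> j \<in> I s) * (x j * ent T i j * cnj (y i)))"
      unfolding I_def sum_distrib_right[symmetric]
      by (intro sum.cong refl, subst fejer_count) (use R in \<open>auto simp: R_def\<close>)
    also have "\<dots> = (\<Sum>s\<in>R. \<Sum>i\<in>F. \<Sum>j\<in>A. of_bool (i \<in> I s \<and> j \<in> I s) * (x j * ent T i j * cnj (y i)))"
      by (subst sum.swap[of _ R]) (rule sum.swap)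
    also have "\<dots> = (\<Sum>s\<in>R. \<Sum>i\<in>F \<inter> I s. z s i * cnj (y i))"
      unfolding z_def sum_distrib_right
      by (intro sum.cong refl sum.mono_neutral_cong_right F)
         (use A F in \<open>auto intro!: sum.mono_neutral_cong_right\<close>)
    finally show ?thesis .
  qed
  have "(real N + 1) * L\<^sup>2 = cmod (of_real ((real N + 1) * L\<^sup>2))" by (simp add: norm_mult norm_power flip: of_real_add of_nat_Suc)
  \<comment> \<open>Cauchy-Schwarz inside each window and then over the windows. By
    \<open>window_sum_le\<close> each of the two factors gains at most sqrt (N + 1), which together
    cancel the N + 1 on the left.\<close>
  also have "\<dots> \<le> (\<Sum>s\<in>R. \<Sum>i\<in>F \<inter> I s. \<bar>cmod (z s i)\<bar> * \<bar>cmod (y i)\<bar>)"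
    unfolding swap by (intro sum_norm_le) (simp add: norm_mult)
  also have "\<dots> \<le> (\<Sum>s\<in>R. opnorm T * a s * b s)"
    by (intro sum_mono order_trans[OF L2_set_mult_ineq] mult_mono z)
       (auto simp: b_def a_def opnorm_nonneg[OF T])
  also have "\<dots> = opnorm T * (\<Sum>s\<in>R. \<bar>a s\<bar> * \<bar>b s\<bar>)"
    by (simp add: sum_distrib_left mult.assoc a_def b_def)
  also have "\<dots> \<le> opnorm T * (L2_set a R * L2_set b R)"
    by (intro mult_left_mono L2_set_mult_ineq opnorm_nonneg T)
  also have "\<dots> \<le> opnorm T * ((sqrt (real N + 1) * X) * (sqrt (real N + 1) * L))"
  proof (intro mult_left_mono mult_mono opnorm_nonneg T)
    have *: "L2_set (\<lambda>s. L2_set (\<lambda>i. cmod (f i)) (B \<inter> I s)) R \<le> sqrt (real N + 1) * L2_set (\<lambda>i. cmod (f i)) B"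
      if "finite B" for B and f :: vec
      unfolding L2_set_def real_sqrt_mult[symmetric]
      using window_sum_le[OF R that, of "\<lambda>i. (cmod (f i))\<^sup>2" N] that
      by (auto simp: I_def sum_nonneg)
    show "L2_set a R \<le> sqrt (real N + 1) * X"
      unfolding a_def X_def by (rule *[OF A])
    show "L2_set b R \<le> sqrt (real N + 1) * L"
      unfolding b_def L_def by (rule *[OF F])
  qed (auto simp: X_def)
  also have "\<dots> = (sqrt (real N + 1))\<^sup>2 * (opnorm T * X * L)" by (simp add: power2_eq_square mult_ac)
  also have "\<dots> = (real N + 1) * (opnorm T * X * L)" by simp
  finally have "L * L \<le> (opnorm T * X) * L" by (simp add: power2_eq_square)
  moreover have "0 \<le> L" "0 \<le> opnorm T * X" using opnorm_nonneg[OF T] by (auto simp: L_def X_def)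
  ultimately have "L \<le> opnorm T * X" by (metis less_eq_real_def mult_le_cancel_right not_less)
  then show ?thesis by (simp add: L_def y_def X_def)
qed

text \<open>The estimate for finite vectors passes to l2 by splitting off a small tail. On the tail
  only the crude bound \<open>opnorm S\<close> is available, which is where boundedness of
  \<open>S\<close> enters.\<close>

lemma opnorm_fejer_le:
  assumes T: "bop T" and S: "bop S" and SE: "\<And>i j. ent S i j = of_real (fejer N (i - j)) * ent T i j"
  shows "opnorm S \<le> opnorm T"
proof (rule opnorm_le_multI[OF _ opnorm_nonneg[OF T]])
  fix x assume x: "l2 x"
  have "L2_set (\<lambda>i. cmod (S x i)) F \<le> opnorm T * l2norm x" if F: "finite F" for F
  proof (rule field_le_epsilon)
    fix e :: real assume e: "e > 0"
    define e' where "e' = e / (opnorm S + 1)"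
    have e': "e' > 0" using e opnorm_nonneg[OF S] by (simp add: e'_def)
    obtain A where A: "finite A" "l2norm (\<lambda>i. if i \<in> A then 0 else x i) < e'"
      using l2_tail[OF x e'] .
    let ?x = "\<lambda>i. if i \<in> A then x i else 0" and ?r = "\<lambda>i. if i \<in> A then 0 else x i"
    have l: "l2 ?x" "l2 ?r"
      by (rule l2_dominated(1)[OF x]; simp)+
    have "x = (\<lambda>i. ?x i + ?r i)" by auto
    then have "S x = (\<lambda>i. S ?x i + S ?r i)"
      using bop_add[OF S l] by metis
    then have "L2_set (\<lambda>i. cmod (S x i)) F \<le> L2_set (\<lambda>i. cmod (S ?x i) + cmod (S ?r i)) F"
      by (auto intro!: L2_set_mono norm_triangle_ineq)
    also have "\<dots> \<le> L2_set (\<lambda>i. cmod (S ?x i)) F + L2_set (\<lambda>i. cmod (S ?r i)) F"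
      by (rule L2_set_triangle_ineq)
    also have "\<dots> \<le> opnorm T * l2norm x + e"
    proof (rule add_mono)
      have "L2_set (\<lambda>i. cmod (S ?x i)) F \<le> opnorm T * L2_set (\<lambda>i. cmod (x i)) A"
        by (subst bop_finite_support[OF S A(1)]) (rule fejer_multiplier_finite[OF T SE A(1) F])
      also have "\<dots> \<le> opnorm T * l2norm x"
        by (intro mult_left_mono L2_set_le_l2norm x opnorm_nonneg T)
      finally show "L2_set (\<lambda>i. cmod (S ?x i)) F \<le> opnorm T * l2norm x" .
      have "L2_set (\<lambda>i. cmod (S ?r i)) F \<le> l2norm (S ?r)"
        by (rule L2_set_le_l2norm[OF bop_l2[OF S l(2)]])
      also have "\<dots> \<le> opnorm S * l2norm ?r" by (rule l2norm_apply_le[OF S l(2)])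
      also have "\<dots> \<le> opnorm S * e'"
        using A(2) opnorm_nonneg[OF S] by (intro mult_left_mono) auto
      also have "\<dots> \<le> e" unfolding e'_def using e opnorm_nonneg[OF S] by (auto simp: field_simps)
      finally show "L2_set (\<lambda>i. cmod (S ?r i)) F \<le> e" .
    qed
    finally show "L2_set (\<lambda>i. cmod (S x i)) F \<le> opnorm T * l2norm x + e" .
  qed
  then show "l2norm (S x) \<le> opnorm T * l2norm x" by (rule l2I(2))
qed

section \<open>Exponential sums\<close>

lemma parseval_roots_of_unity:
  fixes c :: "nat \<Rightarrow> complex"
  assumes K: "K > 0"
  defines "w \<equiv> \<lambda>j. cis (2 * pi * real j / real K)"
  shows "(\<Sum>j<K. (cmod (\<Sum>m<K. c m * w j ^ m))\<^sup>2) = real K * (\<Sum>m<K. (cmod (c m))\<^sup>2)"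
proof -
  \<comment> \<open>This symmetry between \<open>j\<close> and \<open>m\<close> turns the sum over
    \<open>j\<close> into a geometric sum with ratio \<open>r\<close>.\<close>
  have wpow: "w j ^ m = w m ^ j" for j m
    unfolding w_def Complex.DeMoivre by (simp add: mult_ac)
  have wnz: "w j * cnj (w j) = 1" for j
    using complex_norm_square[of "w j"] by (simp add: w_def)
  have orth: "(\<Sum>j<K. w j ^ m * cnj (w j ^ m')) = (if m = m' then of_nat K else 0)"
    if "m < K" "m' < K" for m m'
  proof -
    define r where "r = w m * cnj (w m')"
    have "(\<Sum>j<K. w j ^ m * cnj (w j ^ m')) = (\<Sum>j<K. r ^ j)"
      by (intro sum.cong refl) (simp only: wpow[of _ m] wpow[of _ m'] r_def power_mult_distrib complex_cnj_power)
    also have "\<dots> = (if m = m' then of_nat K else 0)"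
    proof (cases "m = m'")
      case True
      then show ?thesis using wnz by (simp add: r_def)
    next
      case False
      have "inj_on w {..<K}"
        using Complex.bij_betw_roots_unity[OF K] unfolding bij_betw_def w_def by simp
      then have "w m \<noteq> w m'" using that False by (auto dest: inj_onD)
      then have "r \<noteq> 1" using wnz[of m'] unfolding r_def
        by (metis mult.assoc mult.commute mult.right_neutral)
      moreover have "w j ^ K = 1" for j
        unfolding w_def Complex.DeMoivre using K by simp
      then have "r ^ K = 1" by (simp add: r_def power_mult_distrib flip: complex_cnj_power)
      ultimately show ?thesis using False by (simp add: sum_gp_strict)
    qed
    finally show ?thesis .
  qed
  have "complex_of_real (\<Sum>j<K. (cmod (\<Sum>m<K. c m * w j ^ m))\<^sup>2) =
      (\<Sum>j<K. (\<Sum>m<K. c m * w j ^ m) * cnj (\<Sum>m<K. c m * w j ^ m))"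
    by (simp only: of_real_sum complex_norm_square)
  also have "\<dots> = (\<Sum>j<K. \<Sum>m<K. \<Sum>m'<K. c m * cnj (c m') * (w j ^ m * cnj (w j ^ m')))"
    by (simp add: sum_product cnj_sum mult_ac)
  also have "\<dots> = (\<Sum>m<K. \<Sum>j<K. \<Sum>m'<K. c m * cnj (c m') * (w j ^ m * cnj (w j ^ m')))"
    by (rule sum.swap)
  also have "\<dots> = (\<Sum>m<K. \<Sum>m'<K. \<Sum>j<K. c m * cnj (c m') * (w j ^ m * cnj (w j ^ m')))"
    by (rule sum.cong[OF refl], rule sum.swap)
  also have "\<dots> = (\<Sum>m<K. \<Sum>m'<K. c m * cnj (c m') * (if m = m' then of_nat K else 0))"
    by (intro sum.cong refl, simp only: sum_distrib_left[symmetric], subst orth) auto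
  also have "\<dots> = (\<Sum>m<K. of_nat K * (c m * cnj (c m)))"
    by (intro sum.cong refl) (simp add: if_distrib sum.delta' cong: if_cong)
  also have "\<dots> = complex_of_real (real K * (\<Sum>m<K. (cmod (c m))\<^sup>2))"
    by (simp only: sum_distrib_left[symmetric] complex_norm_square[symmetric] of_real_mult of_real_sum of_real_of_nat_eq)
  finally show ?thesis by (simp only: of_real_eq_iff)
qed

text \<open>Multiplying the exponential sum of \<open>b\<close> by that of the indicator of \<open>Q\<close> convolves \<open>b\<close> with this
  indicator; comparing the Parseval identities of both bounds the maximum of the former.\<close>

lemma large_exponential_sum:
  fixes b :: "nat \<Rightarrow> complex"
  assumes D: "D \<le> N" "0 < N" and Q: "Q \<subseteq> {..<D}" "Q \<noteq> {}" and G: "G \<subseteq> {D..<N}" and "0 \<le> h"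
    and big: "\<And>m. m \<in> G \<Longrightarrow> real (card Q) * h \<le> cmod (\<Sum>q\<in>Q. b (m - q))"
  obtains z where "cmod z = 1" "real (card Q) * real (card G) * h\<^sup>2 \<le> (cmod (\<Sum>l<N. b l * z ^ l))\<^sup>2"
proof -
  \<comment> \<open>The convolution of a sequence on {..<N} with the indicator of \<open>Q\<close>
    lives below 2 * N, so with 2 * N roots of unity nothing wraps around.\<close>
  define K where "K = 2 * N"
  define w where "w = (\<lambda>j. cis (2 * pi * real j / real K))"
  define P where "P z = (\<Sum>l<N. b l * z ^ l)" for z
  define W where "W z = (\<Sum>m<K. (if m \<in> Q then 1 else 0) * z ^ m)" for z :: complex
  define c where "c m = (\<Sum>q\<in>Q. if q \<le> m \<and> m - q < N then b (m - q) else 0)" for m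
  have K: "K > 0" using D by (simp add: K_def)
  have finQ: "finite Q" "finite G" using Q G finite_subset by blast+
  have QK: "q < N" "q < K" if "q \<in> Q" for q using that Q D by (auto simp: K_def)
  have PW: "P z * W z = (\<Sum>m<K. c m * z ^ m)" for z
  proof -
    have "W z = (\<Sum>q\<in>Q. z ^ q)"
      unfolding W_def by (rule sum.mono_neutral_cong_right) (use QK in auto)
    then have "P z * W z = (\<Sum>l<N. \<Sum>q\<in>Q. b l * z ^ (l + q))"
      by (simp add: P_def sum_product power_add mult.assoc)
    also have "\<dots> = (\<Sum>q\<in>Q. \<Sum>l<N. b l * z ^ (l + q))" by (rule sum.swap)
    also have "\<dots> = (\<Sum>q\<in>Q. \<Sum>m<K. (if q \<le> m \<and> m - q < N then b (m - q) else 0) * z ^ m)"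
    proof (rule sum.cong[OF refl])
      fix q assume q: "q \<in> Q"
      show "(\<Sum>l<N. b l * z ^ (l + q)) = (\<Sum>m<K. (if q \<le> m \<and> m - q < N then b (m - q) else 0) * z ^ m)"
        by (rule sum.reindex_bij_witness_not_neutral[where S'="{}" and T'="{m. m < K \<and> \<not> (q \<le> m \<and> m - q < N)}"
              and i="\<lambda>m. m - q" and j="\<lambda>l. l + q"])
          (use QK[OF q] in \<open>auto simp: K_def\<close>)
    qed
    also have "\<dots> = (\<Sum>m<K. c m * z ^ m)"
      by (subst sum.swap) (simp add: c_def sum_distrib_right)
    finally show ?thesis .
  qed
  define M where "M = Max ((\<lambda>j. (cmod (P (w j)))\<^sup>2) ` {..<K})"
  have "M \<in> (\<lambda>j. (cmod (P (w j)))\<^sup>2) ` {..<K}"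
    unfolding M_def using K by (intro Max_in) auto
  then obtain j where j: "j < K" "(cmod (P (w j)))\<^sup>2 = M" by auto
  have M: "(cmod (P (w i)))\<^sup>2 \<le> M" if "i < K" for i
    unfolding M_def using that by (intro Max_ge) auto
  have cW: "(\<Sum>m<K. (cmod ((if m \<in> Q then 1 else 0)::complex))\<^sup>2) = real (card Q)"
  proof -
    have "(\<Sum>m<K. (cmod ((if m \<in> Q then 1 else 0)::complex))\<^sup>2) = (\<Sum>m\<in>Q. 1)"
      by (rule sum.mono_neutral_cong_right) (use QK in auto)
    then show ?thesis by simp
  qed
  have "real (card G) * (real (card Q) * h)\<^sup>2 = (\<Sum>m\<in>G. (real (card Q) * h)\<^sup>2)" by simp
  also have "\<dots> \<le> (\<Sum>m\<in>G. (cmod (c m))\<^sup>2)"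
  proof (intro sum_mono power_mono)
    fix m assume m: "m \<in> G"
    \<comment> \<open>For m in \<open>G\<close> no index m - q leaves {..<N}, since q < D <= m <
      N.\<close>
    have "c m = (\<Sum>q\<in>Q. b (m - q))"
      unfolding c_def
    proof (rule sum.cong[OF refl])
      fix q assume "q \<in> Q"
      then have "q < D" "D \<le> m" "m < N" using m G Q by auto
      then show "(if q \<le> m \<and> m - q < N then b (m - q) else 0) = b (m - q)" by simp
    qed
    then show "real (card Q) * h \<le> cmod (c m)" using big[OF m] by simp
  qed (use assms in auto)
  also have "\<dots> \<le> (\<Sum>m<K. (cmod (c m))\<^sup>2)"
    by (rule sum_mono2) (use G in \<open>auto simp: K_def\<close>)
  finally have "real K * (real (card G) * (real (card Q) * h)\<^sup>2) \<le> real K * (\<Sum>m<K. (cmod (c m))\<^sup>2)"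
    by (intro mult_left_mono) auto
  also have "\<dots> = (\<Sum>j<K. (cmod (P (w j) * W (w j)))\<^sup>2)"
    unfolding PW w_def by (rule parseval_roots_of_unity[OF K, symmetric])
  \<comment> \<open>With |P|^2 replaced by its maximum \<open>M\<close>, what is left is the
    Parseval sum of \<open>W\<close>, equal to K * card Q.\<close>
  also have "\<dots> \<le> (\<Sum>j<K. M * (cmod (W (w j)))\<^sup>2)"
    unfolding norm_mult power_mult_distrib by (intro sum_mono mult_right_mono M) auto
  also have "\<dots> = M * (real K * real (card Q))"
    unfolding sum_distrib_left[symmetric] W_def w_def cW[symmetric]
    by (subst parseval_roots_of_unity[OF K]) simp
  finally have "real (card Q) * real K * (real (card Q) * real (card G) * h\<^sup>2) \<le> real (card Q) * real K * M"
    by (simp add: power2_eq_square mult_ac)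
  moreover have "real (card Q) * real K > 0" using K Q finQ by (simp add: card_gt_0_iff)
  ultimately have "real (card Q) * real (card G) * h\<^sup>2 \<le> M"
    by (simp only: mult_le_cancel_left_pos)
  then show ?thesis using j that[of "w j"] by (simp add: P_def w_def)
qed

text \<open>Each step of the shift exchanges one boundary term for another, at a cost of at most 2 *
  B.\<close>

lemma shifted_sum_diff:
  fixes a :: "nat \<Rightarrow> complex"
  assumes "\<And>k. cmod (a k) \<le> B"
  shows "cmod ((\<Sum>k<M. a (k + q)) - (\<Sum>k<M. a k)) \<le> 2 * real q * B"
proof (induction q)
  case (Suc q)
  have "(\<Sum>k<M. a (k + Suc q)) - (\<Sum>k<M. a (k + q)) = a (M + q) - a q"
    using sum_lessThan_telescope[of "\<lambda>k. a (k + q)" M] by (simp add: sum_subtractf)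
  then have "cmod ((\<Sum>k<M. a (k + Suc q)) - (\<Sum>k<M. a (k + q))) \<le> 2 * B"
    using norm_triangle_ineq4[of "a (M + q)" "a q"] assms[of "M + q"] assms[of q] by simp
  then show ?case
    using Suc norm_triangle_ineq[of "(\<Sum>k<M. a (k + Suc q)) - (\<Sum>k<M. a (k + q))"
        "(\<Sum>k<M. a (k + q)) - (\<Sum>k<M. a k)"] by (simp add: algebra_simps)
qed simp

text \<open>The interval consists of \<open>k\<close> disjoint blocks of length
  \<open>Suc L\<close>, each of which contains a hit.\<close>

lemma card_windows_ge:
  fixes s L k :: nat
  assumes "\<And>s. \<exists>m\<in>{s..s + L}. P m"
  shows "k \<le> card {m \<in> {s..<s + k * Suc L}. P m}"
proof (induction k)
  case (Suc k)
  let ?s = "s + k * Suc L"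
  obtain m where m: "m \<in> {?s..?s + L}" "P m" using assms by blast
  have "Suc k \<le> card (insert m {m \<in> {s..<?s}. P m})"
    using Suc m by (subst card_insert_disjoint) auto
  also have "\<dots> \<le> card {m \<in> {s..<s + Suc k * Suc L}. P m}"
    by (rule card_mono) (use m in auto)
  finally show ?case .
qed simp

section \<open>Compact monothetic groups\<close>

lemma gmult_0 [simp]: "gmult 0 x = 0"
  by (simp add: gmult_def)

lemma gmult_Suc: "gmult (n + 1) x = gmult n x + x"
proof -
  consider "n \<ge> 0" | "n < 0" by linarith
  then show ?thesis
  proof cases
    case 1
    then have "nat (n + 1) = Suc (nat n)" by simp
    then show ?thesis using 1 by (simp add: gmult_def add.commute)
  next
    case 2
    then have "nat (- n) = Suc (nat (- (n + 1)))" by simp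
    moreover have "gmult (n + 1) x = - (((+) x ^^ nat (- (n + 1))) 0)"
      using 2 by (cases "n = -1") (auto simp: gmult_def)
    ultimately show ?thesis using 2 by (simp add: gmult_def)
  qed
qed

lemma gmult_1 [simp]: "gmult 1 x = x"
  using gmult_Suc[of 0 x] by simp

lemma gmult_add: "gmult (m + n) x = gmult m x + gmult n x"
proof (induction n rule: int_induct[where k=0])
  case (step1 i)
  then show ?case using gmult_Suc[of "m + i" x] gmult_Suc[of i x] by (simp add: add.assoc)
next
  case (step2 i)
  then show ?case using gmult_Suc[of "m + (i - 1)" x] gmult_Suc[of "i - 1" x] by (simp add: algebra_simps)
qed simp

lemma gmult_minus: "gmult (- n) x = - gmult n x"
  using gmult_add[of n "- n" x] by (simp add: eq_neg_iff_add_eq_0 add.commute)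

lemma gmult_diff: "gmult (m - n) x = gmult m x - gmult n x"
  using gmult_add[of m "- n" x] by (simp add: gmult_minus)

locale monothetic =
  fixes x1 :: "'g::{topological_ab_group_add, t2_space}"
  assumes compact_UNIV: "compact (UNIV :: 'g set)"
    and infinite_UNIV: "infinite (UNIV :: 'g set)"
    and dense: "closure (range (\<lambda>n. gmult n x1)) = UNIV"
begin

abbreviation pt :: "int \<Rightarrow> 'g" where "pt n \<equiv> gmult n x1"

text \<open>A vanishing multiple would make the orbit finite, hence closed, hence by density the
  whole infinite group.\<close>

lemma pt_nonzero:
  assumes "n \<noteq> 0" shows "pt n \<noteq> 0"
proof
  assume z: "pt n = 0"
  define k where "k = \<bar>n\<bar>"
  have k: "k > 0" "pt k = 0" using assms z by (auto simp: k_def abs_if gmult_minus)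
  have mult: "pt (k * q) = 0" for q
  proof (induction q rule: int_induct[where k=0])
    case (step1 i)
    then show ?case using k by (simp add: distrib_left gmult_add)
  next
    case (step2 i)
    then show ?case using k by (simp add: right_diff_distrib gmult_diff)
  qed simp
  have "pt l = pt (l mod k)" for l
    using gmult_add[of "k * (l div k)" "l mod k" x1] mult by simp
  then have "pt l \<in> pt ` {0..<k}" for l
    using k by (intro image_eqI[of _ _ "l mod k"]) auto
  then have "range pt \<subseteq> pt ` {0..<k}" by blast
  then have fin: "finite (range pt)" by (rule finite_subset) auto
  then have "closure (range pt) = range pt" by (intro closure_closed finite_imp_closed)
  then show False using dense infinite_UNIV fin by metis
qed

section \<open>Density, uniform continuity and averages along the orbit\<close>

lemma dense_closedD: "closed S \<Longrightarrow> (\<And>l. pt l \<in> S) \<Longrightarrow> x \<in> S"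
  using closure_minimal[of "range pt" S] dense by auto

lemma dense_eqI:
  fixes f g :: "'g \<Rightarrow> 'b::t2_space"
  assumes "continuous_on UNIV f" "continuous_on UNIV g" "\<And>l. f (pt l) = g (pt l)"
  shows "f = g"
  using dense_closedD[OF closed_Collect_eq[OF assms(1,2)]] assms(3) by auto

lemma CG_translate: "f \<in> CG \<Longrightarrow> (\<lambda>x. f (x + a :: 'g)) \<in> CG"
  unfolding CG_def by (auto intro!: continuous_intros continuous_on_compose2[of UNIV f])

lemma CG_bounded:
  assumes "f \<in> CG"
  obtains B where "0 < B" "\<And>x :: 'g. cmod (f x) \<le> B"
proof -
  have "bounded (range f)"
    using assms compact_UNIV unfolding CG_def by (auto intro: compact_imp_bounded compact_continuous_image)
  then show ?thesis using that unfolding bounded_pos by auto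
qed

text \<open>Uniform continuity in terms of neighbourhoods of 0, as \<open>'g\<close> carries no
  metric. It is the tube argument for (u, x) |-> f (x + u) at u = 0.\<close>

lemma CG_equicontinuous:
  assumes "f \<in> CG" "e > 0"
  obtains U :: "'g set" where "open U" "0 \<in> U" "\<And>u x. u \<in> U \<Longrightarrow> cmod (f (x + u) - f x) < e"
proof -
  have c: "continuous_on (UNIV \<times> UNIV) (\<lambda>p. f (snd p + fst p))"
    using assms unfolding CG_def by (auto intro!: continuous_intros continuous_on_compose2[of UNIV f])
  have e2: "0 < e / 2" using assms by simp
  obtain U where U: "0 \<in> U" "open U"
    "\<forall>u\<in>U \<inter> UNIV. \<forall>x\<in>UNIV. dist (f (snd (u, x) + fst (u, x))) (f (snd (0::'g, x) + fst (0::'g, x))) \<le> e / 2"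
    by (rule continuous_on_prod_compactE[OF c compact_UNIV UNIV_I[of 0] e2])
  have "cmod (f (x + u) - f x) < e" if "u \<in> U" for u x
  proof -
    have "dist (f (x + u)) (f x) \<le> e / 2" using U(3) that by simp
    then show ?thesis using assms(2) by (simp add: dist_norm)
  qed
  then show ?thesis using that U by blast
qed

text \<open>Density makes the translates of \<open>U\<close> by orbit points cover the group, and
  compactness leaves finitely many of them.\<close>

lemma finite_cover:
  assumes "open U" "0 \<in> U"
  obtains L :: nat where "\<And>z. \<exists>q\<le>L. z - pt (int q) \<in> U"
proof -
  define W where "W q = {z. z - pt q \<in> U}" for q
  have op: "open (W q)" for q
  proof -
    have "open ((\<lambda>z. z - pt q) -` U)"
      by (rule open_vimage[OF assms(1)]) (intro continuous_intros)
    then show ?thesis by (simp add: W_def vimage_def)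
  qed
  have cov: "z \<in> (\<Union>q. W q)" for z
  proof -
    have "open ((\<lambda>w. z - w) -` U)"
      by (rule open_vimage[OF assms(1)]) (intro continuous_intros)
    then have "open {w. z - w \<in> U}" by (simp add: vimage_def)
    moreover have "z \<in> {w. z - w \<in> U}" using assms by simp
    ultimately have "{w. z - w \<in> U} \<inter> range pt \<noteq> {}"
      using dense by (metis UNIV_I disjoint_iff open_Int_closure_eq_empty)
    then show ?thesis by (auto simp: W_def)
  qed
  obtain D where D: "finite D" "UNIV \<subseteq> (\<Union>q\<in>D. W q)"
    proof (rule compactE_image[OF compact_UNIV, of UNIV W])
    show "UNIV \<subseteq> (\<Union>q. W q)" using cov by blast
  qed (use op in auto)
  obtain L where L: "\<And>q. q \<in> D \<Longrightarrow> \<bar>q\<bar> \<le> int L"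
  proof -
    have "\<And>q. q \<in> D \<Longrightarrow> \<bar>q\<bar> \<le> int (nat (\<Sum>q\<in>D. \<bar>q\<bar>))"
      using D(1) by (auto intro!: member_le_sum sum_nonneg)
    then show ?thesis using that by blast
  qed
  show ?thesis
  \<comment> \<open>The exponents found lie between -L and L; applying the cover to z - pt L shifts
    them to 0, ..., 2 * L.\<close>
  proof (rule that[of "2 * L"])
    fix z
    obtain q where q: "q \<in> D" "z - pt (int L) \<in> W q" using D(2) by blast
    have "int (nat (int L + q)) = int L + q" using L[OF q(1)] by linarith
    then have "z - pt (int (nat (int L + q))) \<in> U"
      using q(2) by (simp add: W_def gmult_add diff_diff_eq del: int_nat_eq)
    moreover have "nat (int L + q) \<le> 2 * L" using L[OF q(1)] by linarith
    ultimately show "\<exists>q\<le>2 * L. z - pt (int q) \<in> U" by blast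
  qed
qed

text \<open>Averages over the orbit become constant uniformly because finitely many steps of the
  rotation bring every point near any other.\<close>

lemma orbit_average:
  assumes g: "g \<in> CG"
  obtains c where "\<And>e. e > 0 \<Longrightarrow> \<exists>M>0. \<forall>x. cmod ((\<Sum>k<M. g (x + pt (int k))) / of_nat M - c) < e"
proof -
  obtain B where B: "0 < B" "\<And>x. cmod (g x) \<le> B" using CG_bounded[OF g] by blast
  define A where "A M x = (\<Sum>k<M. g (x + pt (int k))) / of_nat M" for M x
  have osc: "\<exists>M0>0. \<forall>M\<ge>M0. \<forall>x y. cmod (A M x - A M y) < e" if e: "e > 0" for e
  proof -
    have e2: "0 < e / 2" using e by simp
    obtain U where U: "open U" "0 \<in> U" "\<And>u x. u \<in> U \<Longrightarrow> cmod (g (x + u) - g x) < e / 2"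
      using CG_equicontinuous[OF g e2] by blast
    obtain L where L: "\<And>z. \<exists>q\<le>L. z - pt (int q) \<in> U" using finite_cover[OF U(1,2)] by blast
    \<comment> \<open>For M > M0 the boundary terms, at most 2 * L * B, take less than half of M *
      e; the termwise error takes the other half.\<close>
    obtain M0 where M0: "4 * real L * B / e < real M0" using reals_Archimedean2 by blast
    have "cmod (A M x - A M y) < e" if M: "M \<ge> Suc M0" for M x y
    proof -
      have Mp: "real M > 0" using M by simp
      \<comment> \<open>The point x + pt q lies within \<open>U\<close> of y: it is compared with y
        term by term, and with x by shifting the sum.\<close>
      obtain q where q: "q \<le> L" "y - x - pt (int q) \<in> U" using L by blast
      let ?s = "\<lambda>x. (\<Sum>k<M. g (x + pt (int k)))"
      have 1: "cmod (?s (x + pt (int q)) - ?s x) \<le> 2 * real L * B"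
      proof -
        have "?s (x + pt (int q)) = (\<Sum>k<M. g (x + pt (int (k + q))))"
          by (intro sum.cong refl) (simp add: gmult_add add_ac)
        then have "cmod (?s (x + pt (int q)) - ?s x) \<le> 2 * real q * B"
          using shifted_sum_diff[of "\<lambda>k. g (x + pt (int k))" B q M] B by simp
        also have "\<dots> \<le> 2 * real L * B" using q(1) B(1) by (intro mult_right_mono) auto
        finally show ?thesis .
      qed
      have 2: "cmod (?s y - ?s (x + pt (int q))) \<le> real M * (e / 2)"
      proof -
        have "cmod (?s y - ?s (x + pt (int q))) \<le> (\<Sum>k<M. e / 2)"
          unfolding sum_subtractf[symmetric]
        proof (intro sum_norm_le)
          fix k
          have "cmod (g ((x + pt (int q) + pt (int k)) + (y - x - pt (int q))) - g (x + pt (int q) + pt (int k))) < e/2"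
            by (rule U(3)[OF q(2)])
          then show "cmod (g (y + pt (int k)) - g (x + pt (int q) + pt (int k))) \<le> e / 2"
            by (simp add: algebra_simps)
        qed
        then show ?thesis by simp
      qed
      have "cmod (?s y - ?s x) \<le> 2 * real L * B + real M * (e / 2)"
        using norm_triangle_ineq[of "?s y - ?s (x + pt (int q))" "?s (x + pt (int q)) - ?s x"] 1 2 by simp
      also have "\<dots> < real M * e"
      proof -
        have "4 * real L * B < real M0 * e" using M0 e by (simp add: field_simps)
        also have "\<dots> \<le> real M * e" using M e by (intro mult_right_mono) auto
        finally show ?thesis by simp
      qed
      finally have "cmod (?s x - ?s y) < real M * e" by (simp add: norm_minus_commute)
      then show ?thesis using Mp
        by (simp add: A_def diff_divide_distrib[symmetric] norm_divide field_simps)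
    qed
    then show ?thesis by blast
  qed
  have bdd: "bounded (range (\<lambda>M. A M 0))"
  proof (rule boundedI)
    fix z assume "z \<in> range (\<lambda>M. A M 0)"
    then obtain M where M: "z = A M 0" by auto
    have "cmod (\<Sum>k<M. g (0 + pt (int k))) \<le> (\<Sum>k<M. B)" by (intro sum_norm_le B)
    then show "cmod z \<le> B" using B(1) unfolding M A_def
      by (cases "M = 0") (auto simp: norm_divide field_simps)
  qed
  \<comment> \<open>A limit along a subsequence is enough, because the oscillation over the group of
    every sufficiently long average is small.\<close>
  obtain c r where cr: "strict_mono r" "((\<lambda>M. A M 0) \<circ> r) \<longlonglongrightarrow> c"
    using bounded_imp_convergent_subsequence[OF bdd] by auto
  show ?thesis
  proof (rule that[of c])
    fix e :: real assume e: "e > 0"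
    obtain M0 where M0: "M0 > 0" "\<forall>M\<ge>M0. \<forall>x y. cmod (A M x - A M y) < e/2" using osc[of "e/2"] e by auto
    obtain n0 where n0: "\<forall>n\<ge>n0. cmod (A (r n) 0 - c) < e/2"
      using LIMSEQ_D[OF cr(2), of "e/2"] e by auto
    define M where "M = r (max n0 M0)"
    have M: "M \<ge> M0" "M > 0"
      using seq_suble[OF cr(1), of "max n0 M0"] M0(1) by (auto simp: M_def)
    have "cmod (A M x - c) < e" for x
    proof -
      have "cmod (A M x - A M 0) < e/2" using M0(2) M(1) by blast
      moreover have "cmod (A M 0 - c) < e/2" using n0[rule_format, of "max n0 M0"] by (simp add: M_def)
      ultimately show ?thesis using norm_triangle_ineq[of "A M x - A M 0" "A M 0 - c"] by simp
    qed
    then show "\<exists>M>0. \<forall>x. cmod ((\<Sum>k<M. g (x + pt (int k))) / of_nat M - c) < e"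
      using M(2) unfolding A_def by blast
  qed
qed

section \<open>Recurrence, exponential sums and characters\<close>

lemma return_times:
  assumes "open V" "0 \<in> V"
  obtains L :: nat where "\<And>s. \<exists>m\<in>{s..s + L}. pt (int m) \<in> V"
proof -
  obtain L where L: "\<And>z. \<exists>q\<le>L. z - pt (int q) \<in> V" using finite_cover[OF assms] by blast
  have "\<exists>m\<in>{s..s + L}. pt (int m) \<in> V" for s
  proof -
    \<comment> \<open>Covering the orbit point of index s + L makes s + L - q a return time, and it
      lies in the window because q <= L.\<close>
    obtain q where q: "q \<le> L" "pt (int (s + L)) - pt (int q) \<in> V" using L by blast
    have "int (s + L - q) = int (s + L) - int q" using q(1) by simp
    then have "pt (int (s + L - q)) \<in> V" using q(2) by (simp only: gmult_diff)
    then show ?thesis using q(1) by (intro bexI[of _ "s + L - q"]) auto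
  qed
  then show ?thesis using that by blast
qed

text \<open>Parseval alone would give sums of order sqrt N. The gain comes from return times to 0:
  if m and q both return, then g is close to g 0 at pt (m - q), so that summing over q produces no
  cancellation. Return times have density at least 1/(L + 1), which makes the bound linear in
  N.\<close>

lemma orbit_exponential_sum:
  assumes g: "g \<in> CG" "g (0::'g) \<noteq> 0"
  obtains c z N where "c > 0" "\<And>k. cmod (z k) = 1" "\<And>k. N k > k"
    "\<And>k. c * real (N k) \<le> cmod (\<Sum>l<N k. g (pt (int l)) * z k ^ l)"
proof -
  \<comment> \<open>At a return time m the modulus of g stays above 3 * h, and the shifts by q cost
    at most h more, which leaves 2 * h.\<close>
  define h where "h = cmod (g 0) / 4"
  have h: "h > 0" using g by (simp add: h_def)
  obtain U where U: "open U" "0 \<in> U" "\<And>u x. u \<in> U \<Longrightarrow> cmod (g (x + u) - g x) < h"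
    using CG_equicontinuous[OF g(1) h] by blast
  \<comment> \<open>Symmetric, because - pt q has to lie in \<open>U\<close> as well.\<close>
  define V where "V = U \<inter> uminus -` U"
  have V: "open V" "0 \<in> V"
    using U by (auto simp: V_def intro!: open_Int open_vimage continuous_intros)
  obtain L where L: "\<And>s. \<exists>m\<in>{s..s + L}. pt (int m) \<in> V" using return_times[OF V] by blast
  \<comment> \<open>With N = 2 * Suc k * Suc L the lower bound Suc k * h equals c * N.\<close>
  define c where "c = h / (2 * real (Suc L))"
  have "\<exists>z N. cmod z = 1 \<and> N > k \<and> c * real N \<le> cmod (\<Sum>l<N. g (pt (int l)) * z ^ l)" for k
  proof -
    define D where "D = Suc k * Suc L"
    define N where "N = D + D"
    \<comment> \<open>\<open>Q\<close> and \<open>G\<close> are the return times in the first and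
      the second half of {0..<N}, so the subtraction m - q on natural numbers is never
      truncated.\<close>
    define Q where "Q = {m \<in> {0..<0 + Suc k * Suc L}. pt (int m) \<in> V}"
    define G where "G = {m \<in> {D..<D + Suc k * Suc L}. pt (int m) \<in> V}"
    have cQ: "Suc k \<le> card Q" unfolding Q_def by (rule card_windows_ge[OF L])
    have cG: "Suc k \<le> card G" unfolding G_def by (rule card_windows_ge[OF L])
    have Qs: "Q \<subseteq> {..<D}" "finite Q" by (auto simp: Q_def D_def)
    have Q0: "Q \<noteq> {}" using cQ by (intro notI) simp
    have Gs: "G \<subseteq> {D..<N}" by (auto simp: G_def N_def D_def)
    have big: "real (card Q) * h \<le> cmod (\<Sum>q\<in>Q. g (pt (int (m - q))))" if m: "m \<in> G" for m
    proof -
      have mV: "pt (int m) \<in> U" using m by (auto simp: G_def V_def)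
      have 1: "cmod (g (pt (int m)) - g 0) < h" using U(3)[OF mV, of 0] by simp
      have 2: "cmod (g (pt (int (m - q))) - g (pt (int m))) \<le> h" if q: "q \<in> Q" for q
      proof -
        have "int (m - q) = int m - int q" using m q Gs Qs by force
        then have "pt (int (m - q)) = pt (int m) + - pt (int q)" by (simp only: gmult_diff) simp
        moreover have "- pt (int q) \<in> U" using q by (auto simp: Q_def V_def)
        ultimately show ?thesis using U(3)[of "- pt (int q)" "pt (int m)"] by (metis less_imp_le)
      qed
      have "cmod ((\<Sum>q\<in>Q. g (pt (int (m - q)))) - of_nat (card Q) * g (pt (int m))) \<le> real (card Q) * h"
      proof -
        have "(\<Sum>q\<in>Q. g (pt (int (m - q)))) - of_nat (card Q) * g (pt (int m)) =
          (\<Sum>q\<in>Q. g (pt (int (m - q))) - g (pt (int m)))" by (simp add: sum_subtractf)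
        also have "cmod \<dots> \<le> (\<Sum>q\<in>Q. h)" by (intro sum_norm_le 2)
        finally show ?thesis by simp
      qed
      moreover have "real (card Q) * (3 * h) \<le> real (card Q) * cmod (g (pt (int m)))"
        using 1 norm_triangle_ineq2[of "g 0" "g (pt (int m))"] unfolding h_def
        by (intro mult_left_mono) (auto simp: norm_minus_commute)
      ultimately have "real (card Q) * (3 * h) - real (card Q) * h \<le> cmod (\<Sum>q\<in>Q. g (pt (int (m - q))))"
        using norm_triangle_ineq2[of "of_nat (card Q) * g (pt (int m))" "\<Sum>q\<in>Q. g (pt (int (m - q)))"]
        unfolding norm_minus_commute[of "of_nat (card Q) * g (pt (int m))"] norm_mult norm_of_nat by linarith
      moreover have "0 \<le> real (card Q) * h" using h by simp
      ultimately show ?thesis by linarith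
    qed
    obtain z where z: "cmod z = 1" "real (card Q) * real (card G) * h\<^sup>2 \<le> (cmod (\<Sum>l<N. g (pt (int l)) * z ^ l))\<^sup>2"
    proof (rule large_exponential_sum[of D N Q G h "\<lambda>l. g (pt (int l))"])
      show "D \<le> N" "0 < N" by (auto simp: N_def D_def)
    qed (use Qs Q0 Gs h big in auto)
    have "(real (Suc k) * h)\<^sup>2 \<le> (cmod (\<Sum>l<N. g (pt (int l)) * z ^ l))\<^sup>2"
    proof -
      have "(real (Suc k) * h)\<^sup>2 = real (Suc k) * real (Suc k) * h\<^sup>2" by (simp add: power2_eq_square)
      also have "\<dots> \<le> real (card Q) * real (card G) * h\<^sup>2"
        using cQ cG by (intro mult_right_mono mult_mono) auto
      finally show ?thesis using z(2) by linarith
    qed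
    then have "real (Suc k) * h \<le> cmod (\<Sum>l<N. g (pt (int l)) * z ^ l)"
      by (rule power2_le_imp_le) simp
    moreover have "c * real N = real (Suc k) * h"
    proof -
      have "real N = 2 * (real (Suc k) * real (Suc L))" unfolding N_def D_def by (simp only: of_nat_add of_nat_mult mult_2)
      moreover have "h / (2 * a) * (2 * (b * a)) = b * h" if "a \<noteq> 0" for a b :: real
        using that by (simp add: field_simps)
      ultimately show ?thesis unfolding c_def by (metis of_nat_eq_0_iff nat.distinct(1))
    qed
    moreover have "k < N" by (simp add: N_def D_def)
    ultimately show ?thesis using z(1) by (intro exI[of _ z] exI[of _ N]) simp
  qed
  then obtain z N where "\<And>k. cmod (z k) = 1 \<and> N k > k \<and> c * real (N k) \<le> cmod (\<Sum>l<N k. g (pt (int l)) * z k ^ l)"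
    by metis
  moreover have "c > 0" using h by (simp add: c_def)
  ultimately show ?thesis using that by blast
qed

text \<open>The frequency is a limit of the numbers z k of \<open>orbit_exponential_sum\<close>. The
  sum shifted by q differs from the original by boundary terms, and from z k ^ q times the original
  by the variation of g. Dividing by the length and passing to the limit gives the third property.
  For a coboundary g the same shift relates its sum to z k ^ n - 1 times the sum of a, which gives
  the fourth and keeps z ^ n away from 1.\<close>

lemma orbit_frequency:
  assumes g: "g \<in> CG" "g (0::'g) \<noteq> 0"
  obtains c z where "c > 0" "cmod z = 1"
    "\<And>q e. (\<And>x. cmod (g (x + pt (int q)) - g x) \<le> e) \<Longrightarrow> c * cmod (z ^ q - 1) \<le> e"
    "\<And>a n B. (\<And>x. g x = a (x + pt (int n)) - a x) \<Longrightarrow> (\<And>x. cmod (a x) \<le> B) \<Longrightarrow> c \<le> cmod (z ^ n - 1) * B"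
proof -
  obtain c z N where cz: "c > 0" "\<And>k. cmod (z k) = 1" "\<And>k. N k > k"
    "\<And>k. c * real (N k) \<le> cmod (\<Sum>l<N k. g (pt (int l)) * z k ^ l)"
    by (rule orbit_exponential_sum[OF g]) blast
  have "bounded (range z)" using cz(2) by (intro boundedI[of _ 1]) auto
  then obtain w r where w: "strict_mono r" "(z \<circ> r) \<longlonglongrightarrow> w"
    using bounded_imp_convergent_subsequence by blast
  define y where "y k = z (r k)" for k
  define M where "M k = N (r k)" for k
  have y: "y \<longlonglongrightarrow> w" using w(2) unfolding y_def o_def .
  have y1: "cmod (y k) = 1" for k using cz by (simp add: y_def)
  \<comment> \<open>The lengths grow at least like k, so the boundary terms are dominated by C/(k +
    1).\<close>
  have Mk: "real k + 1 \<le> real (M k)" for k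
    using cz(3)[of "r k"] seq_suble[OF w(1), of k] by (simp add: M_def)
  have S: "c * real (M k) \<le> cmod (\<Sum>l<M k. g (pt (int l)) * y k ^ l)" for k
    using cz(4)[of "r k"] by (simp add: M_def y_def)
  obtain B where B: "0 < B" "\<And>x. cmod (g x) \<le> B" using CG_bounded[OF g(1)] by blast
  have small: "(\<lambda>k. C / (real k + 1)) \<longlonglongrightarrow> 0" for C
    by (intro tendsto_divide_0[OF tendsto_const] filterlim_at_top_imp_at_infinity
        filterlim_at_top_mono[OF filterlim_real_sequentially] always_eventually) auto
  have ypow: "(\<lambda>k. cmod (y k ^ q - 1)) \<longlonglongrightarrow> cmod (w ^ q - 1)" for q
    by (intro tendsto_intros y)
  have w1: "cmod w = 1"
    using LIMSEQ_unique[OF tendsto_norm[OF y]] y1 by simp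
  have 1: "c * cmod (w ^ q - 1) \<le> e" if q: "\<And>x. cmod (g (x + pt (int q)) - g x) \<le> e" for q e
  proof -
    have "c * cmod (y k ^ q - 1) \<le> e + 2 * real q * B / (real k + 1)" for k
    proof -
      define s where "s = (\<Sum>l<M k. g (pt (int l)) * y k ^ l)"
      have a: "cmod ((\<Sum>l<M k. g (pt (int (l + q))) * y k ^ (l + q)) - s) \<le> 2 * real q * B"
        unfolding s_def by (rule shifted_sum_diff) (use B y1 in \<open>auto simp: norm_mult norm_power\<close>)
      have b: "cmod ((\<Sum>l<M k. g (pt (int (l + q))) * y k ^ (l + q)) - y k ^ q * s) \<le> real (M k) * e"
      proof -
        have "(\<Sum>l<M k. g (pt (int (l + q))) * y k ^ (l + q)) - y k ^ q * s =
          (\<Sum>l<M k. (g (pt (int l) + pt (int q)) - g (pt (int l))) * y k ^ (l + q))"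
          by (simp add: s_def sum_distrib_left sum_subtractf[symmetric] algebra_simps gmult_add power_add)
        also have "cmod \<dots> \<le> (\<Sum>l<M k. e)"
          by (intro sum_norm_le) (use q y1 in \<open>simp add: norm_mult norm_power\<close>)
        finally show ?thesis by simp
      qed
      have "cmod (y k ^ q * s - s) \<le> real (M k) * e + 2 * real q * B"
        using a b norm_triangle_ineq4[of "(\<Sum>l<M k. g (pt (int (l + q))) * y k ^ (l + q)) - s"
           "(\<Sum>l<M k. g (pt (int (l + q))) * y k ^ (l + q)) - y k ^ q * s"] by simp
      moreover have "cmod (y k ^ q * s - s) = cmod (y k ^ q - 1) * cmod s"
        unfolding norm_mult[symmetric] by (simp add: algebra_simps)
      moreover have "cmod (y k ^ q - 1) * (c * real (M k)) \<le> cmod (y k ^ q - 1) * cmod s"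
        using S[of k] by (intro mult_left_mono) (auto simp: s_def)
      ultimately have "real (M k) * (c * cmod (y k ^ q - 1)) \<le> real (M k) * e + 2 * real q * B"
        by (simp add: mult_ac)
      moreover have "real (M k) > 0" using Mk[of k] by linarith
      ultimately have "c * cmod (y k ^ q - 1) \<le> e + 2 * real q * B / real (M k)"
        by (simp add: field_simps)
      also have "2 * real q * B / real (M k) \<le> 2 * real q * B / (real k + 1)"
        using Mk[of k] B(1) by (intro divide_left_mono) auto
      finally show ?thesis by simp
    qed
    then show ?thesis
      using LIMSEQ_le[OF tendsto_mult_left[OF ypow] tendsto_add[OF tendsto_const small]] by fastforce
  qed
  have 2: "c \<le> cmod (w ^ n - 1) * C" if a: "\<And>x. g x = a (x + pt (int n)) - a x" "\<And>x. cmod (a x) \<le> C" for a n C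
  proof -
    have "c \<le> cmod (y k ^ n - 1) * C + 2 * real n * C / (real k + 1)" for k
    proof -
      define s where "s = (\<Sum>l<M k. g (pt (int l)) * y k ^ l)"
      define t where "t = (\<Sum>l<M k. a (pt (int l)) * y k ^ l)"
      have C: "C \<ge> 0" using a(2)[of 0] norm_ge_zero order_trans by blast
      have b: "cmod ((\<Sum>l<M k. a (pt (int (l + n))) * y k ^ (l + n)) - t) \<le> 2 * real n * C"
        unfolding t_def by (rule shifted_sum_diff) (use a(2) y1 in \<open>auto simp: norm_mult norm_power\<close>)
      have "y k ^ n * s = (\<Sum>l<M k. a (pt (int (l + n))) * y k ^ (l + n)) - y k ^ n * t"
        by (simp add: s_def t_def a(1) sum_distrib_left sum_subtractf[symmetric] algebra_simps gmult_add power_add)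
      then have eq: "y k ^ n * s = ((\<Sum>l<M k. a (pt (int (l + n))) * y k ^ (l + n)) - t) - (y k ^ n - 1) * t"
        by (simp add: algebra_simps)
      have "cmod s = cmod (y k ^ n * s)" using y1 by (simp add: norm_mult norm_power)
      also have "\<dots> \<le> 2 * real n * C + cmod (y k ^ n - 1) * cmod t"
        unfolding eq norm_mult[symmetric] by (rule order_trans[OF norm_triangle_ineq4 add_right_mono[OF b]])
      also have "cmod t \<le> (\<Sum>l<M k. C)"
        unfolding t_def by (intro sum_norm_le) (use a(2) y1 in \<open>simp add: norm_mult norm_power\<close>)
      finally have "c * real (M k) \<le> 2 * real n * C + cmod (y k ^ n - 1) * (real (M k) * C)"
        using S[of k] by (simp add: s_def mult_left_mono)
      moreover have "real (M k) > 0" using Mk[of k] by linarith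
      ultimately have "c \<le> cmod (y k ^ n - 1) * C + 2 * real n * C / real (M k)"
        by (simp add: field_simps)
      also have "2 * real n * C / real (M k) \<le> 2 * real n * C / (real k + 1)"
        using Mk[of k] C by (intro divide_left_mono) auto
      finally show ?thesis by simp
    qed
    then show ?thesis
      using LIMSEQ_le[OF tendsto_const tendsto_add[OF tendsto_mult_right[OF ypow] small]] by fastforce
  qed
  show ?thesis by (rule that[OF cz(1) w1 1 2])
qed

text \<open>The closure \<open>K\<close> of the graph of pt l |-> z powi l lies in the compact
  product of the group with the closed unit disc. Its projection is closed and contains the dense
  orbit, so it is everything. The continuity assumption at 0 makes the fibres singletons, so
  \<open>K\<close> is itself a graph, that of the character.\<close>

lemma character_extension:
  assumes z: "cmod z = 1"
    and cont: "\<And>e. e > 0 \<Longrightarrow> \<exists>U. open U \<and> 0 \<in> U \<and> (\<forall>q::nat. pt (int q) \<in> U \<longrightarrow> cmod (z ^ q - 1) \<le> e)"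
  obtains ch :: "'g \<Rightarrow> complex" where "character ch" "\<And>l. ch (pt l) = z powi l"
proof -
  have z0: "z \<noteq> 0" using z by auto
  have zn: "cmod (z powi l) = 1" for l by (simp add: norm_power_int z)
  \<comment> \<open>Negative exponents follow from |z powi (- q) - 1| = |z ^ q - 1| on a symmetric
    neighbourhood.\<close>
  have cont': "\<exists>U. open U \<and> 0 \<in> U \<and> (\<forall>l. pt l \<in> U \<longrightarrow> cmod (z powi l - 1) \<le> e)" if e: "e > 0" for e
  proof -
    obtain U where U: "open U" "0 \<in> U" "\<And>q::nat. pt (int q) \<in> U \<Longrightarrow> cmod (z ^ q - 1) \<le> e"
      using cont[OF e] by blast
    have "cmod (z powi l - 1) \<le> e" if l: "pt l \<in> U \<inter> uminus -` U" for l
    proof (cases "l \<ge> 0")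
      case True
      then show ?thesis using U(3)[of "nat l"] l by (simp add: power_int_def)
    next
      case False
      define q where "q = nat (- l)"
      have lq: "l = - int q" using False by (simp add: q_def)
      have "cmod (z ^ q - 1) \<le> e"
        using U(3)[of q] l by (simp add: lq gmult_minus)
      moreover have "z powi l - 1 = z powi l * (1 - z ^ q)"
        unfolding lq power_int_minus using z0 by (simp add: field_simps)
      then have "cmod (z powi l - 1) = cmod (z ^ q - 1)"
        by (simp add: norm_mult zn norm_minus_commute)
      ultimately show ?thesis by simp
    qed
    moreover have "open (U \<inter> uminus -` U)" "0 \<in> U \<inter> uminus -` U"
      using U by (auto intro!: open_Int open_vimage continuous_intros)
    ultimately show ?thesis by blast
  qed
  define Gr where "Gr = range (\<lambda>l. (pt l, z powi l))"
  define K where "K = closure Gr"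
  have close: "cmod (w - v) \<le> e"
    if "(x, w) \<in> K" "(y, v) \<in> K" "x - y \<in> U" "open U" "\<And>l. pt l \<in> U \<Longrightarrow> cmod (z powi l - 1) \<le> e"
    for x y w v U e
  proof -
    \<comment> \<open>The implication from x - y in U to |w - v| <= e, written as a union of two
      closed sets so that it passes from \<open>Gr\<close> to its closure.\<close>
    define C where "C = {p. fst (fst p) - fst (snd p) \<in> - U} \<union> {p :: ('g \<times> complex) \<times> 'g \<times> complex. cmod (snd (fst p) - snd (snd p)) \<le> e}"
    have "closed C" unfolding C_def
    proof (rule closed_Un)
      have "closed ((\<lambda>p. fst (fst p) - fst (snd p)) -` (- U) :: (('g \<times> complex) \<times> 'g \<times> complex) set)"
        using that(4) by (intro closed_vimage continuous_intros) (auto simp: closed_Compl)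
      then show "closed {p :: ('g \<times> complex) \<times> 'g \<times> complex. fst (fst p) - fst (snd p) \<in> - U}"
        by (simp add: vimage_def)
      show "closed {p :: ('g \<times> complex) \<times> 'g \<times> complex. cmod (snd (fst p) - snd (snd p)) \<le> e}"
        by (intro closed_Collect_le continuous_intros)
    qed
    moreover have "Gr \<times> Gr \<subseteq> C"
    proof
      fix p assume "p \<in> Gr \<times> Gr"
      then obtain l m where p: "p = ((pt l, z powi l), (pt m, z powi m))" by (auto simp: Gr_def)
      have "z powi l - z powi m = z powi m * (z powi (l - m) - 1)"
        using z0 by (simp add: power_int_diff field_simps)
      then have "cmod (z powi l - z powi m) = cmod (z powi (l - m) - 1)" by (simp add: norm_mult zn)
      then show "p \<in> C" unfolding C_def p using that(5)[of "l - m"] by (auto simp: gmult_diff)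
    qed
    ultimately have "K \<times> K \<subseteq> C" unfolding K_def closure_Times[symmetric] by (rule closure_minimal[rotated])
    then have "((x, w), (y, v)) \<in> C" using that by blast
    then show ?thesis using that(3) by (simp add: C_def)
  qed
  have "K \<subseteq> UNIV \<times> cball 0 1"
    unfolding K_def by (rule closure_minimal) (auto simp: Gr_def zn intro!: closed_Times)
  then have "K = (UNIV \<times> cball 0 1) \<inter> K" by blast
  then have "compact K"
    using compact_Int_closed[OF compact_Times[OF compact_UNIV compact_cball], of K 0 1] by (simp add: K_def)
  then have "compact (fst ` K)"
    by (rule compact_continuous_image[rotated]) (intro continuous_intros)
  then have clK: "closed (fst ` K)" by (rule compact_imp_closed)
  have GrK: "(pt l, z powi l) \<in> K" for l
    unfolding K_def by (rule subsetD[OF closure_subset]) (simp add: Gr_def)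
  have "x \<in> fst ` K" for x
    by (rule dense_closedD[OF clK]) (use GrK in force)
  then have "\<exists>w. (x, w) \<in> K" for x by force
  then obtain ch where ch: "\<And>x. (x, ch x) \<in> K" by metis
  have chpt: "ch (pt l) = z powi l" for l
  proof -
    have "cmod (ch (pt l) - z powi l) \<le> e" if "e > 0" for e
    proof -
      obtain U where U: "open U" "0 \<in> U" "\<And>l. pt l \<in> U \<Longrightarrow> cmod (z powi l - 1) \<le> e" using cont'[OF \<open>e > 0\<close>] by blast
      show ?thesis using close[OF ch GrK _ U(1) U(3), of "pt l" l] U(2) by simp
    qed
    then have "cmod (ch (pt l) - z powi l) \<le> 0" by (rule field_le_epsilon) simp
    then show ?thesis by simp
  qed
  have chc: "continuous_on UNIV ch"
    unfolding continuous_on_def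
  proof (intro ballI tendstoI)
    fix y :: 'g and e :: real assume e: "e > 0"
    then have e2: "e / 2 > 0" by simp
    obtain U where U: "open U" "0 \<in> U" "\<And>l. pt l \<in> U \<Longrightarrow> cmod (z powi l - 1) \<le> e / 2" using cont'[OF e2] by blast
    have "open ((\<lambda>x. x - y) -` U)" by (rule open_vimage[OF U(1)]) (intro continuous_intros)
    moreover have "y \<in> (\<lambda>x. x - y) -` U" using U(2) by simp
    moreover have "dist (ch x) (ch y) < e" if "x \<in> (\<lambda>x. x - y) -` U" for x
      using close[OF ch ch _ U(1) U(3), of x y] that e by (simp add: dist_norm)
    ultimately show "\<forall>\<^sub>F x in at y. dist (ch x) (ch y) < e"
      unfolding eventually_at_topological by blast
  qed
  \<comment> \<open>Density is used one variable at a time: two orbit points, then an orbit point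
    and any y, then any x and y.\<close>
  have add1: "ch (pt l + y) = ch (pt l) * ch y" for l y
  proof -
    have "(\<lambda>y. ch (pt l + y)) = (\<lambda>y. ch (pt l) * ch y)"
    proof (rule dense_eqI)
      show "continuous_on UNIV (\<lambda>y. ch (pt l + y))"
        by (rule continuous_on_compose2[OF chc]) (auto intro: continuous_intros)
      show "continuous_on UNIV (\<lambda>y. ch (pt l) * ch y)" by (intro continuous_intros chc)
      show "ch (pt l + pt m) = ch (pt l) * ch (pt m)" for m
        unfolding gmult_add[symmetric] chpt by (rule power_int_add) (use z0 in simp)
    qed
    then show ?thesis by (rule fun_cong)
  qed
  have add: "ch (x + y) = ch x * ch y" for x y
  proof -
    have "(\<lambda>x. ch (x + y)) = (\<lambda>x. ch x * ch y)"
    proof (rule dense_eqI)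
      show "continuous_on UNIV (\<lambda>x. ch (x + y))"
        by (rule continuous_on_compose2[OF chc]) (auto intro: continuous_intros)
      show "continuous_on UNIV (\<lambda>x. ch x * ch y)" by (intro continuous_intros chc)
    qed (rule add1)
    then show ?thesis by (rule fun_cong)
  qed
  have "(\<lambda>x. cmod (ch x)) = (\<lambda>x. 1)"
    by (rule dense_eqI) (auto intro!: continuous_intros chc simp: chpt zn)
  then have "cmod (ch x) = 1" for x by (rule fun_cong)
  then show ?thesis using that[of ch] chc add chpt unfolding character_def by blast
qed

text \<open>If a continuous function separates \<open>0\<close> from \<open>pt n\<close>, then the difference with its translate by
  \<open>pt n\<close> has a frequency, and this frequency is a character that separates the two points.\<close>

lemma characters_separate_nat:
  assumes n: "n > 0"
  obtains ch where "character ch" "ch (pt (int n)) \<noteq> 1"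
proof -
  have nz: "pt (int n) \<noteq> 0" using pt_nonzero n by simp
  have "Hausdorff_space (euclidean :: 'g topology)"
    unfolding Hausdorff_space_def disjnt_def by (metis hausdorff open_openin)
  moreover have "compact_space (euclidean :: 'g topology)"
    using compact_UNIV by (simp add: compact_space_def)
  ultimately have norm: "normal_space (euclidean :: 'g topology)"
    using compact_Hausdorff_or_regular_imp_normal_space by blast
  obtain f where f: "continuous_map euclidean euclideanreal f" "f ` {0} \<subseteq> {0}" "f ` {pt (int n)} \<subseteq> {1}"
    by (rule Urysohn_lemma_alt[OF norm, of "{0}" "{pt (int n)}" 0 1])
       (use nz in \<open>auto simp: disjnt_def\<close>)
  define a where "a x = complex_of_real (f x)" for x
  have aC: "continuous_on UNIV a" unfolding a_def
    using f(1) by (auto intro!: continuous_intros)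
  then have a: "a \<in> CG" by (simp add: CG_def)
  define g where "g x = a (x + pt (int n)) - a x" for x
  have g: "g \<in> CG" "g 0 \<noteq> 0"
    using aC CG_translate[OF a, of "pt (int n)"] f
    by (auto simp: g_def CG_def a_def intro!: continuous_intros)
  obtain B where B: "0 < B" "\<And>x. cmod (a x) \<le> B" using CG_bounded[OF a] by blast
  obtain c z where cz: "c > 0" "cmod z = 1"
    "\<And>q e. (\<And>x. cmod (g (x + pt (int q)) - g x) \<le> e) \<Longrightarrow> c * cmod (z ^ q - 1) \<le> e"
    "\<And>a n B. (\<And>x. g x = a (x + pt (int n)) - a x) \<Longrightarrow> (\<And>x. cmod (a x) \<le> B) \<Longrightarrow> c \<le> cmod (z ^ n - 1) * B"
    by (rule orbit_frequency[OF g]) blast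
  \<comment> \<open>If z ^ n were 1, the coboundary bound would read c <= 0.\<close>
  have zn: "z ^ n \<noteq> 1" using cz(4)[OF g_def B(2)] cz(1) by auto
  have cnt: "\<exists>U. open U \<and> 0 \<in> U \<and> (\<forall>q::nat. pt (int q) \<in> U \<longrightarrow> cmod (z ^ q - 1) \<le> e)" if e: "e > 0" for e
  proof -
    have ce: "c * e > 0" using cz(1) e by simp
    obtain U where U: "open U" "0 \<in> U" "\<And>u x. u \<in> U \<Longrightarrow> cmod (g (x + u) - g x) < c * e"
      using CG_equicontinuous[OF g(1) ce] by blast
    have "cmod (z ^ q - 1) \<le> e" if "pt (int q) \<in> U" for q
      using cz(3)[of q "c * e"] U(3)[OF that] cz(1) by (simp add: less_imp_le)
    then show ?thesis using U(1,2) by blast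
  qed
  obtain ch where ch: "character ch" "\<And>l. ch (pt l) = z powi l"
    using character_extension[OF cz(2) cnt] by blast
  then show ?thesis using that[of ch] zn by simp
qed

lemma characters_separate:
  assumes n: "n \<noteq> 0"
  obtains ch where "character ch" "ch (pt n) \<noteq> 1"
proof -
  obtain ch where ch: "character ch" "ch (pt (int (nat \<bar>n\<bar>))) \<noteq> 1"
    using characters_separate_nat[of "nat \<bar>n\<bar>"] n by auto
  have "ch (pt n) \<noteq> 1"
  proof (cases "n \<ge> 0")
    case False
    have m: "ch (x + y) = ch x * ch y" "cmod (ch x) = 1" for x y using ch(1) by (auto simp: character_def)
    have "ch 0 = 1" using m(1)[of 0 0] m(2)[of 0] by auto
    then have "ch (pt n) * ch (pt (- n)) = 1" by (simp add: gmult_minus flip: m(1))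
    then show ?thesis using ch(2) False by auto
  qed (use ch(2) in auto)
  then show ?thesis using that ch(1) by blast
qed

end

section \<open>Trigonometric polynomials on the group\<close>

lemma character_mult: "character f \<Longrightarrow> character g \<Longrightarrow> character (\<lambda>x. f x * g x)"
  unfolding character_def by (auto intro!: continuous_intros simp: norm_mult)

lemma character_cnj: "character f \<Longrightarrow> character (\<lambda>x. cnj (f x))"
  unfolding character_def by (auto intro!: continuous_intros)

lemma character_one: "character (\<lambda>_. 1)"
  unfolding character_def by auto

lemma character_continuous: "character f \<Longrightarrow> continuous_on UNIV f"
  unfolding character_def by auto

lemma character_add: "character f \<Longrightarrow> f (x + y) = f x * f y"
  unfolding character_def by auto

lemma character_nonzero: "character f \<Longrightarrow> f x \<noteq> 0"
  unfolding character_def by (metis norm_zero zero_neq_one)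

lemma Fspan_zero: "(\<lambda>_. 0) \<in> Fspan"
  unfolding Fspan_def by (auto intro!: exI[of _ "{}"])

lemma Fspan_character: "character ch \<Longrightarrow> (\<lambda>x. c * ch x) \<in> Fspan"
  unfolding Fspan_def by (auto intro!: exI[of _ "{ch}"] exI[of _ "\<lambda>_. c"])

lemma Fspan_add:
  assumes "f \<in> Fspan" "g \<in> Fspan"
  shows "(\<lambda>x. f x + g x) \<in> Fspan"
proof -
  obtain S c where S: "finite S" "S \<subseteq> {ch. character ch}" "f = (\<lambda>x. \<Sum>ch\<in>S. c ch * ch x)"
    using assms(1) unfolding Fspan_def by blast
  obtain S' c' where S': "finite S'" "S' \<subseteq> {ch. character ch}" "g = (\<lambda>x. \<Sum>ch\<in>S'. c' ch * ch x)"
    using assms(2) unfolding Fspan_def by blast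
  have ext: "(\<Sum>ch\<in>R. k ch * ch x) = (\<Sum>ch\<in>S \<union> S'. (if ch \<in> R then k ch else 0) * ch x)"
    if "R \<subseteq> S \<union> S'" for R k x
    using that S(1) S'(1) by (intro sum.mono_neutral_cong_left) auto
  have "(\<lambda>x. f x + g x) = (\<lambda>x. \<Sum>ch\<in>S \<union> S'. ((if ch \<in> S then c ch else 0) + (if ch \<in> S' then c' ch else 0)) * ch x)"
    unfolding S(3) S'(3) by (simp add: ext[of S] ext[of S'] sum.distrib distrib_right)
  then show ?thesis unfolding Fspan_def using S(1,2) S'(1,2)
    by (intro CollectI exI[of _ "S \<union> S'"] exI) auto
qed

lemma Fspan_induct [consumes 1, case_names zero add]:
  assumes "f \<in> Fspan" "P (\<lambda>_. 0)"
    and "\<And>c ch f. character ch \<Longrightarrow> f \<in> Fspan \<Longrightarrow> P f \<Longrightarrow> P (\<lambda>x. c * ch x + f x)"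
  shows "P f"
proof -
  obtain S c where S: "finite S" "S \<subseteq> {ch. character ch}" "f = (\<lambda>x. \<Sum>ch\<in>S. c ch * ch x)"
    using assms(1) unfolding Fspan_def by blast
  have "P (\<lambda>x. \<Sum>ch\<in>S. c ch * ch x)" using S(1,2)
  proof (induction S)
    case (insert ch S)
    have "(\<lambda>x. \<Sum>ch\<in>S. c ch * ch x) \<in> Fspan" using insert by (auto simp: Fspan_def)
    then show ?case using insert assms(3)[of ch "\<lambda>x. \<Sum>ch\<in>S. c ch * ch x" "c ch"] by simp
  qed (simp add: assms(2))
  then show ?thesis using S by simp
qed

text \<open>The common properties of \<open>CG\<close> and \<open>Fspan\<close> under which finite
  sums of weighted shifts with weights in \<open>A\<close> form a *-algebra, so that one argument
  describes \<open>Bcal\<close> and the dense subalgebra of \<open>Balg\<close>.\<close>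

definition admissible :: "('g::topological_ab_group_add \<Rightarrow> complex) set \<Rightarrow> bool" where
  "admissible A \<longleftrightarrow> A \<subseteq> CG \<and> (\<forall>f\<in>A. \<forall>c. (\<lambda>x. c * f x) \<in> A) \<and> (\<forall>f\<in>A. \<forall>g\<in>A. (\<lambda>x. f x * g x) \<in> A)
     \<and> (\<forall>f\<in>A. \<forall>a. (\<lambda>x. f (x + a)) \<in> A) \<and> (\<forall>f\<in>A. (\<lambda>x. cnj (f x)) \<in> A)"

lemma admissible_CG: "admissible (CG :: ('g::topological_ab_group_add \<Rightarrow> complex) set)"
proof -
  have "continuous_on UNIV (\<lambda>x. f (x + a))" if "continuous_on UNIV f" for f :: "'g \<Rightarrow> complex" and a
    by (rule continuous_on_compose2[OF that]) (auto intro: continuous_intros)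
  then show ?thesis unfolding admissible_def CG_def by (auto intro!: continuous_intros)
qed

lemma Fspan_scale: "f \<in> Fspan \<Longrightarrow> (\<lambda>x. c * f x) \<in> Fspan"
proof (induction rule: Fspan_induct)
  case (add k ch f)
  then show ?case using Fspan_add[OF Fspan_character[of ch "c * k"] add(3)] by (simp add: algebra_simps)
qed (simp add: Fspan_zero)

lemma admissible_Fspan: "admissible (Fspan :: ('g::topological_ab_group_add \<Rightarrow> complex) set)"
  unfolding admissible_def
proof (intro conjI ballI allI subsetI)
  fix f :: "'g \<Rightarrow> complex" assume f: "f \<in> Fspan"
  show "f \<in> CG" using f
    by (induction rule: Fspan_induct) (auto simp: CG_def intro!: continuous_intros dest: character_continuous)
  show "(\<lambda>x. c * f x) \<in> Fspan" for c using f by (rule Fspan_scale)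
  show "(\<lambda>x. f x * g x) \<in> Fspan" if g: "g \<in> Fspan" for g using f
  proof (induction rule: Fspan_induct)
    case (add c ch f)
    have "(\<lambda>x. c * ch x * g x) \<in> Fspan" using g
    proof (induction rule: Fspan_induct)
      case (add c' ch' f')
      have "(\<lambda>x. (c * c') * (ch x * ch' x) + c * ch x * f' x) \<in> Fspan"
        by (rule Fspan_add[OF Fspan_character[OF character_mult[OF \<open>character ch\<close> add(1)]] add(3)])
      then show ?case by (simp add: algebra_simps)
    qed (simp add: Fspan_zero)
    from Fspan_add[OF this add(3)] show ?case by (simp add: distrib_right)
  qed (simp add: Fspan_zero)
  show "(\<lambda>x. f (x + a)) \<in> Fspan" for a using f
  proof (induction rule: Fspan_induct)
    case (add c ch f)
    have "(\<lambda>x. (c * ch a) * ch x + f (x + a)) \<in> Fspan"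
      by (rule Fspan_add[OF Fspan_character[OF add(1)] add(3)])
    then show ?case using add(1) by (simp add: character_add mult_ac)
  qed (simp add: Fspan_zero)
  show "(\<lambda>x. cnj (f x)) \<in> Fspan" using f
  proof (induction rule: Fspan_induct)
    case (add c ch f)
    have "(\<lambda>x. cnj c * cnj (ch x) + cnj (f x)) \<in> Fspan"
      by (rule Fspan_add[OF Fspan_character[OF character_cnj[OF add(1)]] add(3)])
    then show ?case by simp
  qed (simp add: Fspan_zero)
qed

lemma Fspan_CG: "f \<in> Fspan \<Longrightarrow> f \<in> CG"
  using admissible_Fspan unfolding admissible_def by blast

lemma one_Fspan: "(\<lambda>_. 1) \<in> Fspan"
  using Fspan_character[OF character_one, of 1] by simp

section \<open>The weighted shifts \<open>V\<^sup>n M\<^sub>f\<close>\<close>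

context monothetic
begin

text \<open>The weighted shift V^n M_f, that is E_l |-> f(x_l) E_(l+n); its entries sit on the
  diagonal of index n.\<close>

definition VM :: "int \<Rightarrow> ('g \<Rightarrow> complex) \<Rightarrow> op" where
  "VM n f x = (if l2 x then (\<lambda>l. f (pt (l - n)) * x (l - n)) else (\<lambda>_. 0))"

lemma VM_bounded:
  assumes B: "\<And>x. cmod (f x) \<le> B"
  shows "bop (VM n f)" and "opnorm (VM n f) \<le> B"
proof -
  have B0: "0 \<le> B" using B[of 0] norm_ge_zero order_trans by blast
  have "L2_set (\<lambda>i. cmod (VM n f x i)) F \<le> B * l2norm x" if x: "l2 x" for x F
  proof -
    have "L2_set (\<lambda>i. cmod (VM n f x i)) F \<le> L2_set (\<lambda>i. B * cmod (x (i - n))) F"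
      using x by (intro L2_set_mono) (auto simp: VM_def norm_mult intro!: mult_right_mono B)
    also have "\<dots> = B * L2_set (\<lambda>i. cmod (x i)) ((\<lambda>i. i - n) ` F)"
      unfolding L2_set_right_distrib[OF B0, symmetric] L2_set_def by (subst sum.reindex) (auto simp: inj_on_def)
    also have "\<dots> \<le> B * l2norm x" by (intro mult_left_mono L2_set_le_l2norm x B0)
    finally show ?thesis .
  qed
  then have *: "l2 (VM n f x)" "l2norm (VM n f x) \<le> B * l2norm x" if "l2 x" for x
    using l2I[of "VM n f x" "B * l2norm x"] that by blast+
  show "bop (VM n f)"
    by (rule bopI[where K=B]) (use * l2_add(1) l2_scale(1) in \<open>auto simp: VM_def algebra_simps\<close>)
  show "opnorm (VM n f) \<le> B" by (rule opnorm_le_multI[OF *(2) B0])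
qed

lemma bop_VM: "f \<in> CG \<Longrightarrow> bop (VM n f)"
  using CG_bounded[of f] VM_bounded(1) by metis

lemma ent_VM: "ent (VM n f) i j = (if i = j + n then f (pt j) else 0)"
  by (simp add: ent_def VM_def l2_Evec) (auto simp: Evec_def)

lemma Vop_VM: "Vop = VM 1 (\<lambda>_. 1)" and Vinv_VM: "Vinv = VM (-1) (\<lambda>_. 1)" and Mop_VM: "Mop x1 f = VM 0 f"
  by (auto simp: fun_eq_iff VM_def Vop_def Vinv_def Mop_def)

lemma VM_add: "op_add (VM n f) (VM n g) = VM n (\<lambda>x. f x + g x)"
  and VM_scale: "op_scale c (VM n f) = VM n (\<lambda>x. c * f x)"
  by (auto simp: fun_eq_iff VM_def op_add_def op_scale_def distrib_right)

text \<open>The covariance relation: moving M_f to the right past V^m translates f by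
  \<open>pt m\<close>.\<close>

lemma VM_comp:
  assumes "g \<in> CG"
  shows "op_comp (VM n f) (VM m g) = VM (n + m) (\<lambda>x. f (x + pt m) * g x)"
proof -
  have "VM n f (VM m g x) = VM (n + m) (\<lambda>x. f (x + pt m) * g x) x" for x
  proof (cases "l2 x")
    case True
    then have "l2 (VM m g x)" by (rule bop_l2[OF bop_VM[OF assms]])
    moreover have "pt (l - n) = pt (l - (n + m)) + pt m" for l
      unfolding gmult_add[symmetric] by simp
    ultimately show ?thesis using True by (simp add: VM_def fun_eq_iff mult.assoc diff_diff_eq)
  next
    case False
    then show ?thesis by (simp add: VM_def l2_zero)
  qed
  then show ?thesis by (simp add: op_comp_def fun_eq_iff)
qed

lemma ent_comp_VM:
  assumes "bop T"
  shows "ent (op_comp T (VM n f)) i j = f (pt j) * ent T i (j + n)"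
proof -
  have "VM n f (Evec j) = (\<lambda>l. f (pt j) * Evec (j + n) l)"
    unfolding VM_def if_P[OF l2_Evec] by (auto simp: Evec_def fun_eq_iff)
  then show ?thesis by (simp add: ent_def op_comp_def bop_scale[OF assms l2_Evec])
qed

lemma ent_VM_comp:
  assumes "bop T"
  shows "ent (op_comp (VM n f) T) i j = f (pt (i - n)) * ent T (i - n) j"
  by (simp add: ent_def op_comp_def VM_def bop_l2[OF assms l2_Evec])

lemma is_adj_VM:
  assumes f: "f \<in> CG"
  shows "is_adj (VM n f) (VM (- n) (\<lambda>x. cnj (f (x + pt (- n)))))"
proof -
  have "(\<lambda>x. cnj (f (x + pt (- n)))) \<in> CG"
    using CG_translate[OF f, of "pt (- n)"] unfolding CG_def by (auto intro: continuous_intros)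
  then have b: "bop (VM (- n) (\<lambda>x. cnj (f (x + pt (- n)))))" by (rule bop_VM)
  have "l2inner (VM n f x) y = l2inner x (VM (- n) (\<lambda>x. cnj (f (x + pt (- n)))) y)" if "l2 x" "l2 y" for x y
  proof -
    have "l2inner (VM n f x) y = (\<Sum>\<^sub>\<infinity>l. f (pt (l - n)) * x (l - n) * cnj (y l))"
      using that by (simp add: l2inner_def VM_def)
    also have "\<dots> = (\<Sum>\<^sub>\<infinity>l. f (pt l) * x l * cnj (y (l + n)))"
      by (rule infsum_reindex_bij_witness[of _ "\<lambda>l. l + n" "\<lambda>l. l - n"]) auto
    also have "\<dots> = l2inner x (VM (- n) (\<lambda>x. cnj (f (x + pt (- n)))) y)"
      using that by (simp add: l2inner_def VM_def gmult_add[symmetric] mult_ac)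
    finally show ?thesis .
  qed
  then show ?thesis using b unfolding is_adj_def by blast
qed

text \<open>Sums are the only operation generated: for admissible \<open>A\<close> the weights
  absorb scalars, products and adjoints (\<open>band_scale\<close>, \<open>band_comp\<close>,
  \<open>band_adj\<close>).\<close>

inductive_set band :: "('g \<Rightarrow> complex) set \<Rightarrow> op set" for A where
  VM: "f \<in> A \<Longrightarrow> VM n f \<in> band A"
| add: "T \<in> band A \<Longrightarrow> S \<in> band A \<Longrightarrow> op_add T S \<in> band A"

lemma band_mono: "A \<subseteq> A' \<Longrightarrow> T \<in> band A \<Longrightarrow> T \<in> band A'"
  by (erule band.induct) (auto intro: band.intros)

lemma band_bop: "A \<subseteq> CG \<Longrightarrow> T \<in> band A \<Longrightarrow> bop T"
  by (erule band.induct) (auto intro: bop_VM bop_op_add)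

lemma op_comp_add_left: "op_comp (op_add T T') S = op_add (op_comp T S) (op_comp T' S)"
  by (simp add: op_comp_def op_add_def)

lemma op_comp_add_right:
  assumes "bop T" "bop S" "bop S'"
  shows "op_comp T (op_add S S') = op_add (op_comp T S) (op_comp T S')"
proof
  fix x
  show "op_comp T (op_add S S') x = op_add (op_comp T S) (op_comp T S') x"
    using bop_add[OF assms(1) bop_l2'[OF assms(2)] bop_l2'[OF assms(3)], of x x]
    by (simp add: op_comp_def op_add_def)
qed

context
  fixes A :: "('g \<Rightarrow> complex) set" assumes A: "admissible A"
begin

lemma admissible_sub: "A \<subseteq> CG"
  and admissible_mult: "f \<in> A \<Longrightarrow> g \<in> A \<Longrightarrow> (\<lambda>x. f x * g x) \<in> A"
  and admissible_translate: "f \<in> A \<Longrightarrow> (\<lambda>x. f (x + a)) \<in> A"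
  and admissible_cnj: "f \<in> A \<Longrightarrow> (\<lambda>x. cnj (f x)) \<in> A"
  using A unfolding admissible_def by simp_all

lemma band_scale: "T \<in> band A \<Longrightarrow> op_scale c T \<in> band A"
proof (induction rule: band.induct)
  case (VM f n)
  then show ?case using A unfolding VM_scale admissible_def by (auto intro: band.VM)
next
  case (add T S)
  have "op_scale c (op_add T S) = op_add (op_scale c T) (op_scale c S)"
    by (simp add: op_scale_def op_add_def distrib_left)
  then show ?case using add by (simp add: band.add)
qed

lemma band_comp:
  assumes "T \<in> band A" "S \<in> band A" shows "op_comp T S \<in> band A"
  using assms(1)
proof (induction rule: band.induct)
  case (VM f n)
  show ?case using assms(2)
  proof (induction rule: band.induct)
    case (VM g m)
    have "(\<lambda>x. f (x + pt m) * g x) \<in> A"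
      by (rule admissible_mult[OF admissible_translate[OF \<open>f \<in> A\<close>] VM])
    moreover have "g \<in> CG" using VM admissible_sub by blast
    ultimately show ?case by (simp add: VM_comp band.VM)
  next
    case (add T S)
    have "op_comp (VM n f) (op_add T S) = op_add (op_comp (VM n f) T) (op_comp (VM n f) S)"
      using VM add admissible_sub by (intro op_comp_add_right bop_VM band_bop) auto
    then show ?case using add by (simp add: band.add)
  qed
qed (simp add: op_comp_add_left band.add)

lemma band_adj:
  assumes "T \<in> band A" shows "\<exists>S\<in>band A. is_adj T S"
  using assms
proof (induction rule: band.induct)
  case (VM f n)
  have "(\<lambda>x. cnj (f (x + pt (- n)))) \<in> A"
    by (rule admissible_cnj[OF admissible_translate[OF VM]])
  moreover have "f \<in> CG" by (rule subsetD[OF admissible_sub VM])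
  ultimately show ?case using is_adj_VM[of f n] band.VM by blast
next
  case (add T S)
  then obtain T' S' where "T' \<in> band A" "S' \<in> band A" "is_adj T T'" "is_adj S S'" by blast
  then show ?case
    using is_adj_add[OF band_bop[OF admissible_sub add(1)] band_bop[OF admissible_sub add(2)]] band.add by blast
qed

lemma star_alg_le_band:
  assumes "S \<subseteq> band A" "T \<in> star_alg S" shows "T \<in> band A"
  using assms(2)
proof (induction rule: star_alg.induct)
  case (adjoint T)
  then obtain S where "S \<in> band A" "is_adj T S" using band_adj by blast
  then show ?case by (simp add: adj_eqI)
qed (use assms(1) in \<open>auto intro: band.add band_scale band_comp\<close>)

lemma band_le_star_alg:
  assumes one: "(\<lambda>_. 1) \<in> A" and V: "Vop \<in> star_alg S" "Vinv \<in> star_alg S"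
    and M: "\<And>f. f \<in> A \<Longrightarrow> Mop x1 f \<in> star_alg S" and T: "T \<in> band A"
  shows "T \<in> star_alg S"
  using T
proof (induction rule: band.induct)
  case (VM f n)
  have 1: "(\<lambda>_ :: 'g. 1) \<in> CG" by (rule subsetD[OF admissible_sub one])
  have "VM n (\<lambda>_. 1) \<in> star_alg S"
  proof (induction n rule: int_induct[where k=0])
    case base
    then show ?case using M[OF one] by (simp add: Mop_VM)
  next
    case (step1 i)
    then show ?case using star_alg.comp[OF V(1) step1(2)] by (simp add: Vop_VM VM_comp[OF 1] add.commute)
  next
    case (step2 i)
    then show ?case using star_alg.comp[OF V(2) step2(2)] by (simp add: Vinv_VM VM_comp[OF 1])
  qed
  moreover have "f \<in> CG" by (rule subsetD[OF admissible_sub VM])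
  ultimately show ?case
    using star_alg.comp[OF _ M[OF VM], of "VM n (\<lambda>_. 1)"] by (simp add: Mop_VM VM_comp)
qed (rule star_alg.add)

end

text \<open>Covariance and the adjoint formula keep finite sums of weighted shifts stable under the
  algebra operations. Inductions over \<open>Bcal x1\<close> thereby reduce to sums and a single
  \<open>VM n f\<close>.\<close>

lemma Bcal_eq: "Bcal x1 = band Fspan"
proof (intro equalityI subsetI)
  fix T assume "T \<in> Bcal x1"
  moreover have "{Vop, Vinv} \<union> {Mop x1 ch |ch. character ch} \<subseteq> band Fspan"
    using Fspan_character[of _ 1] one_Fspan by (auto simp: Vop_VM Vinv_VM Mop_VM intro!: band.VM)
  ultimately show "T \<in> band Fspan" unfolding Bcal_def using star_alg_le_band[OF admissible_Fspan] by blast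
next
  fix T assume T: "T \<in> band Fspan"
  have gen: "X \<in> Bcal x1" if "X \<in> {Vop, Vinv} \<union> {Mop x1 ch |ch. character ch}" for X
    using that unfolding Bcal_def by (rule star_alg.gen)
  have ch: "Mop x1 (\<lambda>x. c * ch x) \<in> Bcal x1" if "character ch" for c ch
  proof -
    have "Mop x1 ch \<in> Bcal x1" using that by (intro gen) blast
    then have "op_scale c (Mop x1 ch) \<in> Bcal x1" unfolding Bcal_def by (rule star_alg.scale)
    then show ?thesis by (simp add: Mop_VM VM_scale)
  qed
  have M: "Mop x1 f \<in> Bcal x1" if "f \<in> Fspan" for f using that
  proof (induction rule: Fspan_induct)
    case zero
    then show ?case using ch[OF character_one, of 0] by simp
  next
    case (add c ch f)
    then show ?case using star_alg.add[OF ch[OF add(1), of c, unfolded Bcal_def] add(3)[unfolded Bcal_def]]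
      by (simp add: Bcal_def Mop_VM VM_add)
  qed
  show "T \<in> Bcal x1" unfolding Bcal_def
    by (rule band_le_star_alg[OF admissible_Fspan one_Fspan _ _ _ T])
       (use gen M in \<open>auto simp: Bcal_def\<close>)
qed

lemma one_CG: "(\<lambda>_ :: 'g. 1) \<in> CG" by (simp add: CG_def)

lemma Balg_eq: "Balg x1 = norm_closure (band CG)"
proof -
  let ?S = "{Vop} \<union> {Mop x1 f | f. f \<in> CG}"
  have gen: "X \<in> star_alg ?S" if "X \<in> ?S" for X
    using that by (rule star_alg.gen)
  \<comment> \<open>The generators of \<open>Balg x1\<close> lack the inverse shift; the adjoint
    provides it.\<close>
  have "adj Vop = Vinv"
    using adj_eqI[OF is_adj_VM[OF one_CG, of 1]] by (simp add: Vop_VM Vinv_VM)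
  then have Vi: "Vinv \<in> star_alg ?S" using star_alg.adjoint[OF gen[of Vop]] by simp
  have "T \<in> star_alg ?S" if "T \<in> band CG" for T
    by (rule band_le_star_alg[OF admissible_CG one_CG gen Vi gen that]) auto
  moreover have "?S \<subseteq> band CG" using one_CG by (auto simp: Vop_VM Mop_VM intro!: band.VM)
  then have "T \<in> band CG" if "T \<in> star_alg ?S" for T
    using star_alg_le_band[OF admissible_CG] that by blast
  ultimately have "star_alg ?S = band CG" by blast
  then show ?thesis by (simp add: Balg_def)
qed

end

lemma mult_divide_add_one_less: "0 \<le> a \<Longrightarrow> 0 < e \<Longrightarrow> a * (e / (a + 1)) < e" for a e :: real
  by (simp add: field_simps)

lemma opnorm_zero: "opnorm (op_sub T T) = 0"
proof (rule antisym)
  have z: "op_sub T T x = (\<lambda>_. 0)" for x by (simp add: op_sub_def)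
  show "opnorm (op_sub T T) \<le> 0" by (rule opnorm_leI) (simp add: z l2norm_zero)
  have "bop (op_sub T T)" by (rule bopI[where K=0]) (auto simp: z l2_zero l2norm_zero)
  then show "0 \<le> opnorm (op_sub T T)" by (rule opnorm_nonneg)
qed

lemma opnorm_sub_triangle:
  assumes "bop T" "bop U" "bop S"
  shows "opnorm (op_sub T S) \<le> opnorm (op_sub T U) + opnorm (op_sub U S)"
proof -
  have "op_sub T S = op_add (op_sub T U) (op_sub U S)" by (simp add: op_sub_def op_add_def)
  then show ?thesis using bop_op_add(2)[OF bop_op_sub(1)[OF assms(1,2)] bop_op_sub(1)[OF assms(2,3)]] by simp
qed

lemma opnorm_sub_commute:
  assumes "bop T" "bop S"
  shows "opnorm (op_sub T S) = opnorm (op_sub S T)"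
proof -
  have "opnorm (op_sub T S) \<le> opnorm (op_sub S T)" if "bop T" "bop S" for T S
  proof -
    have "op_sub T S = op_scale (-1) (op_sub S T)" by (simp add: op_sub_def op_scale_def)
    then show ?thesis using bop_op_scale(2)[OF bop_op_sub(1)[OF that(2,1)], of "-1"] by simp
  qed
  then show ?thesis using assms by (intro antisym)
qed

context monothetic
begin

section \<open>Diagonals of elements of the norm closure\<close>

lemma Balg_bop: "T \<in> Balg x1 \<Longrightarrow> bop T"
  unfolding Balg_eq norm_closure_def by blast

lemma Balg_approx:
  assumes "T \<in> Balg x1" "e > 0"
  obtains U where "U \<in> band CG" "bop U" "opnorm (op_sub T U) < e"
  using assms band_bop[OF order_refl] unfolding Balg_eq norm_closure_def by blast

lemma BalgI:
  assumes "bop T" "\<And>e. e > 0 \<Longrightarrow> \<exists>U\<in>band CG. opnorm (op_sub T U) < e"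
  shows "T \<in> Balg x1"
  unfolding Balg_eq norm_closure_def using assms by blast

lemma band_Balg: "T \<in> band CG \<Longrightarrow> T \<in> Balg x1"
  by (rule BalgI) (auto intro: band_bop bexI[of _ T] simp: opnorm_zero)

lemma Balg_add:
  assumes T: "T \<in> Balg x1" and S: "S \<in> Balg x1"
  shows "op_add T S \<in> Balg x1"
proof (rule BalgI)
  fix e :: real assume "e > 0"
  then have e: "e / 2 > 0" by simp
  obtain U where U: "U \<in> band CG" "bop U" "opnorm (op_sub T U) < e / 2" using Balg_approx[OF T e] .
  obtain W where W: "W \<in> band CG" "bop W" "opnorm (op_sub S W) < e / 2" using Balg_approx[OF S e] .
  have "op_sub (op_add T S) (op_add U W) = op_add (op_sub T U) (op_sub S W)"
    by (simp add: op_sub_def op_add_def algebra_simps)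
  then have "opnorm (op_sub (op_add T S) (op_add U W)) < e"
    using bop_op_add(2)[OF bop_op_sub(1)[OF Balg_bop[OF T] U(2)] bop_op_sub(1)[OF Balg_bop[OF S] W(2)]] U(3) W(3)
    by simp
  then show "\<exists>U\<in>band CG. opnorm (op_sub (op_add T S) U) < e" using band.add[OF U(1) W(1)] by blast
qed (intro bop_op_add Balg_bop T S)

lemma Balg_scale:
  assumes T: "T \<in> Balg x1"
  shows "op_scale c T \<in> Balg x1"
proof (rule BalgI)
  fix e :: real assume e0: "e > 0"
  have e: "e / (cmod c + 1) > 0" using e0 by (simp add: add_nonneg_pos)
  obtain U where U: "U \<in> band CG" "bop U" "opnorm (op_sub T U) < e / (cmod c + 1)" using Balg_approx[OF T e] .
  have "op_sub (op_scale c T) (op_scale c U) = op_scale c (op_sub T U)"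
    by (simp add: op_sub_def op_scale_def algebra_simps)
  then have "opnorm (op_sub (op_scale c T) (op_scale c U)) \<le> cmod c * opnorm (op_sub T U)"
    using bop_op_scale(2)[OF bop_op_sub(1)[OF Balg_bop[OF T] U(2)]] by simp
  also have "\<dots> \<le> cmod c * (e / (cmod c + 1))" using U(3) by (intro mult_left_mono) auto
  also have "\<dots> < e" by (rule mult_divide_add_one_less[OF norm_ge_zero e0])
  finally show "\<exists>U\<in>band CG. opnorm (op_sub (op_scale c T) U) < e"
    using band_scale[OF admissible_CG U(1)] by blast
qed (intro bop_op_scale Balg_bop T)

lemma Balg_sub: "T \<in> Balg x1 \<Longrightarrow> S \<in> Balg x1 \<Longrightarrow> op_sub T S \<in> Balg x1"
  unfolding op_sub_eq by (intro Balg_add Balg_scale)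

lemma Balg_comp_band:
  assumes T: "T \<in> Balg x1" and X: "X \<in> band CG"
  shows "op_comp T X \<in> Balg x1"
proof (rule BalgI)
  have bX: "bop X" using band_bop[OF order_refl X] .
  show "bop (op_comp T X)" by (rule bop_op_comp(1)[OF Balg_bop[OF T] bX])
  fix e :: real assume e0: "e > 0"
  have nn: "0 \<le> opnorm X" by (rule opnorm_nonneg[OF bX])
  then have e: "e / (opnorm X + 1) > 0" using e0 by simp
  obtain U where U: "U \<in> band CG" "bop U" "opnorm (op_sub T U) < e / (opnorm X + 1)" using Balg_approx[OF T e] .
  have "op_sub (op_comp T X) (op_comp U X) = op_comp (op_sub T U) X"
    by (simp add: op_sub_def op_comp_def)
  then have "opnorm (op_sub (op_comp T X) (op_comp U X)) \<le> opnorm (op_sub T U) * opnorm X"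
    using bop_op_comp(2)[OF bop_op_sub(1)[OF Balg_bop[OF T] U(2)] bX] by simp
  also have "\<dots> \<le> e / (opnorm X + 1) * opnorm X" using U(3) nn by (intro mult_right_mono) auto
  also have "\<dots> < e" using e0 nn by (simp add: field_simps)
  finally show "\<exists>U\<in>band CG. opnorm (op_sub (op_comp T X) U) < e"
    using band_comp[OF admissible_CG U(1) X] by blast
qed

lemma band_diagonal:
  assumes "T \<in> band A" and z: "(\<lambda>_. 0) \<in> A" and a: "\<And>f g. f \<in> A \<Longrightarrow> g \<in> A \<Longrightarrow> (\<lambda>x. f x + g x) \<in> A"
  shows "\<exists>f\<in>A. \<forall>l. ent T (l + n) l = f (pt l)"
  using assms(1)
proof (induction rule: band.induct)
  case (VM f m)
  show ?case
  proof (cases "m = n")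
    case True
    then show ?thesis using VM by (intro bexI[of _ f]) (auto simp: ent_VM)
  next
    case False
    then show ?thesis by (intro bexI[OF _ z]) (auto simp: ent_VM)
  qed
next
  case (add T S)
  then obtain f g where "f \<in> A" "g \<in> A" "\<forall>l. ent T (l + n) l = f (pt l)" "\<forall>l. ent S (l + n) l = g (pt l)" by blast
  then show ?case by (intro bexI[OF _ a[of f g]]) auto
qed

lemma CG_add: "f \<in> CG \<Longrightarrow> g \<in> CG \<Longrightarrow> (\<lambda>x. f x + g x) \<in> CG"
  unfolding CG_def by (auto intro: continuous_intros)

lemma zero_CG: "(\<lambda>_ :: 'g. 0) \<in> CG" by (simp add: CG_def)

text \<open>The diagonals of approximants from \<open>band CG\<close> converge uniformly along the
  orbit. The estimates are closed conditions, so by density these continuous functions are uniformly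
  Cauchy on the whole group, and their limit is continuous.\<close>

lemma Balg_diagonal:
  assumes T: "T \<in> Balg x1"
  shows "\<exists>f\<in>CG. \<forall>l. ent T (l + n) l = f (pt l)"
proof -
  have "\<exists>U f. bop U \<and> opnorm (op_sub T U) < 1 / real (Suc k) \<and> f \<in> CG \<and> (\<forall>l. ent U (l + n) l = f (pt l))" for k
  proof -
    have e: "1 / real (Suc k) > 0" by simp
    obtain U where U: "U \<in> band CG" "bop U" "opnorm (op_sub T U) < 1 / real (Suc k)" using Balg_approx[OF T e] .
    obtain f where "f \<in> CG" "\<forall>l. ent U (l + n) l = f (pt l)"
      using band_diagonal[OF U(1) zero_CG CG_add, of n] by blast
    then show ?thesis using U by blast
  qed
  then obtain U f where Uf: "\<And>k. bop (U k)" "\<And>k. opnorm (op_sub T (U k)) < 1 / real (Suc k)"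
    "\<And>k. f k \<in> CG" "\<And>k l. ent (U k) (l + n) l = f k (pt l)"
    by metis
  have close: "cmod (ent T (l + n) l - f k (pt l)) \<le> 1 / real (Suc k)" for k l
    using cmod_ent_le[OF bop_op_sub(1)[OF Balg_bop[OF T] Uf(1)], of k "l + n" l] Uf(2)[of k] Uf(4)[of k l] by simp
  have fk: "continuous_on UNIV (f k)" for k using Uf(3)[of k] by (simp add: CG_def)
  have cauchy: "cmod (f k x - f m x) \<le> 1 / real (Suc k) + 1 / real (Suc m)" for k m x
  proof -
    have "closed {x. cmod (f k x - f m x) \<le> 1 / real (Suc k) + 1 / real (Suc m)}"
      by (intro closed_Collect_le continuous_intros fk)
    moreover have "cmod (f k (pt l) - f m (pt l)) \<le> 1 / real (Suc k) + 1 / real (Suc m)" for l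
      using close[of l k] close[of l m] norm_triangle_ineq4[of "ent T (l + n) l - f m (pt l)" "ent T (l + n) l - f k (pt l)"]
      by simp
    ultimately show ?thesis using dense_closedD by blast
  qed
  have "uniformly_Cauchy_on UNIV f"
  proof (rule uniformly_Cauchy_onI)
    fix e :: real assume "e > 0"
    then obtain M where M: "inverse (real (Suc M)) < e / 2" using reals_Archimedean[of "e/2"] by auto
    have "dist (f m x) (f k x) < e" if "m \<ge> M" "k \<ge> M" for m k x
    proof -
      have "1 / real (Suc m) \<le> inverse (real (Suc M))" "1 / real (Suc k) \<le> inverse (real (Suc M))"
        using that by (auto simp: inverse_eq_divide intro!: divide_left_mono)
      then show ?thesis using cauchy[of m x k] M by (simp add: dist_norm)
    qed
    then show "\<exists>M. \<forall>x\<in>UNIV. \<forall>m\<ge>M. \<forall>n\<ge>M. dist (f m x) (f n x) < e" by blast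
  qed
  then obtain g where g: "uniform_limit UNIV f g sequentially"
    using Cauchy_uniformly_convergent uniformly_convergent_on_def by blast
  have "continuous_on UNIV g"
    by (rule uniform_limit_theorem[OF _ g]) (simp_all add: fk)
  moreover have "ent T (l + n) l = g (pt l)" for l
  proof (rule LIMSEQ_unique)
    show "(\<lambda>k. f k (pt l)) \<longlonglongrightarrow> g (pt l)" by (rule tendsto_uniform_limitI[OF g]) simp
    have "(\<lambda>k. f k (pt l) - ent T (l + n) l) \<longlonglongrightarrow> 0"
      by (rule Lim_null_comparison[OF _ LIMSEQ_inverse_real_of_nat])
         (use close in \<open>auto simp: norm_minus_commute inverse_eq_divide\<close>)
    then show "(\<lambda>k. f k (pt l)) \<longlonglongrightarrow> ent T (l + n) l" by (rule LIM_zero_cancel)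
  qed
  ultimately show ?thesis unfolding CG_def by blast
qed

text \<open>The Fourier coefficient of index \<open>n\<close>: formally T is the sum of the
  operators \<open>VM n (diag T n)\<close>. Density of the orbit makes the choice unique, see
  \<open>diag_eqI\<close>.\<close>

definition diag :: "op \<Rightarrow> int \<Rightarrow> 'g \<Rightarrow> complex" where
  "diag T n = (SOME f. f \<in> CG \<and> (\<forall>l. ent T (l + n) l = f (pt l)))"

lemma
  assumes "T \<in> Balg x1"
  shows diag_CG: "diag T n \<in> CG" and diag_pt: "diag T n (pt l) = ent T (l + n) l"
proof -
  have "diag T n \<in> CG \<and> (\<forall>l. ent T (l + n) l = diag T n (pt l))"
    using someI_ex[of "\<lambda>f. f \<in> CG \<and> (\<forall>l. ent T (l + n) l = f (pt l))"] Balg_diagonal[OF assms, of n]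
    unfolding diag_def by blast
  then show "diag T n \<in> CG" "diag T n (pt l) = ent T (l + n) l" by auto
qed

lemma diag_eqI:
  assumes f: "f \<in> CG" "\<And>l. ent T (l + n) l = f (pt l)"
  shows "diag T n = f"
proof -
  have "diag T n \<in> CG \<and> (\<forall>l. ent T (l + n) l = diag T n (pt l))"
    unfolding diag_def by (rule someI[of _ f]) (use f in blast)
  then show ?thesis using f by (intro dense_eqI) (auto simp: CG_def)
qed

lemma diag_add:
  assumes "T \<in> Balg x1" "S \<in> Balg x1"
  shows "diag (op_add T S) n = (\<lambda>x. diag T n x + diag S n x)"
  by (rule diag_eqI[OF CG_add[OF diag_CG[OF assms(1)] diag_CG[OF assms(2)]]]) (simp add: diag_pt assms)

lemma diag_scale:
  assumes "T \<in> Balg x1"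
  shows "diag (op_scale c T) n = (\<lambda>x. c * diag T n x)"
  by (rule diag_eqI) (use diag_CG[OF assms, of n] in \<open>auto simp: diag_pt assms CG_def intro: continuous_intros\<close>)

lemma diag_VM: "f \<in> CG \<Longrightarrow> diag (VM n f) m = (if m = n then f else (\<lambda>_. 0))"
  by (rule diag_eqI) (auto simp: ent_VM zero_CG)

lemma bandF_Balg: "T \<in> band Fspan \<Longrightarrow> T \<in> Balg x1"
  using band_Balg band_mono Fspan_CG by blast

lemma diag_Fspan:
  assumes "T \<in> band Fspan" shows "diag T n \<in> Fspan"
proof -
  obtain f where "f \<in> Fspan" "\<forall>l. ent T (l + n) l = f (pt l)"
    using band_diagonal[OF assms Fspan_zero Fspan_add, of n] by blast
  then show ?thesis using diag_eqI[OF Fspan_CG] by metis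
qed

section \<open>Convergence of Fejer means\<close>

text \<open>A weighted shift occupies a single diagonal, so its Fejer mean is a multiple of it by a
  scalar that tends to 1.\<close>

lemma fejer_band:
  assumes "U \<in> band CG" "e > 0"
  shows "\<forall>\<^sub>F N in sequentially. \<exists>S. bop S \<and> (\<forall>i j. ent S i j = of_real (fejer N (i - j)) * ent U i j)
    \<and> opnorm (op_sub S U) < e"
  using assms
proof (induction arbitrary: e rule: band.induct)
  case (VM f n)
  have b: "bop (VM n f)" by (rule bop_VM[OF VM(1)])
  have "(\<lambda>N. cmod (of_real (fejer N n) - 1) * opnorm (VM n f)) \<longlonglongrightarrow> cmod (of_real 1 - 1) * opnorm (VM n f)"
    by (intro tendsto_intros fejer_tendsto)
  then have "\<forall>\<^sub>F N in sequentially. cmod (of_real (fejer N n) - 1) * opnorm (VM n f) < e"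
    by (rule order_tendstoD) (use VM in simp)
  then show ?case
  proof eventually_elim
    case (elim N)
    let ?S = "op_scale (of_real (fejer N n)) (VM n f)"
    have "op_sub ?S (VM n f) = op_scale (of_real (fejer N n) - 1) (VM n f)"
      by (simp add: op_sub_def op_scale_def algebra_simps)
    then have "opnorm (op_sub ?S (VM n f)) < e"
      using bop_op_scale(2)[OF b, of "of_real (fejer N n) - 1"] elim by simp
    moreover have "bop ?S" by (rule bop_op_scale(1)[OF b])
    ultimately show ?case by (intro exI[of _ ?S]) (auto simp: ent_VM)
  qed
next
  case (add T U)
  have e: "e / 2 > 0" using add by simp
  show ?case using add(3)[OF e] add(4)[OF e]
  proof eventually_elim
    case (elim N)
    then obtain S W where S: "bop S" "\<forall>i j. ent S i j = of_real (fejer N (i - j)) * ent T i j" "opnorm (op_sub S T) < e / 2"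
      and W: "bop W" "\<forall>i j. ent W i j = of_real (fejer N (i - j)) * ent U i j" "opnorm (op_sub W U) < e / 2" by blast
    have bT: "bop T" "bop U" using add band_bop by auto
    have "op_sub (op_add S W) (op_add T U) = op_add (op_sub S T) (op_sub W U)"
      by (simp add: op_sub_def op_add_def algebra_simps)
    then have "opnorm (op_sub (op_add S W) (op_add T U)) < e"
      using bop_op_add(2)[OF bop_op_sub(1)[OF S(1) bT(1)] bop_op_sub(1)[OF W(1) bT(2)]] S(3) W(3) by simp
    moreover have "bop (op_add S W)" by (rule bop_op_add(1)[OF S(1) W(1)])
    ultimately show ?case using S(2) W(2) by (intro exI[of _ "op_add S W"]) (simp add: distrib_left)
  qed
qed

text \<open>Fejer multipliers are contractions, so convergence on the dense set
  \<open>band CG\<close> extends to its closure. Quantifying over every bounded \<open>S\<close>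
  lets a Fejer mean be recognised from its entries alone.\<close>

lemma fejer_converges:
  assumes T: "T \<in> Balg x1" and e: "e > 0"
  shows "\<forall>\<^sub>F N in sequentially. \<forall>S. bop S \<longrightarrow> (\<forall>i j. ent S i j = of_real (fejer N (i - j)) * ent T i j)
    \<longrightarrow> opnorm (op_sub S T) < e"
proof -
  have e3: "e / 3 > 0" using e by simp
  obtain U where U: "U \<in> band CG" "bop U" "opnorm (op_sub T U) < e / 3" using Balg_approx[OF T e3] .
  have bT: "bop T" by (rule Balg_bop[OF T])
  show ?thesis using fejer_band[OF U(1) e3]
  proof eventually_elim
    case (elim N)
    then obtain W where W: "bop W" "\<forall>i j. ent W i j = of_real (fejer N (i - j)) * ent U i j"
      "opnorm (op_sub W U) < e / 3" by blast
    show ?case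
    proof (intro allI impI)
      fix S assume S: "bop S" "\<forall>i j. ent S i j = of_real (fejer N (i - j)) * ent T i j"
      have "opnorm (op_sub S W) \<le> opnorm (op_sub T U)"
        by (rule opnorm_fejer_le[OF bop_op_sub(1)[OF bT U(2)] bop_op_sub(1)[OF S(1) W(1)]])
           (use S(2) W(2) in \<open>simp add: right_diff_distrib\<close>)
      then show "opnorm (op_sub S T) < e"
        using opnorm_sub_triangle[OF S(1) W(1) bT] opnorm_sub_triangle[OF W(1) U(2) bT] U(3) W(3)
          opnorm_sub_commute[OF bT U(2)] by linarith
    qed
  qed
qed

end

section \<open>Derivations\<close>

lemma op_add_assoc: "op_add (op_add a b) c = op_add a (op_add b c)"
  and op_add_commute: "op_add a b = op_add b a"
  and op_add_left_commute: "op_add a (op_add b c) = op_add b (op_add a c)"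
  by (simp_all add: op_add_def add_ac)

lemmas op_add_ac = op_add_assoc op_add_commute op_add_left_commute

lemma op_comp_scale_right:
  assumes "bop T" "bop S"
  shows "op_comp T (op_scale c S) = op_scale c (op_comp T S)"
  using bop_scale[OF assms(1) bop_l2'[OF assms(2)]] by (simp add: op_comp_def op_scale_def)

lemma bop_sub_vec:
  assumes "bop T" "l2 x" "l2 y"
  shows "T (\<lambda>i. x i - y i) = (\<lambda>i. T x i - T y i)"
  using bop_add[OF assms(1,2) l2_scale(1)[OF assms(3)], of "-1"] bop_scale[OF assms(1,3), of "-1"] by simp

context monothetic
begin

lemma bandF_bop: "T \<in> band Fspan \<Longrightarrow> bop T"
  using Balg_bop bandF_Balg by blast

text \<open>Both sides are additive in each argument, so the Leibniz rule has to be checked on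
  weighted shifts only. It serves for \<open>derD\<close> and for \<open>commL\<close>.\<close>

lemma leibniz_band:
  assumes bopd: "\<And>b. b \<in> band Fspan \<Longrightarrow> bop (d b)"
    and add: "\<And>a b. a \<in> band Fspan \<Longrightarrow> b \<in> band Fspan \<Longrightarrow> d (op_add a b) = op_add (d a) (d b)"
    and base: "\<And>n f m g. f \<in> Fspan \<Longrightarrow> g \<in> Fspan \<Longrightarrow> d (op_comp (VM n f) (VM m g)) =
      op_add (op_comp (d (VM n f)) (VM m g)) (op_comp (VM n f) (d (VM m g)))"
    and a: "a \<in> band Fspan" and b: "b \<in> band Fspan"
  shows "d (op_comp a b) = op_add (op_comp (d a) b) (op_comp a (d b))"
  using a
proof (induction rule: band.induct)
  case (VM f n)
  have V: "VM n f \<in> band Fspan" using VM by (rule band.VM)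
  show ?case using b
  proof (induction rule: band.induct)
    case (VM g m)
    then show ?case using base[OF \<open>f \<in> Fspan\<close>] by simp
  next
    case (add S T)
    have "d (op_comp (VM n f) (op_add S T)) = d (op_add (op_comp (VM n f) S) (op_comp (VM n f) T))"
      by (simp add: op_comp_add_right bandF_bop V add)
    also have "\<dots> = op_add (d (op_comp (VM n f) S)) (d (op_comp (VM n f) T))"
      by (rule assms(2); rule band_comp[OF admissible_Fspan V]; fact)
    finally show ?case
      by (simp add: add assms(2) op_comp_add_right bandF_bop V bopd op_add_ac)
  qed
next
  case (add S T)
  have "d (op_comp (op_add S T) b) = d (op_add (op_comp S b) (op_comp T b))"
    by (simp add: op_comp_add_left)
  also have "\<dots> = op_add (d (op_comp S b)) (d (op_comp T b))"
    by (rule assms(2); rule band_comp[OF admissible_Fspan _ b]; fact)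
  finally show ?case
    by (simp add: add assms(2) op_comp_add_left op_add_ac)
qed

lemma band_generate:
  assumes P: "P Vop" "P Vinv" "\<And>f. f \<in> Fspan \<Longrightarrow> P (Mop x1 f)"
    and add: "\<And>a b. a \<in> band Fspan \<Longrightarrow> b \<in> band Fspan \<Longrightarrow> P a \<Longrightarrow> P b \<Longrightarrow> P (op_add a b)"
    and comp: "\<And>a b. a \<in> band Fspan \<Longrightarrow> b \<in> band Fspan \<Longrightarrow> P a \<Longrightarrow> P b \<Longrightarrow> P (op_comp a b)"
    and b: "b \<in> band Fspan"
  shows "P b"
  using b
proof (induction rule: band.induct)
  case (VM f n)
  have V1: "VM m (\<lambda>_. 1) \<in> band Fspan" for m by (rule band.VM[OF one_Fspan])
  have "P (VM n (\<lambda>_. 1))"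
  proof (induction n rule: int_induct[where k=0])
    case base
    then show ?case using P(3)[OF one_Fspan] by (simp add: Mop_VM)
  next
    case (step1 i)
    then show ?case using comp[OF V1 V1 P(1)[unfolded Vop_VM] step1(2)]
      by (simp add: VM_comp one_CG add.commute)
  next
    case (step2 i)
    then show ?case using comp[OF V1 V1 P(2)[unfolded Vinv_VM] step2(2)]
      by (simp add: VM_comp one_CG)
  qed
  from comp[OF V1 band.VM[OF VM] this P(3)[OF VM, unfolded Mop_VM]]
  show ?case by (simp add: VM_comp Fspan_CG[OF VM])
qed (rule add)

lemma derivation_alt:
  "derivation x1 d \<longleftrightarrow> (\<forall>b\<in>band Fspan. d b \<in> Balg x1) \<and>
     (\<forall>a\<in>band Fspan. \<forall>b\<in>band Fspan. d (op_add a b) = op_add (d a) (d b)) \<and>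
     (\<forall>a\<in>band Fspan. \<forall>c. d (op_scale c a) = op_scale c (d a)) \<and>
     (\<forall>a\<in>band Fspan. \<forall>b\<in>band Fspan. d (op_comp a b) = op_add (op_comp (d a) b) (op_comp a (d b)))"
  unfolding derivation_def Bcal_eq ..

lemma
  assumes "derivation x1 d"
  shows derivation_Balg: "b \<in> band Fspan \<Longrightarrow> d b \<in> Balg x1"
    and derivation_add: "a \<in> band Fspan \<Longrightarrow> b \<in> band Fspan \<Longrightarrow> d (op_add a b) = op_add (d a) (d b)"
    and derivation_scale: "a \<in> band Fspan \<Longrightarrow> d (op_scale c a) = op_scale c (d a)"
    and derivation_comp: "a \<in> band Fspan \<Longrightarrow> b \<in> band Fspan \<Longrightarrow>
      d (op_comp a b) = op_add (op_comp (d a) b) (op_comp a (d b))"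
    and derivation_bop: "b \<in> band Fspan \<Longrightarrow> bop (d b)"
  using assms Balg_bop unfolding derivation_alt by blast+

lemma derivation_combine:
  assumes d: "derivation x1 d" "derivation x1 d1" "derivation x1 d2"
  shows "derivation x1 (\<lambda>b. op_sub (op_sub (d b) (op_scale c (d1 b))) (d2 b))"
  unfolding derivation_alt
proof (intro conjI ballI allI)
  fix a b assume a: "a \<in> band Fspan" and b: "b \<in> band Fspan"
  show "op_sub (op_sub (d a) (op_scale c (d1 a))) (d2 a) \<in> Balg x1"
    by (intro Balg_sub Balg_scale derivation_Balg[OF d(1)] derivation_Balg[OF d(2)] derivation_Balg[OF d(3)] a)
  show "op_sub (op_sub (d (op_add a b)) (op_scale c (d1 (op_add a b)))) (d2 (op_add a b)) =
       op_add (op_sub (op_sub (d a) (op_scale c (d1 a))) (d2 a)) (op_sub (op_sub (d b) (op_scale c (d1 b))) (d2 b))"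
    unfolding derivation_add[OF d(1) a b] derivation_add[OF d(2) a b] derivation_add[OF d(3) a b]
    by (simp add: op_sub_def op_add_def op_scale_def algebra_simps)
  show "op_sub (op_sub (d (op_scale k a)) (op_scale c (d1 (op_scale k a)))) (d2 (op_scale k a)) =
       op_scale k (op_sub (op_sub (d a) (op_scale c (d1 a))) (d2 a))" for k
    unfolding derivation_scale[OF d(1) a] derivation_scale[OF d(2) a] derivation_scale[OF d(3) a]
    by (simp add: op_sub_def op_scale_def algebra_simps)
  have bops: "bop a" "bop b" "bop (d b)" "bop (d1 b)" "bop (d2 b)"
    using bandF_bop a b derivation_bop d by auto
  have "op_comp a (op_sub (op_sub (d b) (op_scale c (d1 b))) (d2 b)) =
      op_sub (op_sub (op_comp a (d b)) (op_scale c (op_comp a (d1 b)))) (op_comp a (d2 b))"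
    unfolding op_sub_eq
    by (simp add: op_comp_add_right op_comp_scale_right bops bop_op_add bop_op_scale)
  then show "op_sub (op_sub (d (op_comp a b)) (op_scale c (d1 (op_comp a b)))) (d2 (op_comp a b)) =
       op_add (op_comp (op_sub (op_sub (d a) (op_scale c (d1 a))) (d2 a)) b)
        (op_comp a (op_sub (op_sub (d b) (op_scale c (d1 b))) (d2 b)))"
    unfolding derivation_comp[OF d(1) a b] derivation_comp[OF d(2) a b] derivation_comp[OF d(3) a b]
    by (simp add: op_sub_def op_add_def op_scale_def op_comp_def algebra_simps)
qed

lemma op_comp_id:
  assumes "bop T"
  shows "op_comp T (VM 0 (\<lambda>_. 1)) = T" "op_comp (VM 0 (\<lambda>_. 1)) T = T"
proof -
  have b: "bop (VM 0 (\<lambda>_. 1))" by (rule bop_VM[OF one_CG])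
  show "op_comp T (VM 0 (\<lambda>_. 1)) = T"
    by (rule bop_eqI[OF bop_op_comp(1)[OF assms b] assms]) (simp add: ent_comp_VM[OF assms])
  show "op_comp (VM 0 (\<lambda>_. 1)) T = T"
    by (rule bop_eqI[OF bop_op_comp(1)[OF b assms] assms]) (simp add: ent_VM_comp[OF assms])
qed

lemma Vop_band: "Vop \<in> band Fspan" and Vinv_band: "Vinv \<in> band Fspan"
  and Mop_band: "f \<in> Fspan \<Longrightarrow> Mop x1 f \<in> band Fspan"
  by (auto simp: Vop_VM Vinv_VM Mop_VM intro: band.VM one_Fspan)

lemma ent_generator_comp:
  assumes "bop T"
  shows "ent (op_comp T Vop) i j = ent T i (j + 1)" "ent (op_comp Vop T) i j = ent T (i - 1) j"
    "ent (op_comp T Vinv) i j = ent T i (j - 1)" "ent (op_comp Vinv T) i j = ent T (i + 1) j"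
    "ent (op_comp T (Mop x1 f)) i j = f (pt j) * ent T i j" "ent (op_comp (Mop x1 f) T) i j = f (pt i) * ent T i j"
  unfolding Vop_VM Vinv_VM Mop_VM by (simp_all add: ent_comp_VM ent_VM_comp assms)

lemma derivation_one:
  assumes d: "derivation x1 d"
  shows "ent (d (VM 0 (\<lambda>_. 1))) i j = 0"
proof -
  let ?I = "VM 0 (\<lambda>_ :: 'g. 1 :: complex)"
  have I: "?I \<in> band Fspan" by (rule band.VM[OF one_Fspan])
  have "d (op_comp ?I ?I) = op_add (d ?I) (d ?I)"
    using derivation_comp[OF d I I] by (simp add: op_comp_id derivation_bop[OF d I])
  moreover have "op_comp ?I ?I = ?I" by (rule op_comp_id[OF bandF_bop[OF I]])
  ultimately have "ent (d ?I) i j = ent (d ?I) i j + ent (d ?I) i j" by (metis ent_simps(1))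
  then show ?thesis by simp
qed

text \<open>Differentiating V V^(-1) = 1 gives - V^(-1) d(V) V^(-1); the outer factors are the two
  index shifts.\<close>

lemma derivation_Vinv:
  assumes d: "derivation x1 d"
  shows "ent (d Vinv) i j = - ent (d Vop) (i + 1) (j - 1)"
proof -
  have b: "bop (d Vop)" "bop (d Vinv)" using derivation_bop[OF d] Vop_band Vinv_band by auto
  have "op_comp Vop Vinv = VM 0 (\<lambda>_. 1)" by (simp add: Vop_VM Vinv_VM VM_comp one_CG)
  then have "d (VM 0 (\<lambda>_. 1)) = op_add (op_comp (d Vop) Vinv) (op_comp Vop (d Vinv))"
    using derivation_comp[OF d Vop_band Vinv_band] by simp
  then have "ent (op_comp (d Vop) Vinv) (i + 1) j + ent (op_comp Vop (d Vinv)) (i + 1) j = 0"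
    using derivation_one[OF d, of "i + 1" j] by simp
  then show ?thesis using b by (simp add: ent_generator_comp add_eq_0_iff)
qed

text \<open>The value at \<open>Vinv\<close> is forced by the one at \<open>Vop\<close>, and the
  remaining elements are sums and products of generators.\<close>

lemma derivation_ext:
  assumes d: "derivation x1 d" "derivation x1 d'"
    and V: "d Vop = d' Vop" and M: "\<And>f. f \<in> Fspan \<Longrightarrow> d (Mop x1 f) = d' (Mop x1 f)"
    and b: "b \<in> band Fspan"
  shows "d b = d' b"
  using b
proof (rule band_generate[rotated -1, where P="\<lambda>b. d b = d' b"])
  show "d Vinv = d' Vinv"
    by (rule bop_eqI) (auto simp: derivation_Vinv[OF d(1)] derivation_Vinv[OF d(2)] V
        intro: derivation_bop[OF d(1)] derivation_bop[OF d(2)] Vinv_band)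
qed (use V M in \<open>auto simp: derivation_add[OF d(1)] derivation_add[OF d(2)]
      derivation_comp[OF d(1)] derivation_comp[OF d(2)]\<close>)

subsection \<open>The derivation \<open>\<delta>\<^sub>\<partial>\<close>\<close>

context
  fixes D assumes D: "phi_inv_derivation x1 D"
begin

lemma D_CG: "f \<in> Fspan \<Longrightarrow> D f \<in> CG"
  and D_add: "f \<in> Fspan \<Longrightarrow> g \<in> Fspan \<Longrightarrow> D (\<lambda>x. f x + g x) = (\<lambda>x. D f x + D g x)"
  and D_scale: "f \<in> Fspan \<Longrightarrow> D (\<lambda>x. c * f x) = (\<lambda>x. c * D f x)"
  and D_mult: "f \<in> Fspan \<Longrightarrow> g \<in> Fspan \<Longrightarrow> D (\<lambda>x. f x * g x) = (\<lambda>x. D f x * g x + f x * D g x)"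
  and D_inv: "f \<in> Fspan \<Longrightarrow> D (\<lambda>x. f (x + x1)) = (\<lambda>x. D f (x + x1))"
  using D unfolding phi_inv_derivation_def by simp_all

lemma D_zero: "D (\<lambda>_. 0) = (\<lambda>_. 0)"
  using D_scale[OF Fspan_zero, of 0] by simp

lemma D_one: "D (\<lambda>_. 1) = (\<lambda>_. 0)"
  using D_mult[OF one_Fspan one_Fspan] by (simp add: fun_eq_iff)

lemma D_translate:
  assumes f: "f \<in> Fspan"
  shows "D (\<lambda>x. f (x + pt m)) = (\<lambda>x. D f (x + pt m))"
proof (induction m rule: int_induct[where k=0])
  case base
  then show ?case by simp
next
  case (step1 i)
  have "(\<lambda>x. f (x + pt i)) \<in> Fspan" by (rule admissible_translate[OF admissible_Fspan f])
  from D_inv[OF this] show ?case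
    unfolding step1(2) gmult_Suc by (simp add: add.assoc add.commute[of x1])
next
  case (step2 i)
  have F: "(\<lambda>x. f (x + pt (i - 1))) \<in> Fspan" by (rule admissible_translate[OF admissible_Fspan f])
  have "(\<lambda>x. f (x + x1 + pt (i - 1))) = (\<lambda>x. f (x + pt i))"
    by (simp add: gmult_diff algebra_simps)
  then have "(\<lambda>x. D (\<lambda>x. f (x + pt (i - 1))) (x + x1)) = (\<lambda>x. D f (x + pt i))"
    using D_inv[OF F] step2(2) by simp
  \<comment> \<open>The backward step is one-step invariance evaluated at x - x1.\<close>
  then have "D (\<lambda>x. f (x + pt (i - 1))) (x - x1 + x1) = D f (x - x1 + pt i)" for x
    by (rule fun_cong)
  then show ?case by (simp add: fun_eq_iff gmult_diff algebra_simps)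
qed

text \<open>V^n M_f |-> V^n M_(D f), prescribed through the diagonals so that it does not depend on
  how \<open>b\<close> is written as a sum of weighted shifts.\<close>

definition derD :: "op \<Rightarrow> op" where
  "derD b = (SOME T. T \<in> band CG \<and> (\<forall>i j. ent T i j = D (diag b (i - j)) (pt j)))"

lemma derD:
  assumes "b \<in> band Fspan"
  shows "derD b \<in> band CG" and "ent (derD b) i j = D (diag b (i - j)) (pt j)"
proof -
  have "\<exists>T. T \<in> band CG \<and> (\<forall>i j. ent T i j = D (diag b (i - j)) (pt j))"
    using assms
  proof (induction rule: band.induct)
    case (VM f n)
    then show ?case
      by (intro exI[of _ "VM n (D f)"]) (auto simp: ent_VM diag_VM Fspan_CG D_zero intro!: band.VM D_CG)
  next
    case (add T S)
    then obtain T' S' where "T' \<in> band CG" "S' \<in> band CG" "\<forall>i j. ent T' i j = D (diag T (i - j)) (pt j)"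
      "\<forall>i j. ent S' i j = D (diag S (i - j)) (pt j)" by blast
    then show ?case using add
      by (intro exI[of _ "op_add T' S'"])
         (auto simp: diag_add bandF_Balg D_add diag_Fspan intro: band.add)
  qed
  from someI_ex[OF this] show "derD b \<in> band CG" "ent (derD b) i j = D (diag b (i - j)) (pt j)"
    unfolding derD_def by auto
qed

lemma derD_bop: "b \<in> band Fspan \<Longrightarrow> bop (derD b)"
  using band_bop[OF order_refl derD(1)] .

lemma derD_VM: "f \<in> Fspan \<Longrightarrow> derD (VM n f) = VM n (D f)"
  by (rule bop_eqI) (auto simp: derD(2) band.VM ent_VM diag_VM Fspan_CG D_zero intro!: derD_bop bop_VM D_CG)

lemma derD_add:
  assumes "a \<in> band Fspan" "b \<in> band Fspan"
  shows "derD (op_add a b) = op_add (derD a) (derD b)"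
  by (rule bop_eqI) (use assms in \<open>auto simp: derD(2) band.add diag_add bandF_Balg D_add diag_Fspan
      intro: derD_bop bop_op_add\<close>)

lemma derivation_derD: "derivation x1 derD"
  unfolding derivation_alt
proof (intro conjI ballI allI)
  fix a b assume a: "a \<in> band Fspan" and b: "b \<in> band Fspan"
  show "derD a \<in> Balg x1" using derD(1)[OF a] by (rule band_Balg)
  show "derD (op_add a b) = op_add (derD a) (derD b)" using a b by (rule derD_add)
  show "derD (op_scale c a) = op_scale c (derD a)" for c
    by (rule bop_eqI) (use a in \<open>auto simp: derD(2) band_scale[OF admissible_Fspan] diag_scale bandF_Balg D_scale diag_Fspan
      intro!: derD_bop bop_op_scale\<close>)
  show "derD (op_comp a b) = op_add (op_comp (derD a) b) (op_comp a (derD b))"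
  \<comment> \<open>On weighted shifts this is the Leibniz rule of \<open>D\<close> for a product
    with f translated by \<open>pt m\<close>; invariance identifies \<open>D\<close> of the
    translate with the translate of \<open>D f\<close>.\<close>
  proof (rule leibniz_band[OF derD_bop derD_add _ a b])
    fix n m and f g :: "'g \<Rightarrow> complex" assume f: "f \<in> Fspan" and g: "g \<in> Fspan"
    have ft: "(\<lambda>x. f (x + pt m)) \<in> Fspan" by (rule admissible_translate[OF admissible_Fspan f])
    have fg: "(\<lambda>x. f (x + pt m) * g x) \<in> Fspan" by (rule admissible_mult[OF admissible_Fspan ft g])
    show "derD (op_comp (VM n f) (VM m g)) =
       op_add (op_comp (derD (VM n f)) (VM m g)) (op_comp (VM n f) (derD (VM m g)))"
      unfolding VM_comp[OF Fspan_CG[OF g]] derD_VM[OF fg] derD_VM[OF f] derD_VM[OF g]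
        VM_comp[OF D_CG[OF g]] VM_add D_mult[OF ft g] D_translate[OF f] ..
  qed
qed

lemma derD_Vop: "derD Vop = (\<lambda>_ _. 0)"
  unfolding Vop_VM derD_VM[OF one_Fspan] D_one by (simp add: VM_def fun_eq_iff)

lemma derD_Mop: "f \<in> Fspan \<Longrightarrow> derD (Mop x1 f) = Mop x1 (D f)"
  by (simp add: Mop_VM derD_VM)

end

subsection \<open>The commutator with the position operator\<close>

definition is_commL :: "op \<Rightarrow> op \<Rightarrow> bool" where
  "is_commL b T \<longleftrightarrow> bop T \<and> (\<forall>x. finite {i. x i \<noteq> 0} \<longrightarrow>
       T x = (\<lambda>l. of_int l * b x l - b (\<lambda>i. of_int i * x i) l))"

text \<open>Left multiplication by the position operator scales row i by i, right multiplication
  scales column j by j. As these entries determine a bounded operator, the choice in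
  \<open>commL\<close> is unambiguous.\<close>

lemma is_commL_ent:
  assumes "is_commL b T" "bop b"
  shows "ent T i j = of_int (i - j) * ent b i j"
proof -
  have "{i. Evec j i \<noteq> 0} = {j}" by (auto simp: Evec_def)
  then have "T (Evec j) = (\<lambda>l. of_int l * b (Evec j) l - b (\<lambda>i. of_int i * Evec j i) l)"
    using assms(1) unfolding is_commL_def by simp
  moreover have "(\<lambda>i. of_int i * Evec j i) = (\<lambda>i. of_int j * Evec j i)"
    by (auto simp: Evec_def)
  ultimately show ?thesis
    by (simp add: ent_def bop_scale[OF assms(2) l2_Evec] left_diff_distrib)
qed

lemma is_commL_ex:
  assumes "b \<in> band Fspan" shows "\<exists>T\<in>band Fspan. is_commL b T"
  using assms
proof (induction rule: band.induct)
  case (VM f n)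
  let ?T = "op_scale (of_int n) (VM n f)"
  have T: "?T \<in> band Fspan" using VM by (intro band_scale[OF admissible_Fspan] band.VM)
  have "?T x = (\<lambda>l. of_int l * VM n f x l - VM n f (\<lambda>i. of_int i * x i) l)" if "finite {i. x i \<noteq> 0}" for x
  proof -
    have "l2 x" "l2 (\<lambda>i. of_int i * x i)"
      by (rule finite_support_norm_le(1)[OF that]; simp)+
    then show ?thesis by (simp add: op_scale_def VM_def algebra_simps)
  qed
  then show ?case using T bandF_bop[OF T] unfolding is_commL_def by blast
next
  case (add T S)
  then obtain T' S' where T: "T' \<in> band Fspan" "is_commL T T'" and S: "S' \<in> band Fspan" "is_commL S S'" by blast
  have "is_commL (op_add T S) (op_add T' S')"
    unfolding is_commL_def
  proof (intro conjI allI impI)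
    show "bop (op_add T' S')" using T(2) S(2) by (auto simp: is_commL_def intro: bop_op_add)
    fix x :: vec assume "finite {i. x i \<noteq> 0}"
    then have "T' x = (\<lambda>l. of_int l * T x l - T (\<lambda>i. of_int i * x i) l)"
      "S' x = (\<lambda>l. of_int l * S x l - S (\<lambda>i. of_int i * x i) l)"
      using T(2) S(2) by (auto simp: is_commL_def)
    then show "op_add T' S' x = (\<lambda>l. of_int l * op_add T S x l - op_add T S (\<lambda>i. of_int i * x i) l)"
      by (simp add: op_add_def fun_eq_iff distrib_left)
  qed
  then show ?case using band.add[OF T(1) S(1)] by blast
qed

lemma commL_band:
  assumes b: "b \<in> band Fspan"
  shows "commL b \<in> band Fspan" and "ent (commL b) i j = of_int (i - j) * ent b i j"
proof -
  obtain T where T: "T \<in> band Fspan" "is_commL b T" using is_commL_ex[OF b] by blast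
  have "commL b = (SOME T. is_commL b T)" unfolding commL_def is_commL_def ..
  then have c: "is_commL b (commL b)" using T(2) by (metis someI)
  note e = is_commL_ent[OF _ bandF_bop[OF b]]
  have "commL b = T"
    by (rule bop_eqI) (use c T in \<open>auto simp: e is_commL_def\<close>)
  then show "commL b \<in> band Fspan" "ent (commL b) i j = of_int (i - j) * ent b i j"
    using T e[OF c] by auto
qed

lemma commL_bop: "b \<in> band Fspan \<Longrightarrow> bop (commL b)"
  using commL_band(1) bandF_bop by blast

lemma commL_VM:
  assumes "f \<in> Fspan" shows "commL (VM n f) = VM n (\<lambda>x. of_int n * f x)"
proof -
  have V: "VM n f \<in> band Fspan" using assms by (rule band.VM)
  show ?thesis unfolding VM_scale[symmetric]
    by (rule bop_eqI[OF commL_bop[OF V] bop_op_scale(1)[OF bandF_bop[OF V]]])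
       (simp add: commL_band[OF V] ent_VM)
qed

lemma commL_add:
  assumes "a \<in> band Fspan" "b \<in> band Fspan"
  shows "commL (op_add a b) = op_add (commL a) (commL b)"
  by (rule bop_eqI) (use assms in \<open>auto simp: commL_band band.add distrib_left intro: commL_bop bop_op_add\<close>)

lemma derivation_commL: "derivation x1 commL"
  unfolding derivation_alt
proof (intro conjI ballI allI)
  fix a b assume a: "a \<in> band Fspan" and b: "b \<in> band Fspan"
  show "commL a \<in> Balg x1" using commL_band(1)[OF a] by (rule bandF_Balg)
  show "commL (op_add a b) = op_add (commL a) (commL b)" using a b by (rule commL_add)
  show "commL (op_scale c a) = op_scale c (commL a)" for c
    by (rule bop_eqI) (use a in \<open>auto simp: commL_band band_scale[OF admissible_Fspan] intro!: commL_bop bop_op_scale\<close>)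
  show "commL (op_comp a b) = op_add (op_comp (commL a) b) (op_comp a (commL b))"
  proof (rule leibniz_band[OF commL_bop commL_add _ a b])
    fix n m and f g :: "'g \<Rightarrow> complex" assume f: "f \<in> Fspan" and g: "g \<in> Fspan"
    have ft: "(\<lambda>x. f (x + pt m)) \<in> Fspan" by (rule admissible_translate[OF admissible_Fspan f])
    have fg: "(\<lambda>x. f (x + pt m) * g x) \<in> Fspan" by (rule admissible_mult[OF admissible_Fspan ft g])
    show "commL (op_comp (VM n f) (VM m g)) =
       op_add (op_comp (commL (VM n f)) (VM m g)) (op_comp (VM n f) (commL (VM m g)))"
      unfolding VM_comp[OF Fspan_CG[OF g]] commL_VM[OF fg] commL_VM[OF f] commL_VM[OF g]
        VM_comp[OF Fspan_CG[OF Fspan_scale[OF g]]] VM_add by (simp add: algebra_simps)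
  qed
qed

section \<open>Existence of the decomposition\<close>

text \<open>\<open>H\<close> is minus the mean over k < M of the partial sums of G along the orbit:
  passing from x to x + x1 changes the k-th partial sum by G (x + pt k) - G x.\<close>

lemma coboundary_average:
  assumes G: "G \<in> CG" and M: "M > 0"
  shows "\<exists>H\<in>CG. \<forall>x. H (x + x1) - H x = G x - (\<Sum>k<M. G (x + pt (int k))) / of_nat M"
proof -
  have Gc: "continuous_on UNIV G" using G by (simp add: CG_def)
  define H where "H x = - (\<Sum>k<M. \<Sum>i<k. G (x + pt (int i))) / of_nat M" for x
  have "continuous_on UNIV (\<lambda>x. G (x + pt (int i)))" for i
    by (rule continuous_on_compose2[OF Gc]) (auto intro: continuous_intros)
  then have "continuous_on UNIV H" unfolding H_def using M by (auto intro!: continuous_intros)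
  moreover have "H (x + x1) - H x = G x - (\<Sum>k<M. G (x + pt (int k))) / of_nat M" for x
  proof -
    have inner: "(\<Sum>i<k. G (x + x1 + pt (int i))) - (\<Sum>i<k. G (x + pt (int i))) = G (x + pt (int k)) - G x" for k
    proof -
      have "G (x + x1 + pt (int i)) = G (x + pt (int (Suc i)))" for i
        using gmult_Suc[of "int i" x1] by (simp add: add_ac)
      then show ?thesis
        using sum_lessThan_telescope[of "\<lambda>i. G (x + pt (int i))" k] by (simp add: sum_subtractf)
    qed
    have "H (x + x1) - H x = - ((\<Sum>k<M. \<Sum>i<k. G (x + x1 + pt (int i))) - (\<Sum>k<M. \<Sum>i<k. G (x + pt (int i)))) / of_nat M"
      unfolding H_def by (simp add: diff_divide_distrib)
    also have "\<dots> = - (\<Sum>k<M. G (x + pt (int k)) - G x) / of_nat M"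
      by (simp only: inner[symmetric] sum_subtractf)
    also have "\<dots> = G x - (\<Sum>k<M. G (x + pt (int k))) / of_nat M"
      using M by (simp add: sum_subtractf diff_divide_distrib)
    finally show ?thesis .
  qed
  ultimately show ?thesis by (intro bexI[of _ H]) (auto simp: CG_def)
qed

lemma approximate_coboundary:
  assumes G: "G \<in> CG"
  shows "\<exists>c H. \<forall>N. H N \<in> CG \<and> (\<forall>x. cmod (H N (x + x1) - H N x - (G x - c)) \<le> 1 / real (Suc N))"
proof -
  obtain c where c: "\<And>e. e > 0 \<Longrightarrow> \<exists>M>0. \<forall>x. cmod ((\<Sum>k<M. G (x + pt (int k))) / of_nat M - c) < e"
    using orbit_average[OF G] by blast
  have "\<exists>H. H \<in> CG \<and> (\<forall>x. cmod (H (x + x1) - H x - (G x - c)) \<le> 1 / real (Suc N))" for N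
  proof -
    have "1 / real (Suc N) > 0" by simp
    then obtain M where M: "M > 0" "\<forall>x. cmod ((\<Sum>k<M. G (x + pt (int k))) / of_nat M - c) < 1 / real (Suc N)"
      using c by blast
    obtain H where H: "H \<in> CG" "\<forall>x. H (x + x1) - H x = G x - (\<Sum>k<M. G (x + pt (int k))) / of_nat M"
      using coboundary_average[OF G M(1)] by blast
    have "cmod (H (x + x1) - H x - (G x - c)) \<le> 1 / real (Suc N)" for x
    proof -
      have "H (x + x1) - H x - (G x - c) = - ((\<Sum>k<M. G (x + pt (int k))) / of_nat M - c)"
        using H(2) by simp
      then show ?thesis using M(2) by (metis less_imp_le norm_minus_cancel)
    qed
    then show ?thesis using H(1) by blast
  qed
  then show ?thesis by metis
qed

lemma band_with_diagonals:
  assumes "finite S" and k: "\<And>n. k n \<in> CG"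
  shows "\<exists>T\<in>band CG. \<forall>i j. ent T i j = (if i - j \<in> S then k (i - j) (pt j) else 0)"
  using assms(1)
proof induction
  case empty
  show ?case by (intro bexI[OF _ band.VM[OF zero_CG, of 0]]) (auto simp: ent_VM)
next
  case (insert n S)
  then obtain T where T: "T \<in> band CG" "\<forall>i j. ent T i j = (if i - j \<in> S then k (i - j) (pt j) else 0)" by blast
  have "op_add (VM n (k n)) T \<in> band CG" using k T(1) by (intro band.add band.VM)
  moreover have "ent (op_add (VM n (k n)) T) i j = (if i - j \<in> insert n S then k (i - j) (pt j) else 0)" for i j
    using T(2) insert by (auto simp: ent_VM)
  ultimately show ?case by blast
qed

section \<open>The diagonals of a given derivation\<close>

context
  fixes d assumes d: "derivation x1 d"
begin

text \<open>Taking the main diagonal of \<open>\<delta>(M\<^sub>f)\<close> keeps the Leibniz rule since multiplication operators are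
  diagonal.\<close>

definition part :: "('g \<Rightarrow> complex) \<Rightarrow> 'g \<Rightarrow> complex" where
  "part f = diag (d (Mop x1 f)) 0"

lemma dM_Balg: "f \<in> Fspan \<Longrightarrow> d (Mop x1 f) \<in> Balg x1"
  using derivation_Balg[OF d] Mop_band by blast

lemma dM_bop: "f \<in> Fspan \<Longrightarrow> bop (d (Mop x1 f))"
  using dM_Balg Balg_bop by blast

lemma dV_Balg: "d Vop \<in> Balg x1"
  using derivation_Balg[OF d] Vop_band by blast

lemma part_pt: "f \<in> Fspan \<Longrightarrow> part f (pt l) = ent (d (Mop x1 f)) l l"
  unfolding part_def using diag_pt[OF dM_Balg, of f 0 l] by simp

lemma phi_inv_part: "phi_inv_derivation x1 part"
  unfolding phi_inv_derivation_def
proof (intro conjI ballI allI)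
  fix f g :: "'g \<Rightarrow> complex" assume f: "f \<in> Fspan" and g: "g \<in> Fspan"
  note bf = Mop_band[OF f] and bg = Mop_band[OF g]
  show fC: "part f \<in> CG" unfolding part_def by (rule diag_CG[OF dM_Balg[OF f]])
  have gC: "part g \<in> CG" unfolding part_def by (rule diag_CG[OF dM_Balg[OF g]])
  show "part (\<lambda>x. f x + g x) = (\<lambda>x. part f x + part g x)"
    unfolding part_def diag_add[OF dM_Balg[OF f] dM_Balg[OF g], symmetric] derivation_add[OF d bf bg, symmetric]
    by (simp add: Mop_VM VM_add)
  show "part (\<lambda>x. c * f x) = (\<lambda>x. c * part f x)" for c
    unfolding part_def diag_scale[OF dM_Balg[OF f], symmetric] derivation_scale[OF d bf, symmetric]
    by (simp add: Mop_VM VM_scale)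
  show "part (\<lambda>x. f x * g x) = (\<lambda>x. part f x * g x + f x * part g x)"
    unfolding part_def[of "\<lambda>x. f x * g x"]
  proof (rule diag_eqI)
    show "(\<lambda>x. part f x * g x + f x * part g x) \<in> CG"
      using fC gC Fspan_CG[OF f] Fspan_CG[OF g] unfolding CG_def by (auto intro: continuous_intros)
    have "Mop x1 (\<lambda>x. f x * g x) = op_comp (Mop x1 f) (Mop x1 g)"
      by (simp add: Mop_VM VM_comp Fspan_CG g)
    then show "ent (d (Mop x1 (\<lambda>x. f x * g x))) (l + 0) l = part f (pt l) * g (pt l) + f (pt l) * part g (pt l)" for l
      by (simp add: derivation_comp[OF d bf bg] ent_generator_comp dM_bop f g part_pt)
  qed
  have ft: "(\<lambda>x. f (x + x1)) \<in> Fspan" by (rule admissible_translate[OF admissible_Fspan f])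
  show "(\<lambda>x. part f (x + x1)) = part (\<lambda>x. f (x + x1))"
  proof (rule dense_eqI)
    show "continuous_on UNIV (\<lambda>x. part f (x + x1))" using CG_translate[OF fC] by (simp add: CG_def)
    show "continuous_on UNIV (part (\<lambda>x. f (x + x1)))"
      unfolding part_def using diag_CG[OF dM_Balg[OF ft]] by (simp add: CG_def)
    fix l
    \<comment> \<open>Invariance is the covariance relation, differentiated and read at the entries
      (l + 1, l): the two terms with d(V) carry the same factor f(x_(l+1)) and cancel.\<close>
    have "op_comp (Mop x1 f) Vop = op_comp Vop (Mop x1 (\<lambda>x. f (x + x1)))"
      by (simp add: Mop_VM Vop_VM VM_comp one_CG Fspan_CG ft)
    then have "op_add (op_comp (d (Mop x1 f)) Vop) (op_comp (Mop x1 f) (d Vop)) =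
       op_add (op_comp (d Vop) (Mop x1 (\<lambda>x. f (x + x1)))) (op_comp Vop (d (Mop x1 (\<lambda>x. f (x + x1)))))"
      using derivation_comp[OF d bf Vop_band] derivation_comp[OF d Vop_band Mop_band[OF ft]] by simp
    then have "ent (op_comp (d (Mop x1 f)) Vop) (l + 1) l + ent (op_comp (Mop x1 f) (d Vop)) (l + 1) l =
       ent (op_comp (d Vop) (Mop x1 (\<lambda>x. f (x + x1)))) (l + 1) l + ent (op_comp Vop (d (Mop x1 (\<lambda>x. f (x + x1))))) (l + 1) l"
      by (metis ent_simps(1))
    then have "ent (d (Mop x1 f)) (l + 1) (l + 1) = ent (d (Mop x1 (\<lambda>x. f (x + x1)))) l l"
      by (simp add: ent_generator_comp dM_bop f ft Balg_bop[OF dV_Balg] gmult_Suc)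
    then show "part f (pt l + x1) = part (\<lambda>x. f (x + x1)) (pt l)"
      using part_pt[OF f, of "l + 1"] part_pt[OF ft, of l] by (simp add: gmult_Suc)
  qed
qed

text \<open>On the \<open>n\<close>-th diagonal, \<open>n \<noteq> 0\<close>, the derivation is the commutator with \<open>V\<^sup>n M\<^sub>h\<close>, where \<open>h\<close> is
  found from any character \<open>\<psi>\<close> with \<open>\<psi>(x\<^sub>n) \<noteq> 1\<close>.\<close>

lemma off_diagonal:
  obtains h where "\<And>n. h n \<in> CG"
    "\<And>f i j. f \<in> Fspan \<Longrightarrow> i \<noteq> j \<Longrightarrow> ent (d (Mop x1 f)) i j = h (i - j) (pt j) * (f (pt j) - f (pt i))"
    "\<And>i j. i \<noteq> j + 1 \<Longrightarrow> ent (d Vop) i j = h (i - j - 1) (pt (j + 1)) - h (i - j - 1) (pt j)"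
proof -
  have "\<exists>ch. character ch \<and> (n \<noteq> 0 \<longrightarrow> ch (pt n) \<noteq> 1)" for n
    using characters_separate[of n] character_one by metis
  then obtain psi where psi: "\<And>n. character (psi n)" "\<And>n. n \<noteq> 0 \<Longrightarrow> psi n (pt n) \<noteq> 1" by metis
  have pF: "psi n \<in> Fspan" for n using Fspan_character[OF psi(1), of 1] by simp
  \<comment> \<open>Obtained by solving d(M_psi)_(j+n, j) = h(x_j) * (psi(x_j) - psi(x_(j+n))),
    where psi(x_(j+n)) = psi(x_j) * psi(x_n). For n = 0 the factor 1 - psi(x_n) is 0, and since
    \<open>inverse 0 = 0\<close>, \<open>h 0\<close> is the zero function.\<close>
  define h where "h n x = inverse (1 - psi n (pt n)) * (diag (d (Mop x1 (psi n))) n x * inverse (psi n x))" for n x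
  have hC: "h n \<in> CG" for n
  proof -
    have "continuous_on UNIV (diag (d (Mop x1 (psi n))) n)" using diag_CG[OF dM_Balg[OF pF]] by (simp add: CG_def)
    moreover have "continuous_on UNIV (\<lambda>x. inverse (psi n x))"
      using character_nonzero[OF psi(1)] by (intro continuous_on_inverse character_continuous psi(1)) auto
    ultimately show ?thesis unfolding h_def CG_def by (auto intro!: continuous_intros)
  qed
  have pm: "psi n (pt (a + b)) = psi n (pt a) * psi n (pt b)" for n a b
    by (simp add: gmult_add character_add[OF psi(1)])
  have pne: "psi (i - j) (pt j) - psi (i - j) (pt i) \<noteq> 0" if "i \<noteq> j" for i j
  proof -
    have "psi (i - j) (pt i) = psi (i - j) (pt j) * psi (i - j) (pt (i - j))" using pm[of "i - j" j "i - j"] by simp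
    then show ?thesis using psi(2)[of "i - j"] that character_nonzero[OF psi(1)] by simp
  qed
  have key: "ent (d (Mop x1 (psi (i - j)))) i j = h (i - j) (pt j) * (psi (i - j) (pt j) - psi (i - j) (pt i))" if "i \<noteq> j" for i j
  proof -
    define n where "n = i - j"
    have i: "i = j + n" by (simp add: n_def)
    have "1 - psi n (pt n) \<noteq> 0" using psi(2)[of n] that by (simp add: n_def)
    moreover have "psi n (pt j) \<noteq> 0" by (rule character_nonzero[OF psi(1)])
    ultimately have "h n (pt j) * (psi n (pt j) * (1 - psi n (pt n))) = diag (d (Mop x1 (psi n))) n (pt j)"
      by (simp add: h_def field_simps)
    then show ?thesis unfolding n_def[symmetric] i
      by (simp add: diag_pt[OF dM_Balg[OF pF]] pm right_diff_distrib)
  qed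
  have F1: "ent (d (Mop x1 f)) i j = h (i - j) (pt j) * (f (pt j) - f (pt i))" if f: "f \<in> Fspan" and ij: "i \<noteq> j" for f i j
  proof -
    define p where "p = psi (i - j)"
    have p: "p \<in> Fspan" unfolding p_def by (rule pF)
    \<comment> \<open>Differentiating the commutation of M_f and M_p ties the entry (i, j) of d(M_f)
      to that of d(M_p), so the \<open>h\<close> found from one character serves every f.\<close>
    have "op_comp (Mop x1 f) (Mop x1 p) = op_comp (Mop x1 p) (Mop x1 f)"
      by (simp add: Mop_VM VM_comp Fspan_CG f p mult.commute)
    then have "op_add (op_comp (d (Mop x1 f)) (Mop x1 p)) (op_comp (Mop x1 f) (d (Mop x1 p))) =
       op_add (op_comp (d (Mop x1 p)) (Mop x1 f)) (op_comp (Mop x1 p) (d (Mop x1 f)))"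
      using derivation_comp[OF d Mop_band[OF f] Mop_band[OF p]] derivation_comp[OF d Mop_band[OF p] Mop_band[OF f]] by simp
    then have "ent (op_comp (d (Mop x1 f)) (Mop x1 p)) i j + ent (op_comp (Mop x1 f) (d (Mop x1 p))) i j =
       ent (op_comp (d (Mop x1 p)) (Mop x1 f)) i j + ent (op_comp (Mop x1 p) (d (Mop x1 f))) i j"
      by (metis ent_simps(1))
    then have "(p (pt j) - p (pt i)) * ent (d (Mop x1 f)) i j = (f (pt j) - f (pt i)) * ent (d (Mop x1 p)) i j"
      by (simp add: ent_generator_comp dM_bop f p algebra_simps)
    also have "\<dots> = (p (pt j) - p (pt i)) * (h (i - j) (pt j) * (f (pt j) - f (pt i)))"
      unfolding p_def key[OF ij] by (simp add: mult_ac)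
    finally show ?thesis using pne[OF ij] by (simp add: p_def)
  qed
  have F2: "ent (d Vop) i j = h (i - j - 1) (pt (j + 1)) - h (i - j - 1) (pt j)" if ij: "i \<noteq> j + 1" for i j
  proof -
    \<comment> \<open>V itself contributes one diagonal, so the entry (i, j) of d(V) belongs to the
      index i - j - 1.\<close>
    define n where "n = i - j - 1"
    define p where "p = psi n"
    have p: "p \<in> Fspan" unfolding p_def by (rule pF)
    \<comment> \<open>Differentiating M_p V = p(x1) V M_p gives a linear equation for the entry of
      d(V); its coefficient p(x_(j+1)) - p(x_i) is nonzero off the diagonal of V.\<close>
    have "op_comp (Mop x1 p) Vop = op_scale (p x1) (op_comp Vop (Mop x1 p))"
      by (simp add: Mop_VM Vop_VM VM_comp VM_scale one_CG Fspan_CG pF p_def character_add[OF psi(1)] mult.commute)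
    then have "op_add (op_comp (d (Mop x1 p)) Vop) (op_comp (Mop x1 p) (d Vop)) =
       op_scale (p x1) (op_add (op_comp (d Vop) (Mop x1 p)) (op_comp Vop (d (Mop x1 p))))"
      using derivation_comp[OF d Mop_band[OF p] Vop_band] derivation_comp[OF d Vop_band Mop_band[OF p]]
        derivation_scale[OF d band_comp[OF admissible_Fspan Vop_band Mop_band[OF p]], of "p x1"] by simp
    then have "ent (op_comp (d (Mop x1 p)) Vop) i j + ent (op_comp (Mop x1 p) (d Vop)) i j =
       p x1 * (ent (op_comp (d Vop) (Mop x1 p)) i j + ent (op_comp Vop (d (Mop x1 p))) i j)"
      by (metis ent_simps(1,3))
    then have eq: "ent (d (Mop x1 p)) i (j + 1) + p (pt i) * ent (d Vop) i j =
       p x1 * (p (pt j) * ent (d Vop) i j + ent (d (Mop x1 p)) (i - 1) j)"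
      by (simp add: ent_generator_comp dM_bop p Balg_bop[OF dV_Balg])
    have k1: "ent (d (Mop x1 p)) i (j + 1) = h n (pt (j + 1)) * (p (pt (j + 1)) - p (pt i))"
      using key[of i "j + 1"] ij by (simp add: p_def n_def diff_diff_eq)
    have k2: "ent (d (Mop x1 p)) (i - 1) j = h n (pt j) * (p (pt j) - p (pt (i - 1)))"
      using key[of "i - 1" j] ij by (simp add: p_def n_def algebra_simps)
    have p1: "p x1 * p (pt j) = p (pt (j + 1))" "p x1 * p (pt (i - 1)) = p (pt i)"
      using pm[of n j 1] pm[of n "i - 1" 1] by (simp_all add: p_def mult.commute)
    have "p x1 * ent (d (Mop x1 p)) (i - 1) j = h n (pt j) * (p (pt (j + 1)) - p (pt i))"
      unfolding k2 p1[symmetric] by (simp add: algebra_simps)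
    then have "h n (pt (j + 1)) * (p (pt (j + 1)) - p (pt i)) + p (pt i) * ent (d Vop) i j =
       p (pt (j + 1)) * ent (d Vop) i j + h n (pt j) * (p (pt (j + 1)) - p (pt i))"
      using eq unfolding k1 distrib_left by (simp add: mult.assoc[symmetric] p1)
    then have "(p (pt (j + 1)) - p (pt i)) * ent (d Vop) i j = (p (pt (j + 1)) - p (pt i)) * (h n (pt (j + 1)) - h n (pt j))"
      by (simp add: algebra_simps)
    moreover have "p (pt (j + 1)) - p (pt i) \<noteq> 0"
      using pne[of i "j + 1"] ij by (simp add: p_def n_def diff_diff_eq)
    ultimately show ?thesis unfolding n_def by simp
  qed
  show ?thesis by (rule that[OF hC F1 F2])
qed

end

section \<open>Approximate innerness from convergence on generators\<close>

lemma commutator_add: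
  assumes "bop y" "bop a" "bop b"
  shows "commutator y (op_add a b) = op_add (commutator y a) (commutator y b)"
  unfolding commutator_def op_comp_add_left op_comp_add_right[OF assms]
  by (simp add: op_sub_def op_add_def algebra_simps)

text \<open>For p = d a and q = d b this is a Leibniz rule for the defect [y, b] - d b, so defects
  that are small at a and at b are small at the product.\<close>

lemma commutator_defect_comp:
  assumes b: "bop y" "bop a" "bop b" "bop p" "bop q"
  shows "op_sub (commutator y (op_comp a b)) (op_add (op_comp p b) (op_comp a q)) =
    op_add (op_comp (op_sub (commutator y a) p) b) (op_comp a (op_sub (commutator y b) q))"
proof
  fix x
  have l: "l2 (y (b x))" "l2 (b (y x))" "l2 (q x)" using b by (auto intro: bop_l2')
  have "a (\<lambda>i. y (b x) i - b (y x) i - q x i) = (\<lambda>i. a (y (b x)) i - a (b (y x)) i - a (q x) i)"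
    using bop_sub_vec[OF b(2) l2_diff(1)[OF l(1,2)] l(3)] bop_sub_vec[OF b(2) l(1,2)] by simp
  then show "op_sub (commutator y (op_comp a b)) (op_add (op_comp p b) (op_comp a q)) x =
    op_add (op_comp (op_sub (commutator y a) p) b) (op_comp a (op_sub (commutator y b) q)) x"
    by (simp add: op_sub_def op_add_def op_comp_def commutator_def algebra_simps)
qed

text \<open>The elements on which the commutators converge to \<open>d\<close> are closed under sums
  and products and include the inverse shift. The image of \<open>sequentially\<close> under
  \<open>y\<close> is the filter required.\<close>

lemma approx_inner_from_generators:
  assumes d: "derivation x1 d" and y: "\<And>N. y N \<in> Balg x1"
    and V: "(\<lambda>N. opnorm (op_sub (commutator (y N) Vop) (d Vop))) \<longlonglongrightarrow> 0"
    and M: "\<And>f. f \<in> Fspan \<Longrightarrow> (\<lambda>N. opnorm (op_sub (commutator (y N) (Mop x1 f)) (d (Mop x1 f)))) \<longlonglongrightarrow> 0"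
  shows "approx_inner x1 d"
proof -
  have yb: "bop (y N)" for N using y Balg_bop by blast
  define P where "P b \<longleftrightarrow> (\<lambda>N. opnorm (op_sub (commutator (y N) b) (d b))) \<longlonglongrightarrow> 0" for b
  have bd: "bop (op_sub (commutator (y N) b) (d b))" if "b \<in> band Fspan" for N b
    by (intro bop_op_sub bop_commutator yb bandF_bop derivation_bop[OF d] that)
  have sq: "f \<longlonglongrightarrow> 0" if "\<And>N. 0 \<le> f N" "\<And>N. f N \<le> g N" "g \<longlonglongrightarrow> 0" for f g :: "nat \<Rightarrow> real"
    by (rule tendsto_sandwich[OF _ _ tendsto_const that(3)]) (use that in auto)
  have "P b" if "b \<in> band Fspan" for b
    using that
  proof (rule band_generate[rotated -1])
    show "P Vop" using V by (simp add: P_def)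
    show "P (Mop x1 f)" if "f \<in> Fspan" for f using M[OF that] by (simp add: P_def)
    show "P Vinv" unfolding P_def
    proof (rule sq[OF opnorm_nonneg[OF bd[OF Vinv_band]]])
      fix N
      define R where "R = op_sub (commutator (y N) Vop) (d Vop)"
      have bV: "bop Vinv" using bandF_bop Vinv_band by auto
      have bR: "bop R" unfolding R_def by (rule bd[OF Vop_band])
      have bRV: "bop (op_comp R Vinv)" by (rule bop_op_comp(1)[OF bR bV])
      have eR: "ent R i j = ent (y N) i (j + 1) - ent (y N) (i - 1) j - ent (d Vop) i j" for i j
        by (simp add: R_def commutator_def ent_generator_comp yb)
      \<comment> \<open>With R the defect at V, the defect at the inverse is - V^(-1) R V^(-1), as
        for the derivative of an inverse.\<close>
      have "op_sub (commutator (y N) Vinv) (d Vinv) = op_scale (-1) (op_comp Vinv (op_comp R Vinv))"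
        by (rule bop_eqI[OF bd[OF Vinv_band] bop_op_scale(1)[OF bop_op_comp(1)[OF bV bRV]]])
           (simp add: commutator_def ent_generator_comp bRV bR yb derivation_Vinv[OF d] eR)
      then have "opnorm (op_sub (commutator (y N) Vinv) (d Vinv)) \<le> cmod (-1) * opnorm (op_comp Vinv (op_comp R Vinv))"
        using bop_op_scale(2)[OF bop_op_comp(1)[OF bV bRV], of "-1"] by simp
      also have "\<dots> \<le> opnorm Vinv * (opnorm R * opnorm Vinv)"
        using bop_op_comp(2)[OF bV bRV]
          mult_left_mono[OF bop_op_comp(2)[OF bR bV] opnorm_nonneg[OF bV]] by simp
      finally show "opnorm (op_sub (commutator (y N) Vinv) (d Vinv)) \<le>
        opnorm Vinv * (opnorm (op_sub (commutator (y N) Vop) (d Vop)) * opnorm Vinv)" unfolding R_def .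
    next
      show "(\<lambda>N. opnorm Vinv * (opnorm (op_sub (commutator (y N) Vop) (d Vop)) * opnorm Vinv)) \<longlonglongrightarrow> 0"
        by (intro tendsto_mult_right_zero tendsto_mult_left_zero V)
    qed
  next
    fix a b assume a: "a \<in> band Fspan" and b: "b \<in> band Fspan" and Pa: "P a" and Pb: "P b"
    let ?A = "\<lambda>N. op_sub (commutator (y N) a) (d a)" and ?B = "\<lambda>N. op_sub (commutator (y N) b) (d b)"
    have ba: "bop a" and bb: "bop b" using a b bandF_bop by auto
    show "P (op_add a b)" unfolding P_def
    proof (rule sq[OF opnorm_nonneg[OF bd[OF band.add[OF a b]]]])
      show "opnorm (op_sub (commutator (y N) (op_add a b)) (d (op_add a b))) \<le> opnorm (?A N) + opnorm (?B N)" for N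
      proof -
        have "op_sub (commutator (y N) (op_add a b)) (d (op_add a b)) = op_add (?A N) (?B N)"
          unfolding commutator_add[OF yb ba bb] derivation_add[OF d a b]
          by (simp add: op_sub_def op_add_def algebra_simps)
        then show ?thesis using bop_op_add(2)[OF bd[OF a] bd[OF b]] by simp
      qed
      show "(\<lambda>N. opnorm (?A N) + opnorm (?B N)) \<longlonglongrightarrow> 0"
        using Pa Pb unfolding P_def by (rule tendsto_add_zero)
    qed
    show "P (op_comp a b)" unfolding P_def
    proof (rule sq[OF opnorm_nonneg[OF bd[OF band_comp[OF admissible_Fspan a b]]]])
      show "opnorm (op_sub (commutator (y N) (op_comp a b)) (d (op_comp a b))) \<le> opnorm (?A N) * opnorm b + opnorm a * opnorm (?B N)" for N
      proof -
        have "op_sub (commutator (y N) (op_comp a b)) (d (op_comp a b)) = op_add (op_comp (?A N) b) (op_comp a (?B N))"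
          unfolding derivation_comp[OF d a b]
          by (rule commutator_defect_comp[OF yb ba bb derivation_bop[OF d a] derivation_bop[OF d b]])
        then show ?thesis
          using order_trans[OF bop_op_add(2)[OF bop_op_comp(1)[OF bd[OF a] bb] bop_op_comp(1)[OF ba bd[OF b]]]
            add_mono[OF bop_op_comp(2)[OF bd[OF a] bb] bop_op_comp(2)[OF ba bd[OF b]]]] by simp
      qed
      show "(\<lambda>N. opnorm (?A N) * opnorm b + opnorm a * opnorm (?B N)) \<longlonglongrightarrow> 0"
        using Pa Pb unfolding P_def by (intro tendsto_add_zero tendsto_mult_left_zero tendsto_mult_right_zero)
    qed
  qed
  then have "\<forall>\<^sub>F N in sequentially. opnorm (op_sub (commutator (y N) b) (d b)) < e" if "b \<in> Bcal x1" "e > 0" for b e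
    using that order_tendstoD(2)[of _ 0] unfolding P_def Bcal_eq by blast
  then show ?thesis
    unfolding approx_inner_def
    by (intro exI[of _ "filtermap y sequentially"]) (auto simp: eventually_filtermap filtermap_bot_iff y)
qed

section \<open>The implementing sequence and the remainder\<close>

lemma tendsto_zeroI:
  assumes "\<And>N. 0 \<le> f N" "\<And>e. e > 0 \<Longrightarrow> \<forall>\<^sub>F N in sequentially. f N < e"
  shows "f \<longlonglongrightarrow> (0 :: real)"
  using assms by (intro tendstoI) (auto simp: dist_real_def)

lemma decomposition_exists:
  assumes d: "derivation x1 d"
  shows "\<exists>c0 D dD dt. decomposition x1 d c0 D dD dt"
proof -
  define D where "D = part d"
  have D: "phi_inv_derivation x1 D" unfolding D_def by (rule phi_inv_part[OF d])
  define dD where "dD = derD D"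
  have dD: "derivation x1 dD" "dD Vop = (\<lambda>_ _. 0)" "\<And>f. f \<in> Fspan \<Longrightarrow> dD (Mop x1 f) = Mop x1 (D f)"
    unfolding dD_def using derivation_derD[OF D] derD_Vop[OF D] derD_Mop[OF D] by auto
  define G where "G = diag (d Vop) 1"
  have dV: "d Vop \<in> Balg x1" by (rule dV_Balg[OF d])
  have G: "G \<in> CG" unfolding G_def by (rule diag_CG[OF dV])
  obtain c0 H where "\<forall>N. H N \<in> CG \<and> (\<forall>x. cmod (H N (x + x1) - H N x - (G x - c0)) \<le> 1 / real (Suc N))"
    using approximate_coboundary[OF G] by (elim exE)
  then have H: "\<And>N. H N \<in> CG" "\<And>N x. cmod (H N (x + x1) - H N x - (G x - c0)) \<le> 1 / real (Suc N)"
    by blast+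
  obtain h where h: "\<And>n. h n \<in> CG"
    "\<And>f i j. f \<in> Fspan \<Longrightarrow> i \<noteq> j \<Longrightarrow> ent (d (Mop x1 f)) i j = h (i - j) (pt j) * (f (pt j) - f (pt i))"
    "\<And>i j. i \<noteq> j + 1 \<Longrightarrow> ent (d Vop) i j = h (i - j - 1) (pt (j + 1)) - h (i - j - 1) (pt j)"
    by (rule off_diagonal[OF d]) blast
  define dt where "dt b = op_sub (op_sub (d b) (op_scale c0 (commL b))) (dD b)" for b
  have dt: "derivation x1 dt"
    unfolding dt_def by (rule derivation_combine[OF d derivation_commL dD(1)])
  have "\<exists>T\<in>band CG. \<forall>i j. ent T i j = (if i = j then H N (pt j) else of_real (fejer N (i - j)) * h (i - j) (pt j))" for N
  proof -
    define k where "k n = (if n = 0 then H N else (\<lambda>x. of_real (fejer N n) * h n x))" for n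
    have "k n \<in> CG" for n using H(1)[of N] h(1)[of n] by (auto simp: k_def CG_def intro: continuous_intros)
    \<comment> \<open>Diagonals beyond N carry weight 0, so a finite set of them realises the
      operator.\<close>
    then obtain T where T: "T \<in> band CG" "\<forall>i j. ent T i j = (if i - j \<in> {- int N..int N} then k (i - j) (pt j) else 0)"
      using band_with_diagonals[of "{- int N..int N}" k] by blast
    have "ent T i j = (if i = j then H N (pt j) else of_real (fejer N (i - j)) * h (i - j) (pt j))" for i j
    proof (cases "\<bar>i - j\<bar> > int N")
      case True
      then show ?thesis using T(2) by (auto simp: fejer_eq_0[OF True])
    next
      case False
      then show ?thesis using T(2) by (auto simp: k_def)
    qed
    then show ?thesis using T(1) by blast
  qed
  then obtain y where y: "\<And>N. y N \<in> band CG"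
    "\<And>N i j. ent (y N) i j = (if i = j then H N (pt j) else of_real (fejer N (i - j)) * h (i - j) (pt j))"
    by metis
  have yB: "y N \<in> Balg x1" and yb: "bop (y N)" for N
    using band_Balg[OF y(1)] Balg_bop by blast+
  have ai: "approx_inner x1 dt"
  proof (rule approx_inner_from_generators[OF dt yB])
    fix f :: "'g \<Rightarrow> complex" assume f: "f \<in> Fspan"
    have Mb: "Mop x1 f \<in> band Fspan" by (rule Mop_band[OF f])
    have bM: "bop (Mop x1 f)" by (rule bandF_bop[OF Mb])
    have dtM: "dt (Mop x1 f) \<in> Balg x1" by (rule derivation_Balg[OF dt Mb])
    \<comment> \<open>The main diagonal vanishes because \<open>D\<close> is the main diagonal of
      \<open>d\<close> on multiplication operators and \<open>commL\<close> is zero there.\<close>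
    have edt: "ent (dt (Mop x1 f)) i j = (if i = j then 0 else h (i - j) (pt j) * (f (pt j) - f (pt i)))" for i j
      using h(2)[OF f, of i j] part_pt[OF d f, of j]
      by (simp add: dt_def commL_band[OF Mb] dD(3)[OF f]) (simp add: Mop_VM ent_VM D_def)
    show "(\<lambda>N. opnorm (op_sub (commutator (y N) (Mop x1 f)) (dt (Mop x1 f)))) \<longlonglongrightarrow> 0"
    proof (rule tendsto_zeroI)
      show "0 \<le> opnorm (op_sub (commutator (y N) (Mop x1 f)) (dt (Mop x1 f)))" for N
        by (intro opnorm_nonneg bop_op_sub bop_commutator yb bM Balg_bop dtM)
      fix e :: real assume e: "e > 0"
      show "\<forall>\<^sub>F N in sequentially. opnorm (op_sub (commutator (y N) (Mop x1 f)) (dt (Mop x1 f))) < e"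
        using fejer_converges[OF dtM e]
      proof eventually_elim
        case (elim N)
        \<comment> \<open>The factor f(x_j) - f(x_i) kills \<open>H N\<close>, so this commutator is
          exactly the Fejer mean of \<open>dt (Mop x1 f)\<close>.\<close>
        have "ent (commutator (y N) (Mop x1 f)) i j = of_real (fejer N (i - j)) * ent (dt (Mop x1 f)) i j" for i j
          unfolding edt by (simp add: commutator_def ent_generator_comp yb y(2) algebra_simps)
        then show ?case using elim bop_commutator[OF yb bM] by blast
      qed
    qed
  next
    \<comment> \<open>Multiplication by \<open>Vinv\<close> moves the diagonal n + 1 of a value at V
      to the diagonal n, the index that the Fejer weights in \<open>y N\<close> carry.\<close>
    define T where "T = op_comp (dt Vop) Vinv"
    have dtV: "dt Vop \<in> Balg x1" by (rule derivation_Balg[OF dt Vop_band])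
    have VinvC: "Vinv \<in> band CG" unfolding Vinv_VM by (rule band.VM[OF one_CG])
    have T: "T \<in> Balg x1" unfolding T_def by (rule Balg_comp_band[OF dtV VinvC])
    have bV: "bop Vop" "bop Vinv" using bandF_bop Vop_band Vinv_band by auto
    have edt: "ent (dt Vop) i j = (if i = j + 1 then G (pt j) - c0 else h (i - j - 1) (pt (j + 1)) - h (i - j - 1) (pt j))" for i j
    proof -
      have "ent (commL Vop) i j = (if i = j + 1 then 1 else 0)"
        unfolding commL_band(2)[OF Vop_band] by (simp add: Vop_VM ent_VM)
      moreover have "ent (dD Vop) i j = 0" by (simp add: dD(2) ent_def)
      ultimately have "ent (dt Vop) i j = ent (d Vop) i j - (if i = j + 1 then c0 else 0)"
        by (simp add: dt_def)
      then show ?thesis using h(3)[of i j] diag_pt[OF dV, of 1 j] by (auto simp: G_def)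
    qed
    \<comment> \<open>The error of \<open>H N\<close> as a primitive, translated by x1. It is the
      main diagonal of \<open>Q N\<close> minus \<open>T\<close>; once it is subtracted,
      \<open>Q N\<close> becomes exactly the Fejer mean of \<open>T\<close>.\<close>
    define E where "E N x = H N x - H N (x - x1) - (G (x - x1) - c0)" for N x
    have E: "cmod (E N x) \<le> 1 / real (Suc N)" for N x
      using H(2)[of N "x - x1"] by (simp add: E_def)
    note bE = VM_bounded[OF E, of 0]
    define Q where "Q N = op_comp (commutator (y N) Vop) Vinv" for N
    have bC: "bop (commutator (y N) Vop)" for N by (rule bop_commutator[OF yb bV(1)])
    have bQ: "bop (Q N)" for N unfolding Q_def by (rule bop_op_comp(1)[OF bC bV(2)])
    have bT: "bop T" by (rule Balg_bop[OF T])
    \<comment> \<open>Multiplication by V undoes the passage to \<open>Vinv\<close> without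
      increasing norms.\<close>
    have le: "opnorm (op_sub (commutator (y N) Vop) (dt Vop)) \<le>
        opnorm (op_sub (op_sub (Q N) (VM 0 (E N))) T) + 1 / real (Suc N)" for N
    proof -
      let ?S = "op_sub (Q N) (VM 0 (E N))"
      have bS: "bop ?S" by (rule bop_op_sub(1)[OF bQ bE(1)])
      have eq: "op_sub (commutator (y N) Vop) (dt Vop) = op_comp (op_sub (Q N) T) Vop"
        by (rule bop_eqI[OF bop_op_sub(1)[OF bC Balg_bop[OF dtV]] bop_op_comp(1)[OF bop_op_sub(1)[OF bQ bT] bV(1)]])
           (simp add: ent_generator_comp bop_op_sub bQ bT, simp add: Q_def T_def ent_generator_comp bC Balg_bop[OF dtV])
      have V1: "opnorm Vop \<le> 1" unfolding Vop_VM by (rule VM_bounded) simp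
      have bQT: "bop (op_sub (Q N) T)" by (rule bop_op_sub(1)[OF bQ bT])
      have "opnorm (op_sub (commutator (y N) Vop) (dt Vop)) \<le> opnorm (op_sub (Q N) T) * opnorm Vop"
        unfolding eq by (rule bop_op_comp(2)[OF bQT bV(1)])
      also have "\<dots> \<le> opnorm (op_sub (Q N) T)"
        using mult_left_mono[OF V1 opnorm_nonneg[OF bQT]] by simp
      also have "op_sub (Q N) T = op_add (op_sub ?S T) (VM 0 (E N))"
        by (simp add: op_sub_def op_add_def)
      also have "opnorm \<dots> \<le> opnorm (op_sub ?S T) + opnorm (VM 0 (E N))"
        by (rule bop_op_add(2)[OF bop_op_sub(1)[OF bS bT] bE(1)])
      also have "\<dots> \<le> opnorm (op_sub ?S T) + 1 / real (Suc N)" using bE(2) by simp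
      finally show ?thesis .
    qed
    have lim: "(\<lambda>N. opnorm (op_sub (op_sub (Q N) (VM 0 (E N))) T)) \<longlonglongrightarrow> 0"
    proof (rule tendsto_zeroI)
      show "0 \<le> opnorm (op_sub (op_sub (Q N) (VM 0 (E N))) T)" for N
        by (intro opnorm_nonneg bop_op_sub bQ bE bT)
      fix e :: real assume e: "e > 0"
      show "\<forall>\<^sub>F N in sequentially. opnorm (op_sub (op_sub (Q N) (VM 0 (E N))) T) < e"
        using fejer_converges[OF T e]
      proof eventually_elim
        case (elim N)
        have eT: "ent T i j = (if i = j then G (pt (j - 1)) - c0 else h (i - j) (pt j) - h (i - j) (pt (j - 1)))" for i j
          by (simp add: T_def ent_generator_comp Balg_bop[OF dtV] edt algebra_simps)
        have eQ: "ent (Q N) i j = ent (y N) i j - ent (y N) (i - 1) (j - 1)" for i j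
          by (simp add: Q_def ent_generator_comp bC) (simp add: commutator_def ent_generator_comp yb)
        have "ent (op_sub (Q N) (VM 0 (E N))) i j = of_real (fejer N (i - j)) * ent T i j" for i j
          unfolding eT by (simp add: eQ y(2) ent_VM E_def gmult_diff right_diff_distrib)
        moreover have "bop (op_sub (Q N) (VM 0 (E N)))" by (rule bop_op_sub(1)[OF bQ bE(1)])
        ultimately show ?case using elim by blast
      qed
    qed
    have up: "(\<lambda>N. opnorm (op_sub (op_sub (Q N) (VM 0 (E N))) T) + 1 / real (Suc N)) \<longlonglongrightarrow> 0"
      using tendsto_add[OF lim LIMSEQ_inverse_real_of_nat] by (simp add: inverse_eq_divide)
    show "(\<lambda>N. opnorm (op_sub (commutator (y N) Vop) (dt Vop))) \<longlonglongrightarrow> 0"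
    proof (rule tendsto_sandwich[OF _ _ tendsto_const up])
      show "\<forall>\<^sub>F N in sequentially. 0 \<le> opnorm (op_sub (commutator (y N) Vop) (dt Vop))"
        by (intro always_eventually allI opnorm_nonneg bop_op_sub bC Balg_bop[OF dtV])
    qed (intro always_eventually allI le)
  qed
  have "d b = op_add (op_add (op_scale c0 (commL b)) (dD b)) (dt b)" for b
    by (simp add: dt_def op_add_def op_sub_def)
  then have "decomposition x1 d c0 D dD dt"
    unfolding decomposition_def using D dD dt ai by blast
  then show ?thesis by blast
qed

section \<open>Uniqueness of the decomposition\<close>

lemma approx_innerD:
  assumes "approx_inner x1 dt" "b \<in> band Fspan" "e > 0"
  obtains y where "y \<in> Balg x1" "opnorm (op_sub (commutator y b) (dt b)) < e"
proof -
  obtain F :: "op filter" where F: "F \<noteq> bot" "eventually (\<lambda>y. y \<in> Balg x1) F"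
    "eventually (\<lambda>y. opnorm (op_sub (commutator y b) (dt b)) < e) F"
    using assms unfolding approx_inner_def Bcal_eq by blast
  from eventually_happens'[OF F(1) eventually_conj[OF F(2,3)]] show ?thesis using that by blast
qed

lemma approx_inner_Mop_diagonal:
  assumes ai: "approx_inner x1 dt" and dt: "derivation x1 dt" and f: "f \<in> Fspan"
  shows "ent (dt (Mop x1 f)) l l = 0"
proof -
  note Mb = Mop_band[OF f]
  have "cmod (ent (dt (Mop x1 f)) l l) \<le> e" if e: "e > 0" for e
  proof -
    obtain y where y: "y \<in> Balg x1" "opnorm (op_sub (commutator y (Mop x1 f)) (dt (Mop x1 f))) < e"
      using approx_innerD[OF ai Mb e] .
    have yb: "bop y" by (rule Balg_bop[OF y(1)])
    have b: "bop (op_sub (commutator y (Mop x1 f)) (dt (Mop x1 f)))"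
      by (intro bop_op_sub bop_commutator yb bandF_bop Mb derivation_bop[OF dt])
    have "ent (op_sub (commutator y (Mop x1 f)) (dt (Mop x1 f))) l l = - ent (dt (Mop x1 f)) l l"
      by (simp add: commutator_def ent_generator_comp yb)
    then show ?thesis using cmod_ent_le[OF b, of l l] y(2) by simp
  qed
  then have "cmod (ent (dt (Mop x1 f)) l l) \<le> 0" by (rule field_le_epsilon) simp
  then show ?thesis by simp
qed

lemma approx_inner_Vop_telescope:
  assumes ai: "approx_inner x1 dt" and dt: "derivation x1 dt" and e: "e > 0"
  obtains K where "\<And>N. cmod (\<Sum>l<N. ent (dt Vop) (int l + 1) (int l)) \<le> real N * e + K"
proof -
  obtain y where y: "y \<in> Balg x1" "opnorm (op_sub (commutator y Vop) (dt Vop)) < e"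
    using approx_innerD[OF ai Vop_band e] .
  have yb: "bop y" by (rule Balg_bop[OF y(1)])
  have b: "bop (op_sub (commutator y Vop) (dt Vop))"
    by (intro bop_op_sub bop_commutator yb bandF_bop Vop_band derivation_bop[OF dt])
  define r where "r l = ent (op_sub (commutator y Vop) (dt Vop)) (int l + 1) (int l)" for l :: nat
  have r: "cmod (r l) \<le> e" for l
    using cmod_ent_le[OF b, of "int l + 1" "int l"] y(2) by (simp add: r_def)
  have v: "ent (dt Vop) (int l + 1) (int l) = (ent y (int (Suc l)) (int (Suc l)) - ent y (int l) (int l)) - r l" for l
    by (simp add: r_def commutator_def ent_generator_comp yb add.commute)
  \<comment> \<open>Telescoping leaves two entries of \<open>y\<close>, hence the constant 2 *
    opnorm y independent of N; the approximation error costs at most e per term.\<close>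
  have "cmod (\<Sum>l<N. ent (dt Vop) (int l + 1) (int l)) \<le> real N * e + 2 * opnorm y" for N
  proof -
    have "(\<Sum>l<N. ent (dt Vop) (int l + 1) (int l)) = (ent y (int N) (int N) - ent y 0 0) - (\<Sum>l<N. r l)"
      unfolding v sum_subtractf using sum_lessThan_telescope[of "\<lambda>l. ent y (int l) (int l)" N]
      by (simp add: sum_subtractf)
    moreover have "cmod (\<Sum>l<N. r l) \<le> (\<Sum>l<N. e)" by (intro sum_norm_le r)
    moreover have "cmod (ent y (int N) (int N)) \<le> opnorm y" "cmod (ent y 0 0) \<le> opnorm y"
      by (rule cmod_ent_le[OF yb])+
    ultimately show ?thesis
      using norm_triangle_ineq4[of "ent y (int N) (int N) - ent y 0 0" "\<Sum>l<N. r l"]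
        norm_triangle_ineq4[of "ent y (int N) (int N)" "ent y 0 0"] by simp
  qed
  then show ?thesis using that by blast
qed

lemma decomposition_unique:
  assumes 1: "decomposition x1 d c0 D dD dt" and 2: "decomposition x1 d c0' D' dD' dt'"
  shows "c0 = c0'" and "\<And>f. f \<in> Fspan \<Longrightarrow> D f = D' f" and "\<And>b. b \<in> Bcal x1 \<Longrightarrow> dt b = dt' b"
proof -
  have D: "phi_inv_derivation x1 D" "derivation x1 dD" "dD Vop = (\<lambda>_ _. 0)"
      "\<And>f. f \<in> Fspan \<Longrightarrow> dD (Mop x1 f) = Mop x1 (D f)" "derivation x1 dt" "approx_inner x1 dt"
      "\<And>b. b \<in> band Fspan \<Longrightarrow> d b = op_add (op_add (op_scale c0 (commL b)) (dD b)) (dt b)"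
    using 1 unfolding decomposition_def Bcal_eq by blast+
  have D': "phi_inv_derivation x1 D'" "derivation x1 dD'" "dD' Vop = (\<lambda>_ _. 0)"
      "\<And>f. f \<in> Fspan \<Longrightarrow> dD' (Mop x1 f) = Mop x1 (D' f)" "derivation x1 dt'" "approx_inner x1 dt'"
      "\<And>b. b \<in> band Fspan \<Longrightarrow> d b = op_add (op_add (op_scale c0' (commL b)) (dD' b)) (dt' b)"
    using 2 unfolding decomposition_def Bcal_eq by blast+
  have eq: "c0 * ent (commL b) i j + ent (dD b) i j + ent (dt b) i j = c0' * ent (commL b) i j + ent (dD' b) i j + ent (dt' b) i j"
    if "b \<in> band Fspan" for b i j
    using arg_cong[OF D(7)[OF that, symmetric, unfolded D'(7)[OF that]], of "\<lambda>T. ent T i j"] by simp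
  show Deq: "D f = D' f" if f: "f \<in> Fspan" for f
  proof (rule dense_eqI)
    show "continuous_on UNIV (D f)" "continuous_on UNIV (D' f)"
      using D_CG[OF D(1) f] D_CG[OF D'(1) f] by (auto simp: CG_def)
    show "D f (pt l) = D' f (pt l)" for l
      using eq[OF Mop_band[OF f], of l l]
      by (simp add: D(4) D'(4) f commL_band[OF Mop_band[OF f]] approx_inner_Mop_diagonal[OF D(6,5) f]
          approx_inner_Mop_diagonal[OF D'(6,5) f]) (simp add: Mop_VM ent_VM)
  qed
  have cV: "ent (commL Vop) (l + 1) l = 1" for l
    unfolding commL_band(2)[OF Vop_band] by (simp add: Vop_VM ent_VM)
  \<comment> \<open>At the entries (l + 1, l) of the values at V the commutator with the position
    operator is 1 and \<open>dD\<close> is 0. The difference of the constants therefore appears at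
    every l and can be averaged over l.\<close>
  have dV: "c0 - c0' = ent (dt' Vop) (l + 1) l - ent (dt Vop) (l + 1) l" for l
  proof -
    have "ent (dD Vop) (l + 1) l = 0" "ent (dD' Vop) (l + 1) l = 0" by (simp_all add: D(3) D'(3) ent_def)
    then have "c0 + ent (dt Vop) (l + 1) l = c0' + ent (dt' Vop) (l + 1) l"
      using eq[OF Vop_band, of "l + 1" l] by (simp add: cV)
    then show ?thesis by (simp add: algebra_simps)
  qed
  have "cmod (c0 - c0') \<le> e" if "e > 0" for e
  proof -
    \<comment> \<open>The two linear terms use up N * e/2 in total; the other half absorbs K + K'
      once N is large.\<close>
    have e: "e / 4 > 0" using that by simp
    obtain K where K: "\<And>N. cmod (\<Sum>l<N. ent (dt Vop) (int l + 1) (int l)) \<le> real N * (e / 4) + K"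
      using approx_inner_Vop_telescope[OF D(6,5) e] by blast
    obtain K' where K': "\<And>N. cmod (\<Sum>l<N. ent (dt' Vop) (int l + 1) (int l)) \<le> real N * (e / 4) + K'"
      using approx_inner_Vop_telescope[OF D'(6,5) e] by blast
    obtain N0 where N0: "2 * (K + K') / e < real N0" using reals_Archimedean2 by blast
    define N where "N = Suc N0"
    have N: "2 * (K + K') < real N * e" "real N > 0"
    proof -
      have "2 * (K + K') < real N0 * e" using N0 that by (simp add: field_simps)
      also have "\<dots> \<le> real N * e" using that by (intro mult_right_mono) (auto simp: N_def)
      finally show "2 * (K + K') < real N * e" .
    qed (simp add: N_def)
    have "of_nat N * (c0 - c0') = (\<Sum>l<N. c0 - c0')" by simp
    also have "\<dots> = (\<Sum>l<N. ent (dt' Vop) (int l + 1) (int l)) - (\<Sum>l<N. ent (dt Vop) (int l + 1) (int l))"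
      unfolding sum_subtractf[symmetric] by (intro sum.cong refl dV)
    finally have "cmod (of_nat N * (c0 - c0')) = cmod ((\<Sum>l<N. ent (dt' Vop) (int l + 1) (int l)) - (\<Sum>l<N. ent (dt Vop) (int l + 1) (int l)))"
      by simp
    then have "real N * cmod (c0 - c0') \<le> real N * (e / 4) + K + (real N * (e / 4) + K')"
      using norm_triangle_ineq4[of "\<Sum>l<N. ent (dt' Vop) (int l + 1) (int l)" "\<Sum>l<N. ent (dt Vop) (int l + 1) (int l)"]
        K[of N] K'[of N] unfolding norm_mult norm_of_nat by linarith
    also have "\<dots> \<le> real N * e" using N(1) by (simp add: field_simps)
    finally show ?thesis using N(2) by simp
  qed
  then have "cmod (c0 - c0') \<le> 0" by (rule field_le_epsilon) simp
  then show ceq: "c0 = c0'" by simp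
  fix b assume "b \<in> Bcal x1"
  then have b: "b \<in> band Fspan" by (simp add: Bcal_eq)
  have "dD b = dD' b"
    by (rule derivation_ext[OF D(2) D'(2) _ _ b]) (simp_all add: D(3,4) D'(3,4) Deq)
  then have "ent (dt b) i j = ent (dt' b) i j" for i j
    using eq[OF b, of i j] ceq by simp
  then show "dt b = dt' b"
    by (rule bop_eqI[OF derivation_bop[OF D(5) b] derivation_bop[OF D'(5) b]])
qed

end

theorem theorem3p15:
  fixes x1 :: "'g::{topological_ab_group_add, t2_space}"
    and d :: "op \<Rightarrow> op"
  assumes "compact (UNIV :: 'g set)"
    and "infinite (UNIV :: 'g set)"
    and "closure (range (\<lambda>n. gmult n x1)) = UNIV"
    and "derivation x1 d"
  shows "(\<exists>c0 D dD dt. decomposition x1 d c0 D dD dt) \<and>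
         (\<forall>c0 D dD dt c0' D' dD' dt'.
             decomposition x1 d c0 D dD dt \<longrightarrow> decomposition x1 d c0' D' dD' dt' \<longrightarrow>
             c0 = c0' \<and> (\<forall>f\<in>Fspan. D f = D' f) \<and> (\<forall>b\<in>Bcal x1. dt b = dt' b)) \<and>
         (\<forall>D dD dD'. phi_inv_derivation x1 D \<longrightarrow>
             derivation x1 dD \<longrightarrow> dD Vop = (\<lambda>_ _. 0) \<longrightarrow> (\<forall>f\<in>Fspan. dD (Mop x1 f) = Mop x1 (D f)) \<longrightarrow>
             derivation x1 dD' \<longrightarrow> dD' Vop = (\<lambda>_ _. 0) \<longrightarrow> (\<forall>f\<in>Fspan. dD' (Mop x1 f) = Mop x1 (D f)) \<longrightarrow>
             (\<forall>b\<in>Bcal x1. dD b = dD' b))"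
proof -
  interpret monothetic x1
    using assms(1-3) by unfold_locales
  have unique: "c0 = c0' \<and> (\<forall>f\<in>Fspan. D f = D' f) \<and> (\<forall>b\<in>Bcal x1. dt b = dt' b)"
    if "decomposition x1 d c0 D dD dt" "decomposition x1 d c0' D' dD' dt'" for c0 D dD dt c0' D' dD' dt'
    using decomposition_unique[OF that] by blast
  have ext: "\<forall>b\<in>Bcal x1. dD b = dD' b"
    if d: "derivation x1 dD" "dD Vop = (\<lambda>_ _. 0)" "\<forall>f\<in>Fspan. dD (Mop x1 f) = Mop x1 (D f)"
      "derivation x1 dD'" "dD' Vop = (\<lambda>_ _. 0)" "\<forall>f\<in>Fspan. dD' (Mop x1 f) = Mop x1 (D f)"
    for D :: "('g \<Rightarrow> complex) \<Rightarrow> 'g \<Rightarrow> complex" and dD dD'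
  proof
    fix b assume "b \<in> Bcal x1"
    then have b: "b \<in> band Fspan" by (simp add: Bcal_eq)
    have V: "dD Vop = dD' Vop" by (rule trans[OF d(2) d(5)[symmetric]])
    have M: "dD (Mop x1 f) = dD' (Mop x1 f)" if "f \<in> Fspan" for f using d(3,6) that by simp
    show "dD b = dD' b" by (rule derivation_ext[OF d(1,4) V M b])
  qed
  show ?thesis
    by (rule conjI[OF decomposition_exists[OF assms(4)] conjI]; intro allI impI; (rule unique | rule ext); assumption)
qed

end
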